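(* Let $h:[0,1)\to[0,1)$ be a wavelet induced isomorphism. Then there exist $u\in\mathcal{WI}_1$ and $v\in\mathcal{WI}_2$ such that $h=u\diamond v$ almost everywhere, where $u\diamond v$ is the Schröder–Cantor–Bernstein map built from $u$ and $v$. Conversely, for every $u\in\mathcal{WI}_1$ and every $v\in\mathcal{WI}_2$ the map $u\diamond v$ is a wavelet induced isomorphism. (The representation $h=u\diamond v$ a.e. is in general not unique, i.e. there are wavelet induced isomorphisms $h$ admitting more than one such pair $(u,v)$.)
   Context: $\mu$ is Lebesgue measure on $\mathbb{R}$; "measurable" means Lebesgue measurable; members of a partition may be empty. Wavelet sets. An orthonormal wavelet is $w\in L^2(\mathbb{R})$ such that $\{2^{j/2}w(2^j\cdot-k)\}_{j,k\in\mathbb{Z}}$ is an orthonormal basis of $L^2(\mathbb{R})$. With $\hat f(x)=\frac1{\sqrt{2\pi}}\int_{\mathbb{R}}e^{-itx}f(t)\,d\mu(t)$ (extended to $L^2(\mathbb{R})$), a measurable $W\subset\mathbb{R}$ is a wavelet set if $\frac1{\sqrt{\mu(W)}}\chi_W=\hat w$ for some orthonormal wavelet $w$. Let $E=[-2\pi,-\pi)\cup[\pi,2\pi)$; $\tau:\mathbb{R}\to E$, $\tau(x)=x+2j\pi$ with $j$ the unique integer such that $x+2j\pi\in E$; $\delta:\mathbb{R}\setminus\{0\}\to E$, $\delta(x)=2^kx$ with $k$ the unique integer such that $2^kx\in E$. It is a known fact that $W$ is a wavelet set if and only if there is a set $W'$ equal to $W$ a.e. such that $\tau_{|W'},\delta_{|W'}:W'\to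 E$ are measurable bijections. Wavelet induced isomorphisms. For a wavelet set $W$ (with $W'$ a set equal to $W$ a.e. such that $\tau_{|W'},\delta_{|W'}:W'\to E$ are measurable bijections) put $h_W=\tau_{|W'}\circ(\delta_{|W'})^{-1}:E\to E$ and $\tilde h_W=\xi\circ h_W\circ\xi^{-1}:[0,1)\to[0,1)$, where $\xi:E\to[0,1)$ is $\xi(x)=\frac{x}{2\pi}$ on $[\pi,2\pi)$ and $\xi(x)=\frac{x}{2\pi}+1$ on $[-2\pi,-\pi)$. These maps are determined by $W$ up to a.e. equality. The maps $\tilde h_W$ are called wavelet induced isomorphisms of $[0,1)$. Classes. $\mathcal{WI}_1$ is the class of all measurable maps $f:[0,1)\to[0,1)$ for which there are measurable partitions $\{A_k\}_{k\ge1}$ of $[\frac12,1)$ and $\{B_k\}_{k\ge1}$ of $[0,\frac12)$ with $f(x)=\frac{x}{2^k}$ for $x\in A_k$ and $f(x)=\frac{x-1}{2^k}+1$ for $x\in B_k$, $k\ge1$. $\mathcal{WI}_2$ is the class of all measurable one-to-one maps $g:[0,1)\to[0,1)$ such that for every $x\in[0,1)$ there are integers $k,l\ge0$ with $g(x)=\frac{x+l}{2^k}$. (Maps in $\mathcal{WI}_1$ are one-to-one.) Operation $\diamond$. For one-to-one maps $u:A\to B$ and $v:B\to A$, the map $u\diamond v:A\to B$ is defined by $(u\diamond v)(x)=u(x)$ for $x\in\bigcup_{k\ge0}(v\circ u)^k(A\setminus v(B))$, and $(u\diamond v)(x)=v^{-1}(x)$ for $x\in\bigcup_{k\ge0}(v\circ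 u)^k\big(v(B)\setminus(v\circ u)(A)\big)\cup\bigcap_{k\ge0}(v\circ u)^k(A)$; it is a bijection. Here $A=B=[0,1)$. *)

theory Defs
  imports "HOL-Analysis.Analysis"
begin

section \<open>Square-integrable functions and the Fourier transform\<close>

text \<open>Elements of the Hilbert space are represented by functions, not by equivalence classes;
  all the notions below are invariant under changes on null sets.\<close>

definition L2 :: "(real \<Rightarrow> complex) set" where
  "L2 = {f. f \<in> borel_measurable lebesgue \<and> integrable lebesgue (\<lambda>x. (norm (f x))\<^sup>2)}"

definition L2_inner :: "(real \<Rightarrow> complex) \<Rightarrow> (real \<Rightarrow> complex) \<Rightarrow> complex" where
  "L2_inner f g = (\<integral>x. f x * cnj (g x) \<partial>lebesgue)"

definition L2_dist :: "(real \<Rightarrow> complex) \<Rightarrow> (real \<Rightarrow> complex) \<Rightarrow> real" where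
  "L2_dist f g = sqrt (\<integral>x. (norm (f x - g x))\<^sup>2 \<partial>lebesgue)"

definition L2_lim :: "(nat \<Rightarrow> real \<Rightarrow> complex) \<Rightarrow> (real \<Rightarrow> complex) \<Rightarrow> bool" where
  "L2_lim \<phi> f \<longleftrightarrow> (\<forall>n. \<phi> n \<in> L2) \<and> f \<in> L2 \<and> (\<lambda>n. L2_dist (\<phi> n) f) \<longlonglongrightarrow> 0"

definition fourier :: "(real \<Rightarrow> complex) \<Rightarrow> real \<Rightarrow> complex" where
  "fourier f x = complex_of_real (1 / sqrt (2 * pi)) *
     (\<integral>t. exp (- (\<i> * complex_of_real t * complex_of_real x)) * f t \<partial>lebesgue)"

text \<open>The extension of \<^const>\<open>fourier\<close> by continuity from the integrable members of
  \<^const>\<open>L2\<close> to all of \<^const>\<open>L2\<close>. It is a relation because the transform is only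
  determined almost everywhere.\<close>

definition fourier_L2 :: "(real \<Rightarrow> complex) \<Rightarrow> (real \<Rightarrow> complex) \<Rightarrow> bool" where
  "fourier_L2 f g \<longleftrightarrow>
     (\<exists>\<phi>. (\<forall>n. integrable lebesgue (\<phi> n)) \<and> L2_lim \<phi> f \<and> L2_lim (\<lambda>n. fourier (\<phi> n)) g)"

section \<open>Wavelets and wavelet sets\<close>

definition wavelet_system :: "(real \<Rightarrow> complex) \<Rightarrow> int \<times> int \<Rightarrow> real \<Rightarrow> complex" where
  "wavelet_system w = (\<lambda>(j, k) x.
     complex_of_real (2 powr (of_int j / 2)) * w (2 powi j * x - of_int k))"

definition orthonormal_basis_L2 :: "('i \<Rightarrow> real \<Rightarrow> complex) \<Rightarrow> bool" where
  "orthonormal_basis_L2 \<psi> \<longleftrightarrow>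
     (\<forall>i. \<psi> i \<in> L2) \<and>
     (\<forall>i i'. L2_inner (\<psi> i) (\<psi> i') = (if i = i' then 1 else 0)) \<and>
     (\<forall>f\<in>L2. \<forall>e>0. \<exists>F c. finite F \<and> L2_dist f (\<lambda>x. \<Sum>i\<in>F. c i * \<psi> i x) < e)"

definition orthonormal_wavelet :: "(real \<Rightarrow> complex) \<Rightarrow> bool" where
  "orthonormal_wavelet w \<longleftrightarrow> w \<in> L2 \<and> orthonormal_basis_L2 (wavelet_system w)"

text \<open>If \<^term>\<open>W\<close> is null or has infinite measure, the function on the right is identically
  zero and hence not the transform of a wavelet, so such sets are excluded.\<close>

definition wavelet_set :: "real set \<Rightarrow> bool" where
  "wavelet_set W \<longleftrightarrow> W \<in> sets lebesgue \<and>
     (\<exists>w. orthonormal_wavelet w \<and>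
       fourier_L2 w (\<lambda>x. complex_of_real (1 / sqrt (measure lebesgue W) * indicator W x)))"

section \<open>Wavelet induced isomorphisms\<close>

definition E :: "real set" where
  "E = {-2 * pi..<-pi} \<union> {pi..<2 * pi}"

definition tau :: "real \<Rightarrow> real" where
  "tau x = x + 2 * of_int (THE j::int. x + 2 * of_int j * pi \<in> E) * pi"

text \<open>Only meaningful for nonzero arguments.\<close>

definition delta :: "real \<Rightarrow> real" where
  "delta x = 2 powi (THE k::int. 2 powi k * x \<in> E) * x"

definition xi :: "real \<Rightarrow> real" where
  "xi x = (if x \<in> {pi..<2 * pi} then x / (2 * pi) else x / (2 * pi) + 1)"

definition measurable_bij :: "(real \<Rightarrow> real) \<Rightarrow> real set \<Rightarrow> real set \<Rightarrow> bool" where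
  "measurable_bij f A B \<longleftrightarrow> f \<in> borel_measurable (lebesgue_on A) \<and> bij_betw f A B"

definition wavelet_set_version :: "real set \<Rightarrow> real set \<Rightarrow> bool" where
  "wavelet_set_version W W' \<longleftrightarrow>
     W' \<in> sets lebesgue \<and> 0 \<notin> W' \<and> (AE x in lebesgue. x \<in> W' \<longleftrightarrow> x \<in> W) \<and>
     measurable_bij tau W' E \<and> measurable_bij delta W' E"

definition h_map :: "real set \<Rightarrow> real \<Rightarrow> real" where
  "h_map W' = tau \<circ> inv_into W' delta"

definition h_tilde :: "real set \<Rightarrow> real \<Rightarrow> real" where
  "h_tilde W' = xi \<circ> h_map W' \<circ> inv_into E xi"

text \<open>Maps on \<open>[0,1)\<close> are total functions of which only the values on \<^term>\<open>{0..<1::real}\<close>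
  matter. The representative of \<^term>\<open>W\<close> may be chosen freely; for a chosen one,
  equality is required at every point of \<open>[0,1)\<close>.\<close>

definition wavelet_induced :: "(real \<Rightarrow> real) \<Rightarrow> bool" where
  "wavelet_induced h \<longleftrightarrow>
     (\<exists>W W'. wavelet_set W \<and> wavelet_set_version W W' \<and> (\<forall>x\<in>{0..<1}. h x = h_tilde W' x))"

section \<open>The two classes of maps and the Schroeder-Cantor-Bernstein map\<close>

definition measurable_partition :: "(nat \<Rightarrow> real set) \<Rightarrow> real set \<Rightarrow> bool" where
  "measurable_partition A S \<longleftrightarrow>
     (\<forall>k\<ge>1. A k \<in> sets lebesgue) \<and> disjoint_family_on A {1..} \<and> (\<Union>k\<in>{1..}. A k) = S"

definition WI1 :: "(real \<Rightarrow> real) set" where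
  "WI1 = {f. f \<in> {0..<1} \<rightarrow> {0..<1} \<and> f \<in> borel_measurable (lebesgue_on {0..<1}) \<and>
     (\<exists>A B. measurable_partition A {1/2..<1} \<and> measurable_partition B {0..<1/2} \<and>
       (\<forall>k\<ge>1. (\<forall>x\<in>A k. f x = x / 2 ^ k) \<and> (\<forall>x\<in>B k. f x = (x - 1) / 2 ^ k + 1)))}"

definition WI2 :: "(real \<Rightarrow> real) set" where
  "WI2 = {g. g \<in> {0..<1} \<rightarrow> {0..<1} \<and> g \<in> borel_measurable (lebesgue_on {0..<1}) \<and>
     inj_on g {0..<1} \<and> (\<forall>x\<in>{0..<1}. \<exists>k l :: nat. g x = (x + real l) / 2 ^ k)}"

text \<open>For injective \<open>u : A \<rightarrow> B\<close> and \<open>v : B \<rightarrow> A\<close> the two regions below partition \<^term>\<open>A\<close>,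
  so \<^term>\<open>undefined\<close> is never reached on \<^term>\<open>A\<close>.\<close>

definition scb_map :: "'a set \<Rightarrow> 'b set \<Rightarrow> ('a \<Rightarrow> 'b) \<Rightarrow> ('b \<Rightarrow> 'a) \<Rightarrow> 'a \<Rightarrow> 'b" where
  "scb_map A B u v x =
     (if x \<in> (\<Union>k. ((v \<circ> u) ^^ k) ` (A - v ` B)) then u x
      else if x \<in> (\<Union>k. ((v \<circ> u) ^^ k) ` (v ` B - (v \<circ> u) ` A)) \<union> (\<Inter>k. ((v \<circ> u) ^^ k) ` A)
      then inv_into B v x
      else undefined)"

abbreviation diamond :: "(real \<Rightarrow> real) \<Rightarrow> (real \<Rightarrow> real) \<Rightarrow> real \<Rightarrow> real" (infixl "\<diamondop>" 70) where
  "u \<diamondop> v \<equiv> scb_map {0..<1} {0..<1} u v"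

definition ae_eq :: "(real \<Rightarrow> real) \<Rightarrow> (real \<Rightarrow> real) \<Rightarrow> bool" where
  "ae_eq f g \<longleftrightarrow> (AE x in lebesgue_on {0..<1}. f x = g x)"

end

theory Submission
  imports Defs "HOL-Probability.Characteristic_Functions"
begin

text \<open>
  The proof works with a normal form of wavelet induced isomorphisms. The inverse of \<^const>\<open>xi\<close> is
  the map \<open>x \<mapsto> 2 pi (lift x)\<close>, where \<open>lift x\<close> is \<open>x - 1\<close> on the left half of \<open>[0,1)\<close> and \<open>x\<close> on the
  right half; in these coordinates the inverse of \<^const>\<open>delta\<close> on \<open>W'\<close> multiplies by a power of two, and
  \<^const>\<open>tau\<close> becomes reduction modulo one. So the isomorphisms are the bijections \<open>h\<close> of \<open>[0,1)\<close> of the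
  form \<open>h x = frac (2 powi (m x) * lift x)\<close> with a measurable integer exponent \<open>m\<close>
  (\<open>wavelet_inducedD\<close>, \<open>wavelet_inducedI\<close>).

  To get an isomorphism from such an \<open>h\<close>, one has to know that a measurable set \<open>W\<close> is a wavelet set
  if it meets every class modulo \<open>2 pi\<close> and every dyadic orbit of a nonzero number exactly once
  (\<open>wavelet_set_of_tile\<close>). The transforms of the dilated translates of the candidate wavelet are
  the functions \<open>2 powr (-j/2) * exp (-i k y)\<close> with \<open>y = x / 2^j\<close>, cut off to \<open>2^j W\<close> and divided by
  \<open>sqrt (2 pi)\<close>. For fixed \<open>j\<close> they behave like the trigonometric system on an interval of length
  \<open>2 pi\<close>, because \<open>W\<close> is a fundamental domain for the translations; for varying \<open>j\<close> they fill the sets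
  \<open>2^j W\<close>, which partition the line up to the origin. Plancherel's theorem carries the orthonormality
  and the completeness back to the wavelet. It is proved by Gaussian summation of Fourier integrals.

  In the normal form, a negative exponent gives exactly the formulas of \<^const>\<open>WI1\<close>
  (\<open>contracting_frac\<close>), while for a nonnegative exponent it is the inverse of \<open>h\<close> that has the form
  required in \<^const>\<open>WI2\<close> (\<open>inverse_of_expanding_frac\<close>). One half of the theorem follows:
  at each point \<open>u \<diamondop> v\<close> equals either \<open>u\<close> or the inverse of \<open>v\<close>, hence has the normal form, and it is
  a bijection by the argument of Schroeder and Bernstein (\<open>diamond_wavelet_induced\<close>).

  For the other half, let \<open>h\<close> be given, and let \<open>A\<^sub>-\<close> and \<open>A\<^sub>+\<close> be the sets where the exponent is
  negative and nonnegative. Put \<open>u = h\<close> on \<open>A\<^sub>-\<close> and let \<open>v\<close> be the inverse of \<open>h\<close> on \<open>h(A\<^sub>+)\<close>. It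
  remains to define \<open>v\<close> on \<open>h(A\<^sub>-)\<close>, injectively, with values in \<open>A\<^sub>-\<close> and by maps
  \<open>y \<mapsto> (y + l) / 2^k\<close>. A greedy choice among all these maps does this almost everywhere
  (\<open>dyadic_partial_injection\<close>): if two sets of positive measure remained unmatched, then some such
  map with large \<open>k\<close> would take a point of the first into the second
  (\<open>affine_meets_of_positive_measure\<close>). The null set of points not treated in this way is enlarged to
  a null set invariant under all maps in question, and \<open>v\<close> is the identity there.
  Now \<open>u\<close> at least halves measures and \<open>v\<close> does not increase them, so the intersection of the
  images of \<open>A\<^sub>-\<close> under the powers of \<open>v \<circ> u\<close> is null. Almost every point of \<open>A\<^sub>-\<close> is therefore
  reached from a point outside the range of \<open>v\<close>, so that \<open>u \<diamondop> v = u = h\<close> there, whereas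
  on \<open>A\<^sub>+\<close> it is the inverse of \<open>v\<close>, that is \<open>h\<close>, almost everywhere (\<open>wavelet_induced_diamond\<close>).

  Uniqueness fails because the range of \<open>v\<close> can be all of \<open>[0,1)\<close>; then \<open>u\<close> does not enter into
  \<open>u \<diamondop> v\<close> at all (\<open>diamond_not_unique\<close>).
\<close>

section \<open>Square-integrable functions and closed subspaces\<close>

text \<open>The square of the norm, as an extended nonnegative number: bounds and limits can then be stated
  without assuming finiteness first.\<close>

definition nsq :: "(real \<Rightarrow> complex) \<Rightarrow> ennreal" where
  "nsq f = (\<integral>\<^sup>+x. ennreal ((norm (f x))\<^sup>2) \<partial>lebesgue)"

lemma L2_iff: "f \<in> L2 \<longleftrightarrow> f \<in> borel_measurable lebesgue \<and> nsq f < \<infinity>"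
  unfolding L2_def nsq_def by (auto simp: integrable_iff_bounded)

lemma L2_measurable [measurable_dest]: "f \<in> L2 \<Longrightarrow> f \<in> borel_measurable lebesgue"
  by (simp add: L2_iff)

lemma nsq_cong_AE: "(AE x in lebesgue. f x = g x) \<Longrightarrow> nsq f = nsq g"
  unfolding nsq_def by (intro nn_integral_cong_AE) auto

lemma nsq_mono: "(\<And>x. norm (f x) \<le> norm (g x)) \<Longrightarrow> nsq f \<le> nsq g"
  unfolding nsq_def by (intro nn_integral_mono ennreal_leI power_mono) auto

lemma nsq_cmult: "f \<in> borel_measurable lebesgue \<Longrightarrow> nsq (\<lambda>x. c * f x) = ennreal ((norm c)\<^sup>2) * nsq f"
  unfolding nsq_def
  by (simp add: norm_mult power_mult_distrib ennreal_mult' nn_integral_cmult)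

lemma nsq_uminus: "nsq (\<lambda>x. - f x) = nsq f"
  by (simp add: nsq_def)

lemma nsq_minus_commute: "nsq (\<lambda>x. f x - g x) = nsq (\<lambda>x. g x - f x)"
  by (simp add: nsq_def norm_minus_commute)

lemma norm_add_square_le: "(norm (a + b))\<^sup>2 \<le> 2 * (norm a)\<^sup>2 + 2 * (norm (b::complex))\<^sup>2"
proof -
  have "(norm (a + b))\<^sup>2 \<le> (norm a + norm b)\<^sup>2"
    by (intro power_mono norm_triangle_ineq) auto
  also have "\<dots> \<le> 2 * (norm a)\<^sup>2 + 2 * (norm b)\<^sup>2"
    using sum_squares_bound[of "norm a" "norm b"] by (simp add: power2_sum)
  finally show ?thesis .
qed

text \<open>A triangle inequality up to a constant; unlike the sharp one it involves no square roots, and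
  approximation arguments are indifferent to the constant.\<close>

lemma nsq_add:
  assumes [measurable]: "f \<in> borel_measurable lebesgue" "g \<in> borel_measurable lebesgue"
  shows "nsq (\<lambda>x. f x + g x) \<le> 2 * nsq f + 2 * nsq g"
proof -
  have "nsq (\<lambda>x. f x + g x) \<le> (\<integral>\<^sup>+x. 2 * ennreal ((norm (f x))\<^sup>2) + 2 * ennreal ((norm (g x))\<^sup>2) \<partial>lebesgue)"
    unfolding nsq_def
  proof (rule nn_integral_mono)
    fix x
    have "ennreal ((norm (f x + g x))\<^sup>2) \<le> ennreal (2 * (norm (f x))\<^sup>2 + 2 * (norm (g x))\<^sup>2)"
      by (rule ennreal_leI[OF norm_add_square_le])
    then show "ennreal ((norm (f x + g x))\<^sup>2) \<le> 2 * ennreal ((norm (f x))\<^sup>2) + 2 * ennreal ((norm (g x))\<^sup>2)"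
      by (simp add: ennreal_mult')
  qed
  also have "\<dots> = 2 * nsq f + 2 * nsq g"
    unfolding nsq_def by (simp add: nn_integral_add nn_integral_cmult)
  finally show ?thesis .
qed

lemma L2_add: "f \<in> L2 \<Longrightarrow> g \<in> L2 \<Longrightarrow> (\<lambda>x. f x + g x) \<in> L2"
  unfolding L2_iff using nsq_add[of f g]
  by (auto simp: ennreal_mult_less_top intro: le_less_trans)

lemma L2_cmult: "f \<in> L2 \<Longrightarrow> (\<lambda>x. c * f x) \<in> L2"
  unfolding L2_iff by (auto simp: nsq_cmult ennreal_mult_less_top)

lemma L2_zero: "(\<lambda>x. 0) \<in> L2"
  by (simp add: L2_iff nsq_def)

lemma L2_diff: "f \<in> L2 \<Longrightarrow> g \<in> L2 \<Longrightarrow> (\<lambda>x. f x - g x) \<in> L2"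
  using L2_add[of f "\<lambda>x. (-1) * g x"] L2_cmult[of g "-1"] by simp

lemma L2_sum: "(\<And>i. i \<in> F \<Longrightarrow> f i \<in> L2) \<Longrightarrow> (\<lambda>x. \<Sum>i\<in>F. f i x) \<in> L2"
  by (induction F rule: infinite_finite_induct) (auto intro: L2_zero L2_add)

lemma L2_dist_less_iff:
  assumes "f \<in> L2" "g \<in> L2" "e > 0"
  shows "L2_dist f g < e \<longleftrightarrow> nsq (\<lambda>x. f x - g x) < ennreal (e\<^sup>2)"
proof -
  have i: "integrable lebesgue (\<lambda>x. (norm (f x - g x))\<^sup>2)"
    using L2_diff[OF assms(1,2)] by (simp add: L2_def)
  have "nsq (\<lambda>x. f x - g x) = ennreal (\<integral>x. (norm (f x - g x))\<^sup>2 \<partial>lebesgue)"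
    unfolding nsq_def by (rule nn_integral_eq_integral[OF i]) auto
  moreover have "L2_dist f g < e \<longleftrightarrow> (\<integral>x. (norm (f x - g x))\<^sup>2 \<partial>lebesgue) < e\<^sup>2"
    unfolding L2_dist_def using assms(3)
    by (metis real_sqrt_less_iff real_sqrt_abs abs_of_pos)
  ultimately show ?thesis
    using assms(3) by (simp add: ennreal_less_iff)
qed

lemma L2_dist_eq:
  assumes "f \<in> L2" "g \<in> L2"
  shows "L2_dist f g = sqrt (enn2real (nsq (\<lambda>x. f x - g x)))"
proof -
  have i: "integrable lebesgue (\<lambda>x. (norm (f x - g x))\<^sup>2)"
    using L2_diff[OF assms(1,2)] by (simp add: L2_def)
  show ?thesis unfolding L2_dist_def nsq_def
    by (subst integral_eq_nn_integral) (use i in auto)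
qed

text \<open>Closedness is phrased by approximability. Functions stand for their classes here, so a closed
  subspace contains with a function every function equal to it almost everywhere.\<close>

definition L2_closed_subspace :: "(real \<Rightarrow> complex) set \<Rightarrow> bool" where
  "L2_closed_subspace V \<longleftrightarrow> V \<subseteq> L2 \<and> (\<lambda>x. 0) \<in> V \<and>
     (\<forall>f\<in>V. \<forall>g\<in>V. (\<lambda>x. f x + g x) \<in> V) \<and> (\<forall>c. \<forall>f\<in>V. (\<lambda>x. c * f x) \<in> V) \<and>
     (\<forall>f\<in>L2. (\<forall>e>0. \<exists>g\<in>V. nsq (\<lambda>x. f x - g x) < ennreal e) \<longrightarrow> f \<in> V)"

lemma closed_subspaceD:
  assumes "L2_closed_subspace V"
  shows "f \<in> V \<Longrightarrow> f \<in> L2" "(\<lambda>x. 0) \<in> V" "f \<in> V \<Longrightarrow> g \<in> V \<Longrightarrow> (\<lambda>x. f x + g x) \<in> V"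
    "f \<in> V \<Longrightarrow> (\<lambda>x. c * f x) \<in> V"
  using assms by (auto simp: L2_closed_subspace_def)

lemma closed_subspace_limit:
  assumes "L2_closed_subspace V" "f \<in> L2" "\<And>e. e > 0 \<Longrightarrow> \<exists>g\<in>V. nsq (\<lambda>x. f x - g x) < ennreal e"
  shows "f \<in> V"
  using assms by (auto simp: L2_closed_subspace_def)

lemma closed_subspace_tendsto:
  assumes "L2_closed_subspace V" "f \<in> L2" "\<And>n::nat. g n \<in> V" "(\<lambda>n. nsq (\<lambda>x. f x - g n x)) \<longlonglongrightarrow> 0"
  shows "f \<in> V"
proof (rule closed_subspace_limit[OF assms(1,2)])
  fix e :: real assume "e > 0"
  then have "eventually (\<lambda>n. nsq (\<lambda>x. f x - g n x) < ennreal e) sequentially"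
    using assms(4) by (intro order_tendstoD) auto
  then obtain n where "nsq (\<lambda>x. f x - g n x) < ennreal e"
    by (meson eventually_happens' sequentially_bot)
  with assms(3) show "\<exists>g\<in>V. nsq (\<lambda>x. f x - g x) < ennreal e" by blast
qed

lemma closed_subspace_sum:
  assumes "L2_closed_subspace V" "\<And>i. i \<in> F \<Longrightarrow> f i \<in> V"
  shows "(\<lambda>x. \<Sum>i\<in>F. f i x) \<in> V"
  using assms(2) by (induction F rule: infinite_finite_induct) (auto intro: closed_subspaceD[OF assms(1)])

text \<open>The closed linear span of a system, written as in the definition of completeness of an
  orthonormal system.\<close>

definition L2_span :: "('i \<Rightarrow> real \<Rightarrow> complex) \<Rightarrow> (real \<Rightarrow> complex) set" where
  "L2_span \<psi> = {f\<in>L2. \<forall>e>0. \<exists>F c. finite F \<and> L2_dist f (\<lambda>x. \<Sum>i\<in>F. c i * \<psi> i x) < e}"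

lemma L2_span_iff:
  assumes \<psi>: "\<And>i. \<psi> i \<in> L2"
  shows "f \<in> L2_span \<psi> \<longleftrightarrow> f \<in> L2 \<and>
    (\<forall>e>0. \<exists>F c. finite F \<and> nsq (\<lambda>x. f x - (\<Sum>i\<in>F. c i * \<psi> i x)) < ennreal e)" (is "?l \<longleftrightarrow> ?r")
proof -
  have S: "(\<lambda>x. \<Sum>i\<in>F. c i * \<psi> i x) \<in> L2" for F c
    by (intro L2_sum L2_cmult \<psi>)
  show ?thesis
  proof
    assume l: ?l
    then have f: "f \<in> L2" by (simp add: L2_span_def)
    moreover have "\<exists>F c. finite F \<and> nsq (\<lambda>x. f x - (\<Sum>i\<in>F. c i * \<psi> i x)) < ennreal e" if e: "e > 0" for e
    proof -
      have "sqrt e > 0" using e by simp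
      with l obtain F c where "finite F" "L2_dist f (\<lambda>x. \<Sum>i\<in>F. c i * \<psi> i x) < sqrt e"
        unfolding L2_span_def by blast
      then show ?thesis
        using L2_dist_less_iff[OF f S \<open>sqrt e > 0\<close>] e by auto
    qed
    ultimately show ?r by blast
  next
    assume r: ?r
    show ?l unfolding L2_span_def
    proof (intro CollectI conjI allI impI)
      show f: "f \<in> L2" using r by simp
      fix e :: real assume e: "e > 0"
      then have "e\<^sup>2 > 0" by simp
      with r obtain F c where "finite F" "nsq (\<lambda>x. f x - (\<Sum>i\<in>F. c i * \<psi> i x)) < ennreal (e\<^sup>2)" by blast
      then show "\<exists>F c. finite F \<and> L2_dist f (\<lambda>x. \<Sum>i\<in>F. c i * \<psi> i x) < e"
        using L2_dist_less_iff[OF f S e] by auto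
    qed
  qed
qed

lemma nsq_approx_add:
  assumes [measurable]: "f \<in> borel_measurable lebesgue" "g \<in> borel_measurable lebesgue"
     and "nsq f < ennreal (e/4)" "nsq g < ennreal (e/4)" "e > 0"
   shows "nsq (\<lambda>x. f x + g x) < ennreal e"
proof -
  have "nsq (\<lambda>x. f x + g x) \<le> 2 * (nsq f + nsq g)"
    using nsq_add[of f g] by (simp add: distrib_left)
  also have "\<dots> < 2 * (ennreal (e/4) + ennreal (e/4))"
    using assms(3,4) by (intro ennreal_mult_strict_left_mono add_strict_mono) auto
  also have "\<dots> = ennreal e" using assms(5) by (simp flip: ennreal_plus ennreal_numeral ennreal_mult'')
  finally show ?thesis .
qed

lemma nsq_approx_trans:
  assumes [measurable]: "f \<in> borel_measurable lebesgue" "g \<in> borel_measurable lebesgue" "h \<in> borel_measurable lebesgue"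
     and "nsq (\<lambda>x. f x - g x) < ennreal (e/4)" "nsq (\<lambda>x. g x - h x) < ennreal (e/4)" "e > 0"
   shows "nsq (\<lambda>x. f x - h x) < ennreal e"
  using nsq_approx_add[of "\<lambda>x. f x - g x" "\<lambda>x. g x - h x" e] assms by simp

lemma sum_extend_zero:
  fixes f :: "'i \<Rightarrow> 'a::comm_ring"
  assumes "finite G" "F \<subseteq> G"
  shows "(\<Sum>i\<in>F. c i * f i) = (\<Sum>i\<in>G. (if i \<in> F then c i else 0) * f i)"
  using assms by (intro sum.mono_neutral_cong_left) auto

text \<open>This makes every density theorem for closed subspaces available for proving that a system is
  complete.\<close>

lemma closed_subspace_L2_span:
  assumes \<psi>: "\<And>i. \<psi> i \<in> L2"
  shows "L2_closed_subspace (L2_span \<psi>)"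
proof -
  note iff = L2_span_iff[OF \<psi>]
  have S: "(\<lambda>x. \<Sum>i\<in>F. c i * \<psi> i x) \<in> L2" for F c
    by (intro L2_sum L2_cmult \<psi>)
  show ?thesis
    unfolding L2_closed_subspace_def
  proof (intro conjI ballI allI impI)
    show "L2_span \<psi> \<subseteq> L2" by (auto simp: L2_span_def)
    have "\<exists>F c. finite F \<and> nsq (\<lambda>x. 0 - (\<Sum>i\<in>F. c i * \<psi> i x)) < ennreal e" if "e > 0" for e
      using that by (intro exI[of _ "{}"]) (auto simp: nsq_def)
    then show "(\<lambda>x. 0) \<in> L2_span \<psi>"
      by (simp only: iff) (auto intro: L2_zero)
  next
    fix f g assume f: "f \<in> L2_span \<psi>" and g: "g \<in> L2_span \<psi>"
    then have [measurable]: "f \<in> borel_measurable lebesgue" "g \<in> borel_measurable lebesgue"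
      by (auto simp: L2_span_def L2_iff)
    show "(\<lambda>x. f x + g x) \<in> L2_span \<psi>"
    proof (subst iff, intro conjI allI impI)
      show "(\<lambda>x. f x + g x) \<in> L2" using f g by (auto intro: L2_add simp: L2_span_def)
      fix e :: real assume e: "e > 0"
      obtain F c where F: "finite F" "nsq (\<lambda>x. f x - (\<Sum>i\<in>F. c i * \<psi> i x)) < ennreal (e/4)"
        using f e unfolding iff by (meson divide_pos_pos zero_less_numeral)
      obtain G d where G: "finite G" "nsq (\<lambda>x. g x - (\<Sum>i\<in>G. d i * \<psi> i x)) < ennreal (e/4)"
        using g e unfolding iff by (meson divide_pos_pos zero_less_numeral)
      \<comment> \<open>The two approximating sums run over different index sets and are extended by zero coefficients.\<close>
      define b where "b i = (if i \<in> F then c i else 0) + (if i \<in> G then d i else 0)" for i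
      have "(\<Sum>i\<in>F. c i * \<psi> i x) + (\<Sum>i\<in>G. d i * \<psi> i x) = (\<Sum>i\<in>F \<union> G. b i * \<psi> i x)" for x
        using F(1) G(1) sum_extend_zero[of "F \<union> G" F c "\<lambda>i. \<psi> i x"] sum_extend_zero[of "F \<union> G" G d "\<lambda>i. \<psi> i x"]
        by (simp only: b_def distrib_right sum.distrib) auto
      then have eq: "f x + g x - (\<Sum>i\<in>F \<union> G. b i * \<psi> i x)
        = (f x - (\<Sum>i\<in>F. c i * \<psi> i x)) + (g x - (\<Sum>i\<in>G. d i * \<psi> i x))" for x
        by (metis add_diff_add)
      show "\<exists>F c. finite F \<and> nsq (\<lambda>x. f x + g x - (\<Sum>i\<in>F. c i * \<psi> i x)) < ennreal e"
        proof (intro exI[of _ "F \<union> G"] exI[of _ b] conjI)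
        show "finite (F \<union> G)" using F G by simp
        show "nsq (\<lambda>x. f x + g x - (\<Sum>i\<in>F \<union> G. b i * \<psi> i x)) < ennreal e"
          unfolding eq by (intro nsq_approx_add F G e borel_measurable_diff L2_measurable[OF S]) auto
      qed
    qed
  next
    fix a f assume f: "f \<in> L2_span \<psi>"
    show "(\<lambda>x. a * f x) \<in> L2_span \<psi>"
    proof (subst iff, intro conjI allI impI)
      show "(\<lambda>x. a * f x) \<in> L2" using f by (auto intro: L2_cmult simp: L2_span_def)
      fix e :: real assume e: "e > 0"
      \<comment> \<open>Adding one avoids a division by zero when the scalar vanishes.\<close>
      define K where "K = (norm a)\<^sup>2 + 1"
      have K: "K > 0" by (simp add: K_def add_nonneg_pos)
      then have "e / K > 0" using e by simp
      then obtain F c where F: "finite F" "nsq (\<lambda>x. f x - (\<Sum>i\<in>F. c i * \<psi> i x)) < ennreal (e/K)"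
        using f unfolding iff by meson
      have "nsq (\<lambda>x. a * f x - (\<Sum>i\<in>F. (a * c i) * \<psi> i x)) = nsq (\<lambda>x. a * (f x - (\<Sum>i\<in>F. c i * \<psi> i x)))"
        by (simp add: right_diff_distrib sum_distrib_left mult.assoc)
      also have "\<dots> = ennreal ((norm a)\<^sup>2) * nsq (\<lambda>x. f x - (\<Sum>i\<in>F. c i * \<psi> i x))"
        using f by (intro nsq_cmult borel_measurable_diff L2_measurable[OF S]) (auto simp: L2_span_def L2_iff)
      also have "\<dots> \<le> ennreal K * nsq (\<lambda>x. f x - (\<Sum>i\<in>F. c i * \<psi> i x))"
        by (intro mult_right_mono ennreal_leI) (auto simp: K_def)
      also have "\<dots> < ennreal K * ennreal (e / K)"
        using F K by (intro ennreal_mult_strict_left_mono) auto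
      also have "\<dots> = ennreal e" using K e by (simp flip: ennreal_mult'')
      finally show "\<exists>F c. finite F \<and> nsq (\<lambda>x. a * f x - (\<Sum>i\<in>F. c i * \<psi> i x)) < ennreal e"
        using F(1) by (intro exI[of _ F] exI[of _ "\<lambda>i. a * c i"]) auto
    qed
  next
    fix f assume f: "f \<in> L2" and lim: "\<forall>e>0. \<exists>g\<in>L2_span \<psi>. nsq (\<lambda>x. f x - g x) < ennreal e"
    show "f \<in> L2_span \<psi>"
    proof (subst iff, intro conjI allI impI f)
      fix e :: real assume e: "e > 0"
      then obtain g where g: "g \<in> L2_span \<psi>" "nsq (\<lambda>x. f x - g x) < ennreal (e/4)"
        using lim by (meson divide_pos_pos zero_less_numeral)
      obtain F c where F: "finite F" "nsq (\<lambda>x. g x - (\<Sum>i\<in>F. c i * \<psi> i x)) < ennreal (e/4)"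
        using g(1) e unfolding iff by (meson divide_pos_pos zero_less_numeral)
      have "nsq (\<lambda>x. f x - (\<Sum>i\<in>F. c i * \<psi> i x)) < ennreal e"
        using f g(1) by (intro nsq_approx_trans[OF _ _ _ g(2) F(2) e] L2_measurable[OF S]) (auto simp: L2_span_def L2_iff)
      with F(1) show "\<exists>F c. finite F \<and> nsq (\<lambda>x. f x - (\<Sum>i\<in>F. c i * \<psi> i x)) < ennreal e"
        by blast
    qed
  qed
qed

lemma in_L2_span:
  assumes \<psi>: "\<And>i. \<psi> i \<in> L2"
  shows "\<psi> i \<in> L2_span \<psi>"
  unfolding L2_span_iff[OF \<psi>]
proof (intro conjI allI impI \<psi>)
  fix e :: real assume "e > 0"
  then show "\<exists>F c. finite F \<and> nsq (\<lambda>x. \<psi> i x - (\<Sum>i\<in>F. c i * \<psi> i x)) < ennreal e"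
    by (intro exI[of _ "{i}"] exI[of _ "\<lambda>_. 1"]) (auto simp: nsq_def)
qed

lemma L2_span_least:
  assumes U: "L2_closed_subspace U" and \<psi>: "\<And>i. \<psi> i \<in> U"
  shows "L2_span \<psi> \<subseteq> U"
proof
  fix f assume f: "f \<in> L2_span \<psi>"
  have \<psi>2: "\<psi> i \<in> L2" for i using closed_subspaceD(1)[OF U \<psi>] .
  show "f \<in> U"
  proof (rule closed_subspace_limit[OF U])
    show "f \<in> L2" using f by (simp add: L2_span_def)
    fix e :: real assume "e > 0"
    then obtain F c where F: "finite F" "nsq (\<lambda>x. f x - (\<Sum>i\<in>F. c i * \<psi> i x)) < ennreal e"
      using f unfolding L2_span_iff[OF \<psi>2] by meson
    moreover have "(\<lambda>x. \<Sum>i\<in>F. c i * \<psi> i x) \<in> U"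
      by (intro closed_subspace_sum[OF U] closed_subspaceD(4)[OF U] \<psi>)
    ultimately show "\<exists>g\<in>U. nsq (\<lambda>x. f x - g x) < ennreal e"
      by (intro bexI[where x="\<lambda>x. \<Sum>i\<in>F. c i * \<psi> i x"]) auto
  qed
qed

lemma ennreal_tendsto_0_iff:
  fixes X :: "'a \<Rightarrow> ennreal"
  shows "(X \<longlongrightarrow> 0) F \<longleftrightarrow> (\<forall>e>0::real. eventually (\<lambda>x. X x < ennreal e) F)"
proof (intro iffI allI impI)
  fix e :: real assume "(X \<longlongrightarrow> 0) F" "e > 0"
  then show "eventually (\<lambda>x. X x < ennreal e) F" by (intro order_tendstoD) auto
next
  assume a: "\<forall>e>0::real. eventually (\<lambda>x. X x < ennreal e) F"
  show "(X \<longlongrightarrow> 0) F"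
  proof (rule order_tendstoI)
    fix e :: ennreal assume "0 < e"
    then obtain r where "0 < r" "r < e" using dense by blast
    then obtain r' where r': "r = ennreal r'" "r' > 0"
      by (cases r) (auto simp: order_less_le top_unique)
    then have "eventually (\<lambda>x. X x < r) F" using a by simp
    then show "eventually (\<lambda>x. X x < e) F"
      using \<open>r < e\<close> by (auto elim!: eventually_mono)
  qed simp
qed

lemma measurable_cnj [measurable]: "cnj \<in> borel_measurable borel"
  by (intro borel_measurable_continuous_onI continuous_intros)

text \<open>Weighted form of \<open>2 a b \<le> a\<^sup>2 + b\<^sup>2\<close>. The free weight makes it as useful as the
  Cauchy-Schwarz inequality when one factor tends to zero.\<close>

lemma L2_product_bound:
  assumes [measurable]: "f \<in> borel_measurable lebesgue" "g \<in> borel_measurable lebesgue" and t: "t > 0"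
  shows "(\<integral>\<^sup>+x. ennreal (norm (f x * cnj (g x))) \<partial>lebesgue) \<le> ennreal t * nsq f + ennreal (1/t) * nsq g"
proof -
  have "(\<integral>\<^sup>+x. ennreal (norm (f x * cnj (g x))) \<partial>lebesgue)
    \<le> (\<integral>\<^sup>+x. ennreal t * ennreal ((norm (f x))\<^sup>2) + ennreal (1/t) * ennreal ((norm (g x))\<^sup>2) \<partial>lebesgue)"
  proof (rule nn_integral_mono)
    fix x
    have "0 \<le> (t * norm (f x) - norm (g x))\<^sup>2 / t" using t by simp
    also have "\<dots> = t * (norm (f x))\<^sup>2 + (norm (g x))\<^sup>2 / t - 2 * norm (f x) * norm (g x)"
      using t by (simp add: power2_eq_square field_simps)
    finally have "norm (f x) * norm (g x) \<le> t * (norm (f x))\<^sup>2 + 1/t * (norm (g x))\<^sup>2"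
      using mult_nonneg_nonneg[of "norm (f x)" "norm (g x)"] by (simp del: mult_nonneg_nonneg)
    then have "ennreal (norm (f x * cnj (g x))) \<le> ennreal (t * (norm (f x))\<^sup>2 + 1/t * (norm (g x))\<^sup>2)"
      by (intro ennreal_leI) (simp add: norm_mult)
    then show "ennreal (norm (f x * cnj (g x))) \<le> ennreal t * ennreal ((norm (f x))\<^sup>2) + ennreal (1/t) * ennreal ((norm (g x))\<^sup>2)"
      using t ennreal_mult''[of "(norm (g x))\<^sup>2" "1/t"] by (simp add: ennreal_mult'')
  qed
  also have "\<dots> = ennreal t * nsq f + ennreal (1/t) * nsq g"
    unfolding nsq_def by (simp add: nn_integral_add nn_integral_cmult)
  finally show ?thesis .
qed

lemma integrable_L2_product:
  assumes "f \<in> L2" "g \<in> L2"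
  shows "integrable lebesgue (\<lambda>x. f x * cnj (g x))"
proof (rule integrableI_bounded)
  have [measurable]: "f \<in> borel_measurable lebesgue" "g \<in> borel_measurable lebesgue"
    using assms by (auto simp: L2_iff)
  show "(\<lambda>x. f x * cnj (g x)) \<in> borel_measurable lebesgue" by measurable
  have "(\<integral>\<^sup>+x. ennreal (norm (f x * cnj (g x))) \<partial>lebesgue) \<le> 1 * nsq f + 1 * nsq g"
    using L2_product_bound[of f g 1] by simp
  also have "\<dots> < \<infinity>" using assms by (simp add: L2_iff)
  finally show "(\<integral>\<^sup>+x. ennreal (norm (f x * cnj (g x))) \<partial>lebesgue) < \<infinity>" .
qed

lemma L2_inner_tendsto:
  assumes f: "\<And>n. f n \<in> L2" "f0 \<in> L2" and g: "g \<in> L2" and lim: "((\<lambda>n. nsq (\<lambda>x. f n x - f0 x)) \<longlongrightarrow> 0) F"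
  shows "((\<lambda>n. L2_inner (f n) g) \<longlongrightarrow> L2_inner f0 g) F"
proof -
  have [measurable]: "f n \<in> borel_measurable lebesgue" "f0 \<in> borel_measurable lebesgue" "g \<in> borel_measurable lebesgue" for n
    using f g by (auto simp: L2_iff)
  have le: "ennreal (norm (L2_inner (f n) g - L2_inner f0 g))
     \<le> ennreal t * nsq (\<lambda>x. f n x - f0 x) + ennreal (1/t) * nsq g" if "t > 0" for n t
  proof -
    have "L2_inner (f n) g - L2_inner f0 g = (\<integral>x. (f n x - f0 x) * cnj (g x) \<partial>lebesgue)"
      unfolding L2_inner_def
      by (subst Bochner_Integration.integral_diff[symmetric]) (auto intro: integrable_L2_product f g simp: left_diff_distrib)
    also have "ennreal (norm \<dots>) \<le> (\<integral>\<^sup>+x. ennreal (norm ((f n x - f0 x) * cnj (g x))) \<partial>lebesgue)"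
      by (intro integral_norm_bound_ennreal integrable_L2_product L2_diff f g)
    also have "\<dots> \<le> ennreal t * nsq (\<lambda>x. f n x - f0 x) + ennreal (1/t) * nsq g"
      by (intro L2_product_bound that) measurable
    finally show ?thesis .
  qed
  obtain G where G: "nsq g = ennreal G" "G \<ge> 0" using g by (cases "nsq g") (auto simp: L2_iff)
  show ?thesis
  proof (rule tendstoI)
    fix e :: real assume e: "e > 0"
    \<comment> \<open>With this weight the term of the fixed function \<open>g\<close> stays below \<open>e/2\<close>; the other term is small
      eventually.\<close>
    define t where "t = 2 * (G + 1) / e"
    have t: "t > 0" using e G by (simp add: t_def)
    have "eventually (\<lambda>n. nsq (\<lambda>x. f n x - f0 x) < ennreal (e / (2 * t))) F"
      using lim e t unfolding ennreal_tendsto_0_iff by simp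
    then show "eventually (\<lambda>n. dist (L2_inner (f n) g) (L2_inner f0 g) < e) F"
    proof eventually_elim
      case (elim n)
      have "ennreal (norm (L2_inner (f n) g - L2_inner f0 g)) \<le> ennreal t * nsq (\<lambda>x. f n x - f0 x) + ennreal (1/t) * nsq g"
        by (rule le[OF t])
      also have "\<dots> \<le> ennreal t * ennreal (e / (2 * t)) + ennreal (1/t) * ennreal G"
        using elim G by (intro add_mono mult_left_mono) auto
      also have "\<dots> = ennreal (t * (e / (2*t)) + 1/t * G)"
        using t e G by (simp flip: ennreal_mult ennreal_plus)
      also have "t * (e / (2*t)) + 1/t * G < e"
      proof -
        have "1/t * G = e/2 * (G / (G + 1))" using e G by (simp add: t_def field_simps)
        also have "\<dots> < e/2 * 1" using e G by (intro mult_strict_left_mono) auto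
        finally show ?thesis using t by (simp only: mult_1_right) (simp add: field_simps)
      qed
      then have "ennreal (t * (e / (2*t)) + 1/t * G) < ennreal e"
        using e by (intro ennreal_lessI)
      finally show ?case using e by (simp add: dist_norm ennreal_less_iff)
    qed
  qed
qed

section \<open>Density criteria and continuity of translations\<close>

lemma nsq_dominated_convergence:
  fixes u :: "nat \<Rightarrow> real \<Rightarrow> complex"
  assumes [measurable]: "\<And>n. u n \<in> borel_measurable lebesgue" and w: "w \<in> L2"
    and le: "\<And>n x. norm (u n x) \<le> norm (w x)" and lim: "AE x in lebesgue. (\<lambda>n. u n x) \<longlonglongrightarrow> 0"
  shows "(\<lambda>n. nsq (u n)) \<longlonglongrightarrow> 0"
proof -
  have [measurable]: "w \<in> borel_measurable lebesgue" using w by (simp add: L2_iff)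
  have "(\<lambda>n. \<integral>\<^sup>+x. ennreal ((norm (u n x))\<^sup>2) \<partial>lebesgue) \<longlonglongrightarrow> (\<integral>\<^sup>+x. 0 \<partial>(lebesgue::real measure))"
  proof (rule nn_integral_dominated_convergence[where w="\<lambda>x. ennreal ((norm (w x))\<^sup>2)"])
    show "(\<integral>\<^sup>+x. ennreal ((norm (w x))\<^sup>2) \<partial>lebesgue) < \<infinity>"
      using w by (simp add: L2_iff nsq_def)
    show "AE x in lebesgue. ennreal ((norm (u j x))\<^sup>2) \<le> ennreal ((norm (w x))\<^sup>2)" for j
      using le by (intro always_eventually allI ennreal_leI power_mono) auto
    show "AE x in lebesgue. (\<lambda>n. ennreal ((norm (u n x))\<^sup>2)) \<longlonglongrightarrow> 0"
      using lim
    proof eventually_elim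
      case (elim x)
      have "(\<lambda>n. ennreal ((norm (u n x))\<^sup>2)) \<longlonglongrightarrow> ennreal ((norm (0::complex))\<^sup>2)"
        by (intro tendsto_ennrealI tendsto_intros elim)
      then show ?case by simp
    qed
  qed auto
  then show ?thesis by (simp add: nsq_def)
qed

lemma nsq_indicator:
  assumes "S \<in> sets lebesgue"
  shows "nsq (\<lambda>x. complex_of_real (indicator S x)) = emeasure lebesgue S"
proof -
  have "nsq (\<lambda>x. complex_of_real (indicator S x)) = (\<integral>\<^sup>+x. indicator S x \<partial>lebesgue)"
    unfolding nsq_def by (intro nn_integral_cong) (auto simp: indicator_def)
  then show ?thesis using assms by simp
qed
lemma indicator_L2:
  assumes "S \<in> sets lebesgue" "emeasure lebesgue S < \<infinity>"
  shows "(\<lambda>x. complex_of_real (indicator S x)) \<in> L2"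
  using assms by (simp add: L2_iff nsq_indicator)

text \<open>Regularity of Lebesgue measure puts \<open>S\<close> between a closed and an open set of almost the same measure,
  and an Urysohn function between these two differs from the indicator of \<open>S\<close> on a small set only.\<close>

lemma closed_subspace_indicator:
  assumes V: "L2_closed_subspace V"
    and cont: "\<And>f::real\<Rightarrow>real. continuous_on UNIV f \<Longrightarrow> (\<And>x. 0 \<le> f x \<and> f x \<le> 1) \<Longrightarrow>
      (\<And>x. x \<notin> {a<..<b} \<Longrightarrow> f x = 0) \<Longrightarrow> (\<lambda>x. complex_of_real (f x)) \<in> V"
    and S: "S \<in> sets lebesgue" "S \<subseteq> {a<..<b}"
  shows "(\<lambda>x. complex_of_real (indicator S x)) \<in> V"
proof (rule closed_subspace_limit[OF V])
  have "emeasure lebesgue S \<le> emeasure lebesgue {a<..<b}"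
    using S by (intro emeasure_mono) auto
  also have "\<dots> < \<infinity>" by (cases "a \<le> b") auto
  finally show "(\<lambda>x. complex_of_real (indicator S x)) \<in> L2" using S(1) by (intro indicator_L2)
  fix e :: real assume e: "e > 0"
  then have e2: "e/2 > 0" by simp
  obtain K where K: "closed K" "K \<subseteq> S" "S - K \<in> lmeasurable" "emeasure lebesgue (S - K) < ennreal (e/2)"
    using sets_lebesgue_inner_closed[OF S(1) e2] by metis
  obtain U where U: "open U" "S \<subseteq> U" "U - S \<in> lmeasurable" "emeasure lebesgue (U - S) < ennreal (e/2)"
    using sets_lebesgue_outer_open[OF S(1) e2] by metis
  \<comment> \<open>Cutting off the open set keeps the support of the Urysohn function inside the interval.\<close>
  define U' where "U' = U \<inter> {a<..<b}"
  have "open U'" using U by (auto simp: U'_def)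
  then have "closed (- U')" by auto
  moreover have "K \<inter> - U' = {}" using K U S by (auto simp: U'_def)
  ultimately obtain f :: "real \<Rightarrow> real" where f: "continuous_on UNIV f" "\<And>x. f x \<in> closed_segment 1 0"
     "\<And>x. x \<in> K \<Longrightarrow> f x = 1" "\<And>x. x \<in> - U' \<Longrightarrow> f x = 0"
    using Urysohn[OF \<open>closed K\<close>, of "- U'" 1 0] by metis
  have f01: "0 \<le> f x \<and> f x \<le> 1" for x
    using f(2)[of x] by (auto simp: closed_segment_eq_real_ivl)
  have "(\<lambda>x. complex_of_real (f x)) \<in> V"
    using f(4) by (intro cont f(1) f01) (auto simp: U'_def)
  moreover have "nsq (\<lambda>x. complex_of_real (indicator S x) - complex_of_real (f x)) < ennreal e"
  proof -
    have "nsq (\<lambda>x. complex_of_real (indicator S x) - complex_of_real (f x))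
       \<le> (\<integral>\<^sup>+x. indicator (U - S) x + indicator (S - K) x \<partial>lebesgue)"
      unfolding nsq_def
    proof (rule nn_integral_mono)
      fix x
      have "(norm (complex_of_real (indicator S x) - complex_of_real (f x)))\<^sup>2 \<le> 1"
      proof (rule power_le_one)
        show "cmod (complex_of_real (indicat_real S x) - complex_of_real (f x)) \<le> 1"
          using f01[of x] by (simp only: flip: of_real_diff, simp only: norm_of_real) (auto simp: indicator_def)
      qed simp
      moreover have "x \<in> K \<Longrightarrow> indicator S x = f x" "x \<notin> U \<Longrightarrow> indicator S x = f x"
        using f(3,4) K U by (auto simp: U'_def indicator_def)
      ultimately show "ennreal ((norm (complex_of_real (indicator S x) - complex_of_real (f x)))\<^sup>2)
         \<le> indicator (U - S) x + indicator (S - K) x"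
        by (cases "x \<in> K"; cases "x \<in> U"; cases "x \<in> S")
          (auto simp: indicator_def ennreal_le_1 K(2)[THEN subsetD] U(2)[THEN subsetD])
    qed
    also have "\<dots> = emeasure lebesgue (U - S) + emeasure lebesgue (S - K)"
      using U K by (subst nn_integral_add) auto
    also have "\<dots> < ennreal (e/2) + ennreal (e/2)"
      using U K by (intro add_strict_mono) auto
    also have "\<dots> = ennreal e" using e by (simp flip: ennreal_plus)
    finally show ?thesis .
  qed
  ultimately show "\<exists>g\<in>V. nsq (\<lambda>x. complex_of_real (indicator S x) - g x) < ennreal e"
    by (intro bexI[where x="\<lambda>x. complex_of_real (f x)"])
qed

text \<open>A square-integrable \<open>f\<close> is the limit of simple functions bounded by \<open>2 |f|\<close>. Their level sets for
  nonzero values have finite measure by Chebyshev's inequality.\<close>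

lemma closed_subspace_eq_L2:
  assumes V: "L2_closed_subspace V"
    and ind: "\<And>S. S \<in> sets lebesgue \<Longrightarrow> emeasure lebesgue S < \<infinity> \<Longrightarrow> (\<lambda>x. complex_of_real (indicator S x)) \<in> V"
  shows "V = L2"
proof
  show "V \<subseteq> L2" using V by (auto simp: L2_closed_subspace_def)
  show "L2 \<subseteq> V"
  proof
    fix f assume f: "f \<in> L2"
    have fm [measurable]: "f \<in> borel_measurable lebesgue" using f by (simp add: L2_iff)
    obtain F where F: "\<And>i. simple_function lebesgue (F i)" "\<And>x. (\<lambda>i. F i x) \<longlonglongrightarrow> f x"
      "\<And>i x. norm (F i x) \<le> 2 * norm (f x)"
      using borel_measurable_implies_sequence_metric[OF fm, of 0] by auto
    have Fm [measurable]: "F i \<in> borel_measurable lebesgue" for i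
      using F(1) by (rule borel_measurable_simple_function)
    have FV: "F i \<in> V" for i
    proof -
      have fin: "finite (range (F i))" using F(1)[of i] by (simp add: simple_function_def)
      have m: "F i -` {y} \<in> sets lebesgue" for y
        using measurable_sets[OF Fm, of "{y}" i] by simp
      have eq: "F i x = (\<Sum>y\<in>range (F i) - {0}. y * complex_of_real (indicator (F i -` {y}) x))" for x
      proof -
        have "(\<Sum>y\<in>range (F i) - {0}. y * complex_of_real (indicator (F i -` {y}) x))
          = (\<Sum>y\<in>range (F i) - {0}. if y = F i x then y else 0)"
          by (intro sum.cong) (auto simp: indicator_def)
        also have "\<dots> = F i x"
          using fin by (subst sum.delta) auto
        finally show ?thesis by simp
      qed
      have "(\<lambda>x. \<Sum>y\<in>range (F i) - {0}. y * complex_of_real (indicator (F i -` {y}) x)) \<in> V"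
      proof (intro closed_subspace_sum[OF V] closed_subspaceD(4)[OF V] ind m)
        fix y assume y: "y \<in> range (F i) - {0}"
        have "ennreal ((norm y / 2)\<^sup>2) * emeasure lebesgue (F i -` {y})
           = (\<integral>\<^sup>+x. ennreal ((norm y / 2)\<^sup>2) * indicator (F i -` {y}) x \<partial>lebesgue)"
          using m by (simp add: nn_integral_cmult)
        also have "\<dots> \<le> nsq f" unfolding nsq_def
        proof (rule nn_integral_mono)
          fix x
          show "ennreal ((norm y / 2)\<^sup>2) * indicator (F i -` {y}) x \<le> ennreal ((norm (f x))\<^sup>2)"
            using F(3)[of i x] by (auto simp: indicator_def intro!: ennreal_leI power_mono)
        qed
        also have "\<dots> < \<infinity>" using f by (simp add: L2_iff)
        finally show "emeasure lebesgue (F i -` {y}) < \<infinity>"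
          using y by (auto simp: ennreal_mult_less_top)
      qed
      moreover have "(\<lambda>x. \<Sum>y\<in>range (F i) - {0}. y * complex_of_real (indicator (F i -` {y}) x)) = F i"
        by (intro ext) (rule eq[symmetric])
      ultimately show ?thesis by (simp only:)
    qed
    show "f \<in> V"
    proof (rule closed_subspace_tendsto[OF V f FV])
      show "(\<lambda>n. nsq (\<lambda>x. f x - F n x)) \<longlonglongrightarrow> 0"
      proof (rule nsq_dominated_convergence)
        show "(\<lambda>x. 3 * f x) \<in> L2" using f by (rule L2_cmult)
        show "norm (f x - F n x) \<le> norm (3 * f x)" for n x
          using norm_triangle_ineq4[of "f x" "F n x"] F(3)[of n x] by (simp add: norm_mult)
        have "(\<lambda>n. f x - F n x) \<longlonglongrightarrow> 0" for x
          using tendsto_diff[OF tendsto_const[of "f x"] F(2)[of x]] by simp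
        then show "AE x in lebesgue. (\<lambda>n. f x - F n x) \<longlonglongrightarrow> 0" by simp
      qed measurable
    qed
  qed
qed

lemma closed_subspace_eq_L2_continuous:
  assumes V: "L2_closed_subspace V"
    and cont: "\<And>(f::real\<Rightarrow>real) a b. continuous_on UNIV f \<Longrightarrow> (\<And>x. 0 \<le> f x \<and> f x \<le> 1) \<Longrightarrow>
      (\<And>x. x \<notin> {a<..<b} \<Longrightarrow> f x = 0) \<Longrightarrow> (\<lambda>x. complex_of_real (f x)) \<in> V"
  shows "V = L2"
proof (rule closed_subspace_eq_L2[OF V])
  fix S :: "real set" assume S: "S \<in> sets lebesgue" "emeasure lebesgue S < \<infinity>"
  define T where "T n = S \<inter> {- real n<..<real n}" for n
  have T: "T n \<in> sets lebesgue" for n using S by (auto simp: T_def)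
  show "(\<lambda>x. complex_of_real (indicator S x)) \<in> V"
  proof (rule closed_subspace_tendsto[OF V indicator_L2[OF S]])
    show "(\<lambda>x. complex_of_real (indicator (T n) x)) \<in> V" for n
      by (rule closed_subspace_indicator[OF V cont T, of "- real n" "real n"]) (auto simp: T_def)
    show "(\<lambda>n. nsq (\<lambda>x. complex_of_real (indicator S x) - complex_of_real (indicator (T n) x))) \<longlonglongrightarrow> 0"
    proof (rule nsq_dominated_convergence[OF _ indicator_L2[OF S]])
      show "(\<lambda>x. complex_of_real (indicator S x) - complex_of_real (indicator (T n) x)) \<in> borel_measurable lebesgue" for n
        using S T by measurable
      show "norm (complex_of_real (indicator S x) - complex_of_real (indicator (T n) x)) \<le> norm (complex_of_real (indicator S x))" for n x
        by (auto simp: indicator_def T_def)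
      have "(\<lambda>n. complex_of_real (indicator S x) - complex_of_real (indicator (T n) x)) \<longlonglongrightarrow> 0" for x
      proof (rule tendsto_eventually)
        obtain n where "\<bar>x\<bar> < real n" using reals_Archimedean2 by blast
        then show "eventually (\<lambda>n. complex_of_real (indicator S x) - complex_of_real (indicator (T n) x) = 0) sequentially"
          unfolding eventually_sequentially
          by (intro exI[of _ n]) (auto simp: T_def indicator_def abs_less_iff)
      qed
      then show "AE x in lebesgue. (\<lambda>n. complex_of_real (indicator S x) - complex_of_real (indicator (T n) x)) \<longlonglongrightarrow> 0"
        by simp
    qed
  qed
qed

lemma lebesgue_measurable_affine [measurable]:
  fixes c t :: real
  assumes "c \<noteq> 0" shows "(\<lambda>x. t + c * x) \<in> lebesgue \<rightarrow>\<^sub>M lebesgue"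
  using lebesgue_affine_measurable[of "\<lambda>_. c" t] assms by simp

lemma borel_measurable_lebesgue_affine:
  fixes c t :: real
  assumes f: "f \<in> borel_measurable lebesgue" and "c \<noteq> 0"
  shows "(\<lambda>x. f (t + c * x)) \<in> borel_measurable lebesgue"
  using measurable_comp[OF lebesgue_measurable_affine[OF assms(2), of t] f] by (simp add: comp_def)

lemma nsq_affine:
  assumes f: "f \<in> borel_measurable lebesgue" and "c \<noteq> 0"
  shows "nsq f = ennreal \<bar>c\<bar> * nsq (\<lambda>x. f (t + c * x))"
  unfolding nsq_def using f assms(2) by (subst nn_integral_real_affine_lebesgue[of _ c t]) auto

lemma nsq_shift: "f \<in> borel_measurable lebesgue \<Longrightarrow> nsq (\<lambda>x. f (x + h)) = nsq f"
  using nsq_affine[of f 1 h] by (simp add: add.commute)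

lemma measurable_shift: "f \<in> borel_measurable lebesgue \<Longrightarrow> (\<lambda>x. f (x + h)) \<in> borel_measurable (lebesgue::real measure)"
  using borel_measurable_lebesgue_affine[of f 1 h] by (simp add: add.commute)

text \<open>Translations are isometries, so the functions with this property form a closed subspace. It contains
  the continuous functions of bounded support by dominated convergence, hence is everything.\<close>

lemma L2_translation_continuous:
  assumes h: "h \<longlonglongrightarrow> (0::real)" and f: "f \<in> L2"
  shows "(\<lambda>n. nsq (\<lambda>x. f (x + h n) - f x)) \<longlonglongrightarrow> 0"
proof -
  define V where "V = {f\<in>L2. (\<lambda>n. nsq (\<lambda>x. f (x + h n) - f x)) \<longlonglongrightarrow> 0}"
  have m: "f \<in> L2 \<Longrightarrow> (\<lambda>x. f (x + a)) \<in> borel_measurable lebesgue"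
     "f \<in> L2 \<Longrightarrow> f \<in> borel_measurable lebesgue"
     "f \<in> L2 \<Longrightarrow> (\<lambda>x. f (x + a) - f x) \<in> borel_measurable lebesgue" for f a
    by (auto intro!: measurable_shift borel_measurable_diff simp: L2_iff)
  have "V = L2"
  proof (rule closed_subspace_eq_L2_continuous)
    show "L2_closed_subspace V"
      unfolding L2_closed_subspace_def
    proof (intro conjI ballI allI impI)
      show "V \<subseteq> L2" "(\<lambda>x. 0) \<in> V" by (auto simp: V_def L2_zero nsq_def)
    next
      fix f g assume fg: "f \<in> V" "g \<in> V"
      have "(\<lambda>n. nsq (\<lambda>x. f (x + h n) + g (x + h n) - (f x + g x))) \<longlonglongrightarrow> 0"
      proof (rule tendsto_sandwich[OF _ _ tendsto_const])
        have "nsq (\<lambda>x. f (x + h n) + g (x + h n) - (f x + g x))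
          \<le> 2 * nsq (\<lambda>x. f (x + h n) - f x) + 2 * nsq (\<lambda>x. g (x + h n) - g x)" for n
          using nsq_add[of "\<lambda>x. f (x + h n) - f x" "\<lambda>x. g (x + h n) - g x"] fg
          by (simp add: V_def m algebra_simps)
        then show "eventually (\<lambda>n. nsq (\<lambda>x. f (x + h n) + g (x + h n) - (f x + g x))
          \<le> 2 * nsq (\<lambda>x. f (x + h n) - f x) + 2 * nsq (\<lambda>x. g (x + h n) - g x)) sequentially" by simp
        have "(\<lambda>n. 2 * nsq (\<lambda>x. f (x + h n) - f x) + 2 * nsq (\<lambda>x. g (x + h n) - g x)) \<longlonglongrightarrow> 2 * 0 + 2 * 0"
          using fg unfolding V_def by (intro tendsto_add ennreal_tendsto_cmult) auto
        then show "(\<lambda>n. 2 * nsq (\<lambda>x. f (x + h n) - f x) + 2 * nsq (\<lambda>x. g (x + h n) - g x)) \<longlonglongrightarrow> 0" by simp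
      qed auto
      then show "(\<lambda>x. f x + g x) \<in> V" using fg by (auto simp: V_def L2_add)
    next
      fix c f assume f: "f \<in> V"
      have "nsq (\<lambda>x. c * f (x + h n) - c * f x) = ennreal ((norm c)\<^sup>2) * nsq (\<lambda>x. f (x + h n) - f x)" for n
        using f by (subst nsq_cmult[symmetric]) (auto simp: V_def m right_diff_distrib)
      moreover have "(\<lambda>n. ennreal ((norm c)\<^sup>2) * nsq (\<lambda>x. f (x + h n) - f x)) \<longlonglongrightarrow> ennreal ((norm c)\<^sup>2) * 0"
        using f unfolding V_def by (intro ennreal_tendsto_cmult) auto
      ultimately show "(\<lambda>x. c * f x) \<in> V" using f by (simp add: V_def L2_cmult)
    next
      fix f assume f: "f \<in> L2" and lim: "\<forall>e>0. \<exists>g\<in>V. nsq (\<lambda>x. f x - g x) < ennreal e"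
      have "(\<lambda>n. nsq (\<lambda>x. f (x + h n) - f x)) \<longlonglongrightarrow> 0"
        unfolding ennreal_tendsto_0_iff
      proof (intro allI impI)
        fix e :: real assume e: "e > 0"
        then obtain g where g: "g \<in> V" "nsq (\<lambda>x. f x - g x) < ennreal (e/4/4)"
          using lim by (meson divide_pos_pos zero_less_numeral)
        then have gL: "g \<in> L2" by (simp add: V_def)
        have "eventually (\<lambda>n. nsq (\<lambda>x. g (x + h n) - g x) < ennreal (e/4/4)) sequentially"
          using g(1) e by (simp add: V_def ennreal_tendsto_0_iff)
        then show "eventually (\<lambda>n. nsq (\<lambda>x. f (x + h n) - f x) < ennreal e) sequentially"
        proof eventually_elim
          case (elim n)
          have 1: "nsq (\<lambda>x. f (x + h n) - g (x + h n)) < ennreal (e/4/4)"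
            using nsq_shift[of "\<lambda>x. f x - g x" "h n"] g f gL by (simp add: m)
          have 2: "nsq (\<lambda>x. g (x + h n) - f x) < ennreal (e/4)"
            using e g(2) by (intro nsq_approx_trans[OF _ _ _ elim]) (auto simp: m f gL nsq_minus_commute[of g f])
          have "ennreal (e/4/4) < ennreal (e/4)" using e by (intro ennreal_lessI) auto
          with 1 have "nsq (\<lambda>x. f (x + h n) - g (x + h n)) < ennreal (e/4)" by (rule order.strict_trans)
          then show ?case
            by (rule nsq_approx_trans[OF m(1)[OF f] m(1)[OF gL] m(2)[OF f] _ 2 e])
        qed
      qed
      with f show "f \<in> V" by (simp add: V_def)
    qed
  next
    fix f :: "real \<Rightarrow> real" and a b
    assume f: "continuous_on UNIV f" "\<And>x. 0 \<le> f x \<and> f x \<le> 1" "\<And>x. x \<notin> {a<..<b} \<Longrightarrow> f x = 0"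
    have fm [measurable]: "f \<in> borel_measurable borel" using f(1) by (rule borel_measurable_continuous_onI)
    have [measurable]: "f \<in> borel_measurable lebesgue" using fm by (intro measurable_completion) simp
    let ?I = "{a<..<b}"
    have I: "(\<lambda>x. complex_of_real (indicator {c<..<d} x)) \<in> L2" for c d :: real
      by (rule indicator_L2; cases "c \<le> d") auto
    have fL: "(\<lambda>x. complex_of_real (f x)) \<in> L2"
      unfolding L2_iff
    proof
      have "nsq (\<lambda>x. complex_of_real (f x)) \<le> nsq (\<lambda>x. complex_of_real (indicator ?I x))"
        using f by (intro nsq_mono) (auto simp: indicator_def)
      then show "nsq (\<lambda>x. complex_of_real (f x)) < \<infinity>" using I[of a b] by (auto simp: L2_iff)
    qed measurable
    \<comment> \<open>A bound on the translations gives one bounded interval that supports all the differences.\<close>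
    obtain B where B: "\<And>n. \<bar>h n\<bar> \<le> B"
      using convergent_imp_Bseq[of h] h by (auto simp: convergent_def Bseq_def)
    have "B \<ge> 0" using B[of 0] by simp
    have "(\<lambda>n. nsq (\<lambda>x. complex_of_real (f (x + h n)) - complex_of_real (f x))) \<longlonglongrightarrow> 0"
    proof (rule nsq_dominated_convergence[OF _ I])
      fix n
      show "(\<lambda>x. complex_of_real (f (x + h n)) - complex_of_real (f x)) \<in> borel_measurable lebesgue"
        using m(3)[OF fL] .
      show "norm (complex_of_real (f (x + h n)) - complex_of_real (f x))
         \<le> norm (complex_of_real (indicator {a - B<..<b + B} x))" for x
      proof (cases "x \<in> {a - B<..<b + B}")
        case True
        then show ?thesis using f(2)[of x] f(2)[of "x + h n"]
          by (simp only: norm_of_real flip: of_real_diff) auto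
      next
        case False
        then have "f x = 0" "f (x + h n) = 0"
          using B[of n] \<open>B \<ge> 0\<close> by (auto intro!: f(3))
        then show ?thesis by simp
      qed
    next
      have "(\<lambda>n. complex_of_real (f (x + h n)) - complex_of_real (f x)) \<longlonglongrightarrow> 0" for x
      proof -
        have "(\<lambda>n. x + h n) \<longlonglongrightarrow> x" using tendsto_add[OF tendsto_const h] by simp
        moreover have "isCont f x" using f(1) by (simp add: continuous_on_eq_continuous_at)
        ultimately have "(\<lambda>n. f (x + h n)) \<longlonglongrightarrow> f x" by (rule isCont_tendsto_compose[rotated])
        then have "(\<lambda>n. complex_of_real (f (x + h n)) - complex_of_real (f x)) \<longlonglongrightarrow> complex_of_real (f x) - complex_of_real (f x)"
          by (intro tendsto_intros)
        then show ?thesis by simp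
      qed
      then show "AE x in lebesgue. (\<lambda>n. complex_of_real (f (x + h n)) - complex_of_real (f x)) \<longlonglongrightarrow> 0" by simp
    qed
    then show "(\<lambda>x. complex_of_real (f x)) \<in> V" using fL by (simp add: V_def)
  qed
  then show ?thesis using f by (auto simp: V_def)
qed

section \<open>Fourier integrals and Gaussian means\<close>

lemma measurable_cis [measurable]: "cis \<in> borel_measurable borel"
  unfolding cis_conv_exp[abs_def] by measurable

text \<open>The inverse Fourier integral: the wavelet is constructed from its prescribed transform.\<close>

definition ifourier :: "(real \<Rightarrow> complex) \<Rightarrow> real \<Rightarrow> complex" where
  "ifourier f t = complex_of_real (1 / sqrt (2 * pi)) * (\<integral>x. cis (t * x) * f x \<partial>lebesgue)"

lemma fourier_eq_ifourier: "fourier f x = ifourier f (- x)"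
  unfolding fourier_def ifourier_def cis_conv_exp by (simp add: mult_ac)

lemma borel_imp_lebesgue_measurable: "f \<in> borel_measurable borel \<Longrightarrow> f \<in> borel_measurable lebesgue"
  by (rule measurable_completion) simp

lemma ifourier_cong_AE:
  assumes "AE x in lebesgue. f x = g x" "f \<in> borel_measurable lebesgue" "g \<in> borel_measurable lebesgue"
  shows "ifourier f = ifourier g"
proof
  fix t
  have "(\<lambda>x. cis (t * x)) \<in> borel_measurable lebesgue"
    by (rule borel_imp_lebesgue_measurable) measurable
  then have "(\<integral>x. cis (t * x) * f x \<partial>lebesgue) = (\<integral>x. cis (t * x) * g x \<partial>lebesgue)"
    using assms by (intro integral_cong_AE) auto
  then show "ifourier f t = ifourier g t" by (simp add: ifourier_def)
qed

lemma ifourier_borel: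
  assumes [measurable]: "f \<in> borel_measurable borel"
  shows "ifourier f t = complex_of_real (1 / sqrt (2 * pi)) * (\<integral>x. cis (t * x) * f x \<partial>lborel)"
  unfolding ifourier_def by (subst integral_completion) auto

lemma measurable_ifourier [measurable]:
  assumes [measurable]: "f \<in> borel_measurable borel"
  shows "ifourier f \<in> borel_measurable borel"
proof -
  have "ifourier f = (\<lambda>t. complex_of_real (1 / sqrt (2 * pi)) * (\<integral>x. cis (t * x) * f x \<partial>lborel))"
    by (intro ext ifourier_borel) fact
  also have "\<dots> \<in> borel_measurable borel" by measurable
  finally show ?thesis .
qed

lemma norm_ifourier_le: "norm (ifourier f t) \<le> (\<integral>x. norm (f x) \<partial>lebesgue)"
proof -
  have "norm (ifourier f t) = 1 / sqrt (2 * pi) * norm (\<integral>x. cis (t * x) * f x \<partial>lebesgue)"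
    by (simp add: ifourier_def norm_mult norm_divide)
  also have "\<dots> \<le> 1 * (\<integral>x. norm (cis (t * x) * f x) \<partial>lebesgue)"
  proof (intro mult_mono integral_norm_bound)
    have "1 \<le> sqrt (2 * pi)" using pi_gt3 by (simp add: real_le_rsqrt)
    then show "1 / sqrt (2 * pi) \<le> 1" by (simp add: divide_le_eq)
  qed auto
  finally show ?thesis by (simp add: norm_mult)
qed

lemma ifourier_uminus_arg:
  assumes [measurable]: "f \<in> borel_measurable borel"
  shows "ifourier (\<lambda>x. f (- x)) t = ifourier f (- t)"
proof -
  have "(\<integral>x. cis (- t * x) * f x \<partial>lborel) = (\<integral>x. cis (t * x) * f (- x) \<partial>lborel)"
    by (subst lborel_integral_real_affine[of "-1" _ 0]) simp_all
  then show ?thesis by (simp add: ifourier_borel)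
qed

lemma cnj_ifourier: "cnj (ifourier f t) = ifourier (\<lambda>x. cnj (f x)) (- t)"
proof -
  have "cnj (\<integral>x. cis (t * x) * f x \<partial>lebesgue) = (\<integral>x. cnj (cis (t * x) * f x) \<partial>lebesgue)"
    by (simp only: Bochner_Integration.integral_cnj)
  then show ?thesis by (simp add: ifourier_def cis_cnj)
qed

text \<open>Fubini's theorem: both sides are the double integral of \<open>a t * cis (t * x) * b x\<close>.\<close>

lemma ifourier_multiplication:
  assumes a: "integrable lborel a" and b: "integrable lborel b"
  shows "(\<integral>t. a t * ifourier b t \<partial>lborel) = (\<integral>x. b x * ifourier a x \<partial>lborel)"
proof -
  have [measurable]: "a \<in> borel_measurable borel" "b \<in> borel_measurable borel"
    using a b by auto
  let ?c = "complex_of_real (1 / sqrt (2 * pi))"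
  let ?F = "\<lambda>(t, x). a t * (cis (t * x) * b x)"
  have int: "integrable (lborel \<Otimes>\<^sub>M lborel) ?F"
  proof (rule lborel_pair.Fubini_integrable)
    show "integrable lborel (\<lambda>t. \<integral>x. norm (?F (t, x)) \<partial>lborel)"
      using a by (simp add: norm_mult)
    show "AE t in lborel. integrable lborel (\<lambda>x. ?F (t, x))"
    proof (rule AE_I2)
      fix t
      have "integrable lborel (\<lambda>x. cis (t * x) * b x)"
        by (rule Bochner_Integration.integrable_bound[OF b]) (auto simp: norm_mult)
      then show "integrable lborel (\<lambda>x. ?F (t, x))" by simp
    qed
  qed measurable
  have "(\<integral>t. a t * ifourier b t \<partial>lborel) = (\<integral>t. ?c * (a t * (\<integral>x. cis (t * x) * b x \<partial>lborel)) \<partial>lborel)"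
    by (intro Bochner_Integration.integral_cong refl) (simp add: ifourier_borel)
  also have "\<dots> = ?c * (\<integral>t. (\<integral>x. ?F (t, x) \<partial>lborel) \<partial>lborel)"
    by (simp only: integral_mult_right_zero prod.case)
  also have "(\<integral>t. (\<integral>x. ?F (t, x) \<partial>lborel) \<partial>lborel) = (\<integral>x. (\<integral>t. ?F (t, x) \<partial>lborel) \<partial>lborel)"
    using lborel_pair.Fubini_integral[of "\<lambda>t x. ?F (t, x)"] int by simp
  also have "\<dots> = (\<integral>x. (\<integral>t. b x * (cis (x * t) * a t) \<partial>lborel) \<partial>lborel)"
    by (simp only: prod.case mult_ac)
  also have "\<dots> = (\<integral>x. b x * (\<integral>t. cis (x * t) * a t \<partial>lborel) \<partial>lborel)"
    by (simp only: integral_mult_right_zero)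
  also have "?c * \<dots> = (\<integral>x. ?c * (b x * (\<integral>t. cis (x * t) * a t \<partial>lborel)) \<partial>lborel)"
    by (simp only: integral_mult_right_zero)
  also have "\<dots> = (\<integral>x. b x * ifourier a x \<partial>lborel)"
    by (intro Bochner_Integration.integral_cong refl) (simp add: ifourier_borel)
  finally show ?thesis .
qed

text \<open>Convolution of \<open>f\<close> with the centred normal density of standard deviation \<open>s\<close>. Written as an
  expectation it is accessible to Jensen's inequality.\<close>

definition gauss_mean :: "real \<Rightarrow> (real \<Rightarrow> complex) \<Rightarrow> real \<Rightarrow> complex" where
  "gauss_mean s f x = (\<integral>z. f (x + s * z) \<partial>std_normal_distribution)"

lemma measurable_gauss_mean [measurable]:
  assumes [measurable]: "f \<in> borel_measurable borel"
  shows "gauss_mean s f \<in> borel_measurable borel"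
proof -
  interpret real_distribution std_normal_distribution by (rule real_dist_normal_dist)
  show ?thesis unfolding gauss_mean_def[abs_def] by measurable
qed

text \<open>The variance of \<open>|f (x + s Z) - f x|\<close> under the normal distribution is nonnegative.\<close>

lemma gauss_mean_jensen:
  assumes [measurable]: "f \<in> borel_measurable borel"
  shows "ennreal ((norm (gauss_mean s f x - f x))\<^sup>2)
    \<le> (\<integral>\<^sup>+z. ennreal ((norm (f (x + s * z) - f x))\<^sup>2) \<partial>std_normal_distribution)" (is "_ \<le> ?R")
proof (cases "?R = \<infinity>")
  case False
  interpret real_distribution std_normal_distribution by (rule real_dist_normal_dist)
  let ?M = "std_normal_distribution"
  let ?u = "\<lambda>z. f (x + s * z) - f x"
  have i2: "integrable ?M (\<lambda>z. (norm (?u z))\<^sup>2)"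
    using False by (intro integrableI_bounded) (auto simp: less_top)
  have i1: "integrable ?M (\<lambda>z. norm (?u z))"
    by (rule square_integrable_imp_integrable[OF _ i2]) measurable
  then have i: "integrable ?M ?u" by (subst (asm) integrable_norm_iff) auto
  then have "integrable ?M (\<lambda>z. ?u z + f x)" by (intro Bochner_Integration.integrable_add) auto
  then have "integrable ?M (\<lambda>z. f (x + s * z))" by simp
  then have eq: "gauss_mean s f x - f x = (\<integral>z. ?u z \<partial>?M)"
    unfolding gauss_mean_def using prob_space by (subst Bochner_Integration.integral_diff) auto
  have "(norm (gauss_mean s f x - f x))\<^sup>2 \<le> (\<integral>z. norm (?u z) \<partial>?M)\<^sup>2"
    unfolding eq by (intro power_mono integral_norm_bound) auto
  also have "\<dots> \<le> (\<integral>z. (norm (?u z))\<^sup>2 \<partial>?M)"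
    using variance_eq[OF i1 i2] variance_positive[of "\<lambda>z. norm (?u z)"] by simp
  finally have "ennreal ((norm (gauss_mean s f x - f x))\<^sup>2) \<le> ennreal (\<integral>z. (norm (?u z))\<^sup>2 \<partial>?M)"
    by (rule ennreal_leI)
  also have "\<dots> = ?R" using i2 by (intro nn_integral_eq_integral[symmetric]) auto
  finally show ?thesis .
qed auto

lemma nsq_gauss_mean_diff_le:
  assumes [measurable]: "f \<in> borel_measurable borel"
  shows "nsq (\<lambda>x. gauss_mean s f x - f x) \<le> (\<integral>\<^sup>+z. nsq (\<lambda>x. f (x + s * z) - f x) \<partial>std_normal_distribution)"
proof -
  interpret real_distribution std_normal_distribution by (rule real_dist_normal_dist)
  let ?M = "std_normal_distribution"
  interpret pair_sigma_finite lborel ?M ..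
  have "nsq (\<lambda>x. gauss_mean s f x - f x) \<le> (\<integral>\<^sup>+x. (\<integral>\<^sup>+z. ennreal ((norm (f (x + s * z) - f x))\<^sup>2) \<partial>?M) \<partial>lborel)"
    unfolding nsq_def nn_integral_completion by (intro nn_integral_mono gauss_mean_jensen assms)
  also have "\<dots> = (\<integral>\<^sup>+z. (\<integral>\<^sup>+x. ennreal ((norm (f (x + s * z) - f x))\<^sup>2) \<partial>lborel) \<partial>?M)"
    by (rule Fubini'[symmetric]) measurable
  finally show ?thesis by (simp add: nsq_def nn_integral_completion)
qed

lemma nsq_shift_diff_le:
  assumes f [measurable]: "f \<in> borel_measurable borel"
  shows "nsq (\<lambda>x. f (x + a) - f x) \<le> 4 * nsq f"
proof -
  have "nsq (\<lambda>x. f (x + a) + (- f x)) \<le> 2 * nsq (\<lambda>x. f (x + a)) + 2 * nsq (\<lambda>x. - f x)"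
    by (intro nsq_add borel_imp_lebesgue_measurable) measurable
  also have "\<dots> = 4 * nsq f"
    by (simp add: nsq_shift nsq_uminus borel_imp_lebesgue_measurable f flip: distrib_right)
  finally show ?thesis by simp
qed

text \<open>An average of translates of \<open>f\<close>, each of which tends to \<open>f\<close>.\<close>

lemma gauss_mean_tendsto:
  assumes fm [measurable]: "f \<in> borel_measurable borel" and f: "f \<in> L2" and s: "s \<longlonglongrightarrow> 0"
  shows "(\<lambda>n. nsq (\<lambda>x. gauss_mean (s n) f x - f x)) \<longlonglongrightarrow> 0"
proof -
  interpret real_distribution std_normal_distribution by (rule real_dist_normal_dist)
  let ?M = "std_normal_distribution"
  interpret pair_sigma_finite lborel ?M ..
  have "(\<lambda>n. \<integral>\<^sup>+z. nsq (\<lambda>x. f (x + s n * z) - f x) \<partial>?M) \<longlonglongrightarrow> (\<integral>\<^sup>+z. 0 \<partial>?M)"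
  proof (rule nn_integral_dominated_convergence[where w="\<lambda>_. 4 * nsq f"])
    show "(\<lambda>z. nsq (\<lambda>x. f (x + s n * z) - f x)) \<in> borel_measurable ?M" for n
      unfolding nsq_def nn_integral_completion by measurable
    show "AE z in ?M. nsq (\<lambda>x. f (x + s n * z) - f x) \<le> 4 * nsq f" for n
      using nsq_shift_diff_le[OF fm] by simp
    show "(\<integral>\<^sup>+z. 4 * nsq f \<partial>?M) < \<infinity>"
      using f emeasure_space_1 by (simp add: L2_iff ennreal_mult_less_top)
    have "(\<lambda>n. nsq (\<lambda>x. f (x + s n * z) - f x)) \<longlonglongrightarrow> 0" for z
      by (rule L2_translation_continuous[OF _ f]) (use tendsto_mult[OF s tendsto_const[of z]] in simp)
    then show "AE z in ?M. (\<lambda>n. nsq (\<lambda>x. f (x + s n * z) - f x)) \<longlonglongrightarrow> 0" by simp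
  qed auto
  then have "(\<lambda>n. \<integral>\<^sup>+z. nsq (\<lambda>x. f (x + s n * z) - f x) \<partial>?M) \<longlonglongrightarrow> 0" by simp
  then show ?thesis
    by (rule tendsto_sandwich[OF _ _ tendsto_const, rotated 2]) (use nsq_gauss_mean_diff_le[OF fm] in auto)
qed

text \<open>The summability factor on the transform side: inserting it into the inversion formula of \<open>f\<close>
  produces \<^term>\<open>gauss_mean s f\<close>.\<close>

definition gaussian :: "real \<Rightarrow> real \<Rightarrow> complex" where
  "gaussian s t = complex_of_real (exp (- (s * t)\<^sup>2 / 2))"

lemma measurable_gaussian [measurable]: "gaussian s \<in> borel_measurable borel"
  unfolding gaussian_def[abs_def] by measurable

lemma gaussian_eq_density: "gaussian s t = complex_of_real (sqrt (2 * pi) * std_normal_density (0 + s * t))"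
  by (simp add: gaussian_def std_normal_density_def)

lemma norm_gaussian: "norm (gaussian s t) = exp (- (s * t)\<^sup>2 / 2)"
  unfolding gaussian_def by (simp only: norm_of_real) simp

lemma norm_gaussian_le_1: "norm (gaussian s t) \<le> 1"
  by (simp add: norm_gaussian)

lemma integrable_gaussian:
  assumes "s \<noteq> 0" shows "integrable lborel (gaussian s)"
proof -
  have "integrable lborel (\<lambda>x. std_normal_density x * x ^ 0)" by (rule integrable_std_normal_moment)
  then have "integrable lborel std_normal_density" by simp
  then have "integrable lborel (\<lambda>t. std_normal_density (0 + s * t))"
    using assms by (rule lborel_integrable_real_affine)
  then have "integrable lborel (\<lambda>t. sqrt (2 * pi) * std_normal_density (0 + s * t))"
    by (rule integrable_mult_right)
  then have "integrable lborel (\<lambda>t. complex_of_real (sqrt (2 * pi) * std_normal_density (0 + s * t)))"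
    by (rule integrable_of_real)
  then show ?thesis unfolding gaussian_eq_density[abs_def] .
qed

text \<open>The Gaussian is its own transform, by the known characteristic function of the normal
  distribution.\<close>

lemma ifourier_gaussian:
  assumes s: "s > 0"
  shows "ifourier (\<lambda>t. cis (- (x * t)) * gaussian s t) y = complex_of_real (1 / s) * gaussian (1 / s) (y - x)"
proof -
  let ?c = "complex_of_real (1 / sqrt (2 * pi))"
  have "ifourier (\<lambda>t. cis (- (x * t)) * gaussian s t) y = ?c * (\<integral>t. cis (y * t) * (cis (- (x * t)) * gaussian s t) \<partial>lborel)"
    by (subst ifourier_borel) auto
  also have "(\<integral>t. cis (y * t) * (cis (- (x * t)) * gaussian s t) \<partial>lborel) = (\<integral>t. cis ((y - x) * t) * gaussian s t \<partial>lborel)"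
    by (intro Bochner_Integration.integral_cong refl) (simp add: cis_mult left_diff_distrib flip: mult.assoc)
  also have "\<dots> = (1 / s) *\<^sub>R (\<integral>t. cis ((y - x) * (0 + 1/s * t)) * gaussian s (0 + 1/s * t) \<partial>lborel)"
    using s by (subst lborel_integral_real_affine[of "1/s" _ 0]) auto
  also have "(\<integral>t. cis ((y - x) * (0 + 1/s * t)) * gaussian s (0 + 1/s * t) \<partial>lborel)
     = (\<integral>t. complex_of_real (sqrt (2 * pi)) * (std_normal_density t *\<^sub>R iexp (((y - x) / s) * t)) \<partial>lborel)"
    using s by (intro Bochner_Integration.integral_cong refl)
      (simp add: gaussian_eq_density scaleR_conv_of_real mult_ac cis_conv_exp)
  also have "\<dots> = complex_of_real (sqrt (2 * pi)) * (\<integral>t. std_normal_density t *\<^sub>R iexp (((y - x) / s) * t) \<partial>lborel)"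
    by (simp only: integral_mult_right_zero)
  also have "(\<integral>t. std_normal_density t *\<^sub>R iexp (((y - x) / s) * t) \<partial>lborel) = char std_normal_distribution ((y - x) / s)"
    unfolding char_def by (subst integral_density) auto
  also have "char std_normal_distribution ((y - x) / s) = gaussian (1/s) (y - x)"
    by (simp add: char_std_normal_distribution gaussian_def)
  finally show ?thesis by (simp add: scaleR_conv_of_real)
qed

text \<open>The multiplication formula moves the transform from \<open>g\<close> to the modulated Gaussian; its transform is
  again a Gaussian, centred at \<open>x\<close>, and integrating \<open>g\<close> against it gives the mean.\<close>

lemma fourier_ifourier_gaussian:
  assumes g: "integrable lborel g" and s: "s > 0"
  shows "fourier (\<lambda>t. ifourier g t * gaussian s t) x = gauss_mean s g x"
proof -
  have [measurable]: "g \<in> borel_measurable borel" using g by auto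
  let ?c = "complex_of_real (1 / sqrt (2 * pi))"
  let ?a = "\<lambda>t. cis (- (x * t)) * gaussian s t"
  have a: "integrable lborel ?a"
    using s by (intro Bochner_Integration.integrable_bound[OF integrable_gaussian[of s]]) (auto simp: norm_mult)
  have "fourier (\<lambda>t. ifourier g t * gaussian s t) x = ?c * (\<integral>t. cis (- x * t) * (ifourier g t * gaussian s t) \<partial>lborel)"
    unfolding fourier_eq_ifourier by (subst ifourier_borel) auto
  also have "\<dots> = ?c * (\<integral>t. ?a t * ifourier g t \<partial>lborel)"
    by (simp add: mult_ac)
  also have "\<dots> = ?c * (\<integral>y. g y * ifourier ?a y \<partial>lborel)"
    by (subst ifourier_multiplication[OF a g]) simp
  also have "\<dots> = ?c * (\<integral>y. complex_of_real (1/s) * (g y * gaussian (1/s) (y - x)) \<partial>lborel)"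
    unfolding ifourier_gaussian[OF s] by (simp only: mult_ac)
  also have "\<dots> = ?c * (complex_of_real (1/s) * (\<integral>y. g y * gaussian (1/s) (y - x) \<partial>lborel))"
    by (simp only: integral_mult_right_zero)
  also have "(\<integral>y. g y * gaussian (1/s) (y - x) \<partial>lborel) = s *\<^sub>R (\<integral>z. g (x + s * z) * gaussian (1/s) (x + s * z - x) \<partial>lborel)"
    using s by (subst lborel_integral_real_affine[of s _ x]) auto
  also have "(\<integral>z. g (x + s * z) * gaussian (1/s) (x + s * z - x) \<partial>lborel)
     = (\<integral>z. complex_of_real (sqrt (2 * pi)) * (std_normal_density z *\<^sub>R g (x + s * z)) \<partial>lborel)"
    using s by (intro Bochner_Integration.integral_cong refl) (simp add: gaussian_eq_density scaleR_conv_of_real mult_ac)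
  also have "\<dots> = complex_of_real (sqrt (2 * pi)) * (\<integral>z. std_normal_density z *\<^sub>R g (x + s * z) \<partial>lborel)"
    by (simp only: integral_mult_right_zero)
  also have "(\<integral>z. std_normal_density z *\<^sub>R g (x + s * z) \<partial>lborel) = gauss_mean s g x"
    unfolding gauss_mean_def by (subst integral_density) auto
  finally show ?thesis using s by (simp add: scaleR_conv_of_real)
qed

section \<open>Plancherel's theorem\<close>

lemma integrable_lborel_bounded_mult:
  fixes a b :: "real \<Rightarrow> complex"
  assumes "integrable lborel a" and [measurable]: "b \<in> borel_measurable borel" and b: "\<And>x. norm (b x) \<le> B"
  shows "integrable lborel (\<lambda>x. b x * a x)"
proof (rule Bochner_Integration.integrable_bound)
  have [measurable]: "a \<in> borel_measurable borel" using assms(1) by auto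
  show "integrable lborel (\<lambda>x. B *\<^sub>R a x)" using assms(1) by auto
  show "(\<lambda>x. b x * a x) \<in> borel_measurable lborel" by measurable
  have "norm (b x * a x) \<le> norm (B *\<^sub>R a x)" for x
    using b[of x] order_trans[OF norm_ge_zero b[of x]] by (auto simp: norm_mult intro: mult_right_mono)
  then show "AE x in lborel. norm (b x * a x) \<le> norm (B *\<^sub>R a x)" by simp
qed

lemma L2_inner_borel:
  assumes [measurable]: "f \<in> borel_measurable borel" "g \<in> borel_measurable borel"
  shows "L2_inner f g = (\<integral>x. f x * cnj (g x) \<partial>lborel)"
  unfolding L2_inner_def by (subst integral_completion) auto

text \<open>Parseval's identity in damped form, again by the multiplication formula. Letting the damping
  disappear gives both Plancherel's and Parseval's identity.\<close>

lemma ifourier_inner_gaussian: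
  assumes f: "integrable lborel f" and g: "integrable lborel g" and s: "s > 0"
  shows "(\<integral>t. gaussian s t * (ifourier f t * cnj (ifourier g t)) \<partial>lborel) = L2_inner (gauss_mean s f) g"
proof -
  have [measurable]: "f \<in> borel_measurable borel" "g \<in> borel_measurable borel" using f g by auto
  define a where "a t = ifourier f t * gaussian s t" for t
  have [measurable]: "a \<in> borel_measurable borel" unfolding a_def[abs_def] by measurable
  have a: "integrable lborel a"
    unfolding a_def[abs_def] using s norm_ifourier_le[of f]
    by (intro integrable_lborel_bounded_mult[OF integrable_gaussian]) auto
  have a': "integrable lborel (\<lambda>t. a (- t))"
    using lborel_integrable_real_affine[OF a, of "-1" 0] by simp
  have g': "integrable lborel (\<lambda>x. cnj (g x))" using g by simp
  have "(\<integral>t. gaussian s t * (ifourier f t * cnj (ifourier g t)) \<partial>lborel)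
     = (\<integral>t. a t * ifourier (\<lambda>x. cnj (g x)) (- t) \<partial>lborel)"
    by (simp add: a_def cnj_ifourier mult_ac)
  also have "\<dots> = (\<integral>t. a (- t) * ifourier (\<lambda>x. cnj (g x)) t \<partial>lborel)"
    by (subst lborel_integral_real_affine[of "-1" _ 0]) simp_all
  also have "\<dots> = (\<integral>x. cnj (g x) * ifourier (\<lambda>t. a (- t)) x \<partial>lborel)"
    by (rule ifourier_multiplication[OF a' g'])
  also have "\<dots> = (\<integral>x. gauss_mean s f x * cnj (g x) \<partial>lborel)"
  proof -
    have "ifourier a (- x) = gauss_mean s f x" for x
      using fourier_ifourier_gaussian[OF f s, of x] unfolding fourier_eq_ifourier a_def[abs_def] .
    then show ?thesis by (simp add: ifourier_uminus_arg mult.commute)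
  qed
  finally show ?thesis by (simp add: L2_inner_borel)
qed

lemma gauss_mean_L2:
  assumes fm [measurable]: "f \<in> borel_measurable borel" and f: "f \<in> L2"
  shows "gauss_mean s f \<in> L2"
proof -
  interpret real_distribution std_normal_distribution by (rule real_dist_normal_dist)
  have "nsq (\<lambda>x. gauss_mean s f x - f x) \<le> (\<integral>\<^sup>+z. 4 * nsq f \<partial>std_normal_distribution)"
    by (rule order_trans[OF nsq_gauss_mean_diff_le[OF fm] nn_integral_mono[OF nsq_shift_diff_le[OF fm]]])
  also have "\<dots> < \<infinity>"
    using f emeasure_space_1 by (simp add: L2_iff ennreal_mult_less_top)
  finally have "(\<lambda>x. gauss_mean s f x - f x) \<in> L2"
    unfolding L2_iff by (auto intro!: borel_imp_lebesgue_measurable)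
  from L2_add[OF this f] show ?thesis by simp
qed

text \<open>A sequence of standard deviations along which the damping is removed monotonically.\<close>

definition eps :: "nat \<Rightarrow> real" where "eps n = 1 / real (Suc n)"

lemma eps_pos: "eps n > 0" by (simp add: eps_def)
lemma eps_tendsto: "eps \<longlonglongrightarrow> 0" unfolding eps_def[abs_def] by (rule LIMSEQ_Suc[OF lim_1_over_n])

lemma gaussian_eps_tendsto: "(\<lambda>n. gaussian (eps n) t) \<longlonglongrightarrow> 1"
proof -
  have "(\<lambda>n. gaussian (eps n) t) \<longlonglongrightarrow> complex_of_real (exp (- (0 * t)\<^sup>2 / 2))"
    unfolding gaussian_def by (intro tendsto_intros eps_tendsto) auto
  then show ?thesis by simp
qed

lemma gaussian_eps_mono: "mono (\<lambda>n. norm (gaussian (eps n) t))"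
proof (rule monoI)
  fix m n :: nat assume "m \<le> n"
  then have "eps n \<le> eps m" by (simp add: eps_def frac_le)
  then have "(eps n * t)\<^sup>2 \<le> (eps m * t)\<^sup>2"
    using eps_pos[of n] by (simp add: power_mult_distrib mult_right_mono power_mono)
  then show "norm (gaussian (eps m) t) \<le> norm (gaussian (eps n) t)" by (simp add: norm_gaussian)
qed

lemma L2_inner_self: "f \<in> L2 \<Longrightarrow> ennreal (Re (L2_inner f f)) = nsq f"
proof -
  assume f: "f \<in> L2"
  have i: "integrable lebesgue (\<lambda>x. (norm (f x))\<^sup>2)"
    using f by (simp add: L2_def)
  have "L2_inner f f = (\<integral>x. complex_of_real ((norm (f x))\<^sup>2) \<partial>lebesgue)"
    unfolding L2_inner_def by (simp only: complex_norm_square)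
  also have "\<dots> = complex_of_real (\<integral>x. (norm (f x))\<^sup>2 \<partial>lebesgue)"
    by (simp only: integral_complex_of_real)
  finally show ?thesis
    unfolding nsq_def by (simp only: Re_complex_of_real nn_integral_eq_integral[OF i] zero_le_power2 always_eventually simp_thms)
qed

text \<open>On the transform side the damping factors increase to one, so monotone convergence applies without
  knowing in advance that \<^term>\<open>ifourier f\<close> is square-integrable; on the other side the Gaussian
  means converge to \<open>f\<close>.\<close>

lemma plancherel_borel:
  assumes f: "integrable lborel f" "f \<in> L2"
  shows "nsq (ifourier f) = nsq f"
proof -
  have fm [measurable]: "f \<in> borel_measurable borel" using f by auto
  define u where "u n t = ennreal (norm (gaussian (eps n) t)) * ennreal ((norm (ifourier f t))\<^sup>2)" for n t
  have [measurable]: "u n \<in> borel_measurable borel" for n unfolding u_def[abs_def] by measurable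
  have inc: "incseq u"
    unfolding u_def incseq_def le_fun_def using gaussian_eps_mono
    by (auto intro!: mult_right_mono ennreal_leI simp: mono_def)
  have sup: "(SUP n. u n t) = ennreal ((norm (ifourier f t))\<^sup>2)" for t
  proof (rule LIMSEQ_unique)
    show "(\<lambda>n. u n t) \<longlonglongrightarrow> (SUP n. u n t)"
      using inc by (intro LIMSEQ_SUP) (auto simp: incseq_def le_fun_def)
    have "(\<lambda>n. ennreal (norm (gaussian (eps n) t) * (norm (ifourier f t))\<^sup>2)) \<longlonglongrightarrow> ennreal (norm (1::complex) * (norm (ifourier f t))\<^sup>2)"
      by (intro tendsto_ennrealI tendsto_intros gaussian_eps_tendsto)
    then show "(\<lambda>n. u n t) \<longlonglongrightarrow> ennreal ((norm (ifourier f t))\<^sup>2)"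
      by (simp add: u_def ennreal_mult)
  qed
  have "(SUP n. integral\<^sup>N lborel (u n)) = (\<integral>\<^sup>+t. (SUP n. u n t) \<partial>lborel)"
    using inc by (intro nn_integral_monotone_convergence_SUP[symmetric]) auto
  also have "\<dots> = nsq (ifourier f)"
    by (simp add: sup nsq_def nn_integral_completion)
  finally have "(\<lambda>n. integral\<^sup>N lborel (u n)) \<longlonglongrightarrow> nsq (ifourier f)"
    using LIMSEQ_SUP[of "\<lambda>n. integral\<^sup>N lborel (u n)"] inc
    by (auto simp: incseq_def le_fun_def intro!: nn_integral_mono)
  moreover have "integral\<^sup>N lborel (u n) = ennreal (Re (L2_inner (gauss_mean (eps n) f) f))" for n
  proof -
    let ?h = "\<lambda>t. norm (gaussian (eps n) t) * (norm (ifourier f t))\<^sup>2"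
    have eq: "complex_of_real (?h t) = gaussian (eps n) t * (ifourier f t * cnj (ifourier f t))" for t
      by (simp only: of_real_mult flip: complex_norm_square) (simp add: norm_gaussian gaussian_def)
    have "integrable lborel (\<lambda>t. (ifourier f t * cnj (ifourier f t)) * gaussian (eps n) t)"
      using eps_pos[of n] norm_ifourier_le[of f]
      by (intro integrable_lborel_bounded_mult[OF integrable_gaussian]) (auto simp: norm_mult intro!: mult_mono order_trans[OF norm_ge_zero])
    then have "integrable lborel (\<lambda>t. complex_of_real (?h t))"
      by (simp only: eq mult_ac)
    then have i: "integrable lborel ?h" by (simp only: complex_of_real_integrable_eq)
    have "integral\<^sup>N lborel (u n) = (\<integral>\<^sup>+t. ennreal (?h t) \<partial>lborel)"
      by (simp add: u_def[abs_def] ennreal_mult)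
    also have "\<dots> = ennreal (\<integral>t. ?h t \<partial>lborel)"
      using i by (rule nn_integral_eq_integral) auto
    also have "(\<integral>t. ?h t \<partial>lborel) = Re (\<integral>t. complex_of_real (?h t) \<partial>lborel)"
      by (simp only: integral_complex_of_real Re_complex_of_real)
    also have "(\<integral>t. complex_of_real (?h t) \<partial>lborel) = L2_inner (gauss_mean (eps n) f) f"
      unfolding eq by (rule ifourier_inner_gaussian[OF f(1) f(1) eps_pos])
    finally show ?thesis .
  qed
  moreover have "(\<lambda>n. ennreal (Re (L2_inner (gauss_mean (eps n) f) f))) \<longlonglongrightarrow> ennreal (Re (L2_inner f f))"
    by (intro tendsto_ennrealI tendsto_Re L2_inner_tendsto gauss_mean_L2 f fm gauss_mean_tendsto eps_tendsto)
  ultimately have "nsq (ifourier f) = ennreal (Re (L2_inner f f))"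
    by (simp add: LIMSEQ_unique)
  then show ?thesis using f(2) by (simp add: L2_inner_self)
qed

lemma ifourier_L2_borel:
  assumes f: "integrable lborel f" "f \<in> L2"
  shows "ifourier f \<in> L2"
  using f plancherel_borel[OF f] by (auto simp: L2_iff intro!: borel_imp_lebesgue_measurable)

text \<open>Since the product of the transforms is integrable by \<open>ifourier_L2_borel\<close>, the damping can be
  removed by dominated convergence.\<close>

lemma parseval_borel:
  assumes f: "integrable lborel f" "f \<in> L2" and g: "integrable lborel g" "g \<in> L2"
  shows "L2_inner (ifourier f) (ifourier g) = L2_inner f g"
proof -
  have fm [measurable]: "f \<in> borel_measurable borel" "g \<in> borel_measurable borel" using f g by auto
  let ?w = "\<lambda>t. ifourier f t * cnj (ifourier g t)"
  have i: "integrable lborel ?w"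
    using integrable_L2_product[OF ifourier_L2_borel[OF f] ifourier_L2_borel[OF g]]
    by (subst (asm) integrable_completion) auto
  have "(\<lambda>n. \<integral>t. gaussian (eps n) t * ?w t \<partial>lborel) \<longlonglongrightarrow> (\<integral>t. ?w t \<partial>lborel)"
  proof (rule integral_dominated_convergence[where w="\<lambda>t. norm (?w t)"])
    show "integrable lborel (\<lambda>t. norm (?w t))" using i by (rule integrable_norm)
    have "(\<lambda>n. gaussian (eps n) t * ?w t) \<longlonglongrightarrow> 1 * ?w t" for t
      by (intro tendsto_mult gaussian_eps_tendsto tendsto_const)
    then show "AE t in lborel. (\<lambda>n. gaussian (eps n) t * ?w t) \<longlonglongrightarrow> ?w t" by simp
    have "norm (gaussian (eps n) t * ?w t) \<le> 1 * norm (?w t)" for n t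
      unfolding norm_mult[of "gaussian (eps n) t"] by (intro mult_right_mono norm_gaussian_le_1) auto
    then show "AE t in lborel. norm (gaussian (eps n) t * ?w t) \<le> norm (?w t)" for n by simp
  qed measurable
  then have "(\<lambda>n. L2_inner (gauss_mean (eps n) f) g) \<longlonglongrightarrow> L2_inner (ifourier f) (ifourier g)"
    unfolding ifourier_inner_gaussian[OF f(1) g(1) eps_pos] by (simp add: L2_inner_borel)
  moreover have "(\<lambda>n. L2_inner (gauss_mean (eps n) f) g) \<longlonglongrightarrow> L2_inner f g"
    by (intro L2_inner_tendsto gauss_mean_L2 f g fm gauss_mean_tendsto eps_tendsto)
  ultimately show ?thesis by (rule LIMSEQ_unique)
qed

lemma L2_limI:
  assumes "\<And>n. \<phi> n \<in> L2" "f \<in> L2" "(\<lambda>n. nsq (\<lambda>x. \<phi> n x - f x)) \<longlonglongrightarrow> 0"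
  shows "L2_lim \<phi> f"
proof -
  have "(\<lambda>n. L2_dist (\<phi> n) f) \<longlonglongrightarrow> 0"
  proof (rule tendstoI)
    fix e :: real assume e: "e > 0"
    then have "eventually (\<lambda>n. nsq (\<lambda>x. \<phi> n x - f x) < ennreal (e\<^sup>2)) sequentially"
      using assms(3) by (auto simp: ennreal_tendsto_0_iff)
    then show "eventually (\<lambda>n. dist (L2_dist (\<phi> n) f) 0 < e) sequentially"
    proof eventually_elim
      case (elim n)
      then have "L2_dist (\<phi> n) f < e" using L2_dist_less_iff[OF assms(1,2) e] by simp
      moreover have "L2_dist (\<phi> n) f \<ge> 0" by (simp add: L2_dist_def)
      ultimately show ?case by simp
    qed
  qed
  then show ?thesis using assms by (simp add: L2_lim_def)
qed

lemma ifourier_gaussian_L1_L2: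
  assumes f: "integrable lborel f" and s: "s > 0"
  shows "integrable lborel (\<lambda>t. ifourier f t * gaussian s t)" "(\<lambda>t. ifourier f t * gaussian s t) \<in> L2"
proof -
  have [measurable]: "f \<in> borel_measurable borel" using f by auto
  let ?B = "\<integral>x. norm (f x) \<partial>lebesgue"
  let ?a = "\<lambda>t. ifourier f t * gaussian s t"
  show i: "integrable lborel ?a"
    using s norm_ifourier_le[of f] by (intro integrable_lborel_bounded_mult[OF integrable_gaussian]) auto
  have "norm (cnj (?a t)) \<le> ?B * 1" for t
    unfolding complex_mod_cnj norm_mult
    by (intro mult_mono norm_ifourier_le norm_gaussian_le_1) auto
  then have "integrable lborel (\<lambda>t. cnj (?a t) * ?a t)"
    by (intro integrable_lborel_bounded_mult[OF i, of _ ?B]) auto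
  then have "integrable lborel (\<lambda>t. complex_of_real ((norm (?a t))\<^sup>2))"
    by (simp only: complex_norm_square mult_ac)
  then have "integrable lborel (\<lambda>t. (norm (?a t))\<^sup>2)" by (simp only: complex_of_real_integrable_eq)
  then show "?a \<in> L2"
    unfolding L2_def using integrable_completion[of "\<lambda>t. (norm (?a t))\<^sup>2" lborel]
    by (auto intro!: borel_imp_lebesgue_measurable)
qed

text \<open>The damped functions \<open>ifourier f t * gaussian s t\<close> are integrable, tend to \<^term>\<open>ifourier f\<close>, and
  have the Gaussian means of \<open>f\<close> as transforms: they witness the extension of the transform by
  continuity.\<close>

lemma fourier_L2_ifourier_borel:
  assumes f: "integrable lborel f" "f \<in> L2"
  shows "fourier_L2 (ifourier f) f"
  unfolding fourier_L2_def
proof (intro exI[of _ "\<lambda>n t. ifourier f t * gaussian (eps n) t"] conjI allI)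
  have fm [measurable]: "f \<in> borel_measurable borel" using f by auto
  show "integrable lebesgue (\<lambda>t. ifourier f t * gaussian (eps n) t)" for n
    using ifourier_gaussian_L1_L2(1)[OF f(1) eps_pos] by (subst integrable_completion) auto
  show "L2_lim (\<lambda>n t. ifourier f t * gaussian (eps n) t) (ifourier f)"
  proof (rule L2_limI)
    show "(\<lambda>t. ifourier f t * gaussian (eps n) t) \<in> L2" for n by (rule ifourier_gaussian_L1_L2(2)[OF f(1) eps_pos])
    show "ifourier f \<in> L2" by (rule ifourier_L2_borel[OF f])
    show "(\<lambda>n. nsq (\<lambda>t. ifourier f t * gaussian (eps n) t - ifourier f t)) \<longlonglongrightarrow> 0"
    proof (rule nsq_dominated_convergence[where w="\<lambda>t. 2 * ifourier f t"])
      show "(\<lambda>t. ifourier f t * gaussian (eps n) t - ifourier f t) \<in> borel_measurable lebesgue" for n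
        by (rule borel_imp_lebesgue_measurable) measurable
      show "(\<lambda>t. 2 * ifourier f t) \<in> L2" by (intro L2_cmult ifourier_L2_borel f)
      show "norm (ifourier f t * gaussian (eps n) t - ifourier f t) \<le> norm (2 * ifourier f t)" for n t
      proof -
        have "norm (ifourier f t * gaussian (eps n) t - ifourier f t) \<le> norm (ifourier f t) * norm (gaussian (eps n) t) + norm (ifourier f t)"
          using norm_triangle_ineq4[of "ifourier f t * gaussian (eps n) t" "ifourier f t"] by (simp add: norm_mult)
        also have "\<dots> \<le> norm (ifourier f t) * 1 + norm (ifourier f t)"
          by (intro add_right_mono mult_left_mono norm_gaussian_le_1) auto
        finally show ?thesis by (simp add: norm_mult)
      qed
      have "(\<lambda>n. ifourier f t * gaussian (eps n) t - ifourier f t) \<longlonglongrightarrow> ifourier f t * 1 - ifourier f t" for t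
        by (intro tendsto_intros gaussian_eps_tendsto)
      then show "AE t in lebesgue. (\<lambda>n. ifourier f t * gaussian (eps n) t - ifourier f t) \<longlonglongrightarrow> 0" by simp
    qed
  qed
  have "L2_lim (\<lambda>n. gauss_mean (eps n) f) f"
    by (intro L2_limI gauss_mean_L2 gauss_mean_tendsto f fm eps_tendsto)
  moreover have "fourier (\<lambda>t. ifourier f t * gaussian (eps n) t) = gauss_mean (eps n) f" for n
    by (intro ext fourier_ifourier_gaussian f eps_pos)
  ultimately show "L2_lim (\<lambda>n. fourier (\<lambda>t. ifourier f t * gaussian (eps n) t)) f" by simp
qed

text \<open>The functions for which the transform is given by its integral and is isometric.\<close>

definition L12 :: "(real \<Rightarrow> complex) set" where
  "L12 = {f \<in> L2. integrable lebesgue f}"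

text \<open>Gaussian means of \<open>f\<close> are close to \<open>f\<close>, and by the damped inversion formula they are transforms
  themselves. A reflection of the argument turns \<^const>\<open>fourier\<close> into \<^const>\<open>ifourier\<close>.\<close>

lemma ifourier_dense_borel:
  assumes f: "integrable lborel f" "f \<in> L2" and e: "e > 0"
  shows "\<exists>g\<in>L12. nsq (\<lambda>x. f x - ifourier g x) < ennreal e"
proof -
  have fm [measurable]: "f \<in> borel_measurable borel" using f by auto
  have "eventually (\<lambda>n. nsq (\<lambda>x. gauss_mean (eps n) f x - f x) < ennreal e) sequentially"
    using gauss_mean_tendsto[OF fm f(2) eps_tendsto] e by (simp add: ennreal_tendsto_0_iff)
  then obtain n where n: "nsq (\<lambda>x. gauss_mean (eps n) f x - f x) < ennreal e"
    by (meson eventually_happens' sequentially_bot)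
  define a where "a t = ifourier f t * gaussian (eps n) t" for t
  define H where "H t = a (- t)" for t
  have [measurable]: "a \<in> borel_measurable borel" unfolding a_def[abs_def] by measurable
  have a: "integrable lborel a" "a \<in> L2"
    using ifourier_gaussian_L1_L2[OF f(1) eps_pos] by (simp_all add: a_def[abs_def])
  have Hi: "integrable lborel H"
    unfolding H_def[abs_def] using lborel_integrable_real_affine[OF a(1), of "-1" 0] by simp
  have "nsq a = nsq H"
    using nsq_affine[of a "-1" 0] a(2) by (simp add: H_def[abs_def] L2_iff)
  then have "H \<in> L2" using a(2) by (auto simp: L2_iff H_def[abs_def] intro!: borel_imp_lebesgue_measurable)
  moreover have "integrable lebesgue H"
    using Hi by (subst integrable_completion) auto
  moreover have "ifourier H x = gauss_mean (eps n) f x" for x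
  proof -
    have "ifourier a (- x) = gauss_mean (eps n) f x"
      using fourier_ifourier_gaussian[OF f(1) eps_pos, of n x] unfolding fourier_eq_ifourier a_def[abs_def] .
    then show ?thesis by (simp add: H_def[abs_def] ifourier_uminus_arg)
  qed
  ultimately show ?thesis using n by (intro bexI[of _ H]) (auto simp: L12_def nsq_minus_commute[of f])
qed

text \<open>The arguments with Fubini's theorem need joint measurability and were therefore made for Borel
  functions; all quantities involved only depend on functions up to null sets.\<close>

lemma borel_version:
  fixes f :: "real \<Rightarrow> complex"
  assumes f [measurable]: "f \<in> borel_measurable lebesgue"
  obtains g where "g \<in> borel_measurable borel" "AE x in lebesgue. f x = g x"
proof -
  have R: "(\<lambda>x. Re (f x)) \<in> borel_measurable lebesgue" and I: "(\<lambda>x. Im (f x)) \<in> borel_measurable lebesgue"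
    by measurable
  obtain a b where ab: "a \<in> borel_measurable lborel" "AE x in lborel. Re (f x) = a x"
     "b \<in> borel_measurable lborel" "AE x in lborel. Im (f x) = b x"
    using completion_ex_borel_measurable_real[OF R] completion_ex_borel_measurable_real[OF I] by auto
  have "AE x in lborel. f x = Complex (a x) (b x)"
    using ab(2,4) by eventually_elim (simp add: complex_eq_iff)
  then have "AE x in lebesgue. f x = Complex (a x) (b x)" by (rule AE_completion)
  moreover have "(\<lambda>x. Complex (a x) (b x)) \<in> borel_measurable borel"
    using ab(1,3) unfolding borel_measurable_complex_iff by simp
  ultimately show ?thesis using that by blast
qed

lemma L12_borel_version:
  assumes "f \<in> L12"
  obtains g where "integrable lborel g" "g \<in> L2" "AE x in lebesgue. f x = g x" "ifourier f = ifourier g"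
proof -
  have fm: "f \<in> borel_measurable lebesgue" using assms by (auto simp: L12_def L2_iff)
  obtain g where g: "g \<in> borel_measurable borel" "AE x in lebesgue. f x = g x" using borel_version[OF fm] .
  have gm: "g \<in> borel_measurable lebesgue" using g by (intro borel_imp_lebesgue_measurable)
  have "integrable lebesgue g"
    using assms integrable_cong_AE[OF fm gm g(2)] by (simp add: L12_def)
  then have "integrable lborel g" using g by (subst (asm) integrable_completion) auto
  moreover have "g \<in> L2" using nsq_cong_AE[OF g(2)] gm assms by (auto simp: L12_def L2_iff)
  moreover have "ifourier f = ifourier g" by (rule ifourier_cong_AE[OF g(2) fm gm])
  ultimately show ?thesis using that g by blast
qed

lemma ifourier_L2:
  assumes "f \<in> L12" shows "ifourier f \<in> L2"
proof -
  obtain f' where f': "integrable lborel f'" "f' \<in> L2" "AE x in lebesgue. f x = f' x" "ifourier f = ifourier f'"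
    using L12_borel_version[OF assms(1)] .
  show ?thesis unfolding f'(4) by (rule ifourier_L2_borel[OF f'(1,2)])
qed

lemma parseval:
  assumes "f \<in> L12" "g \<in> L12"
  shows "L2_inner (ifourier f) (ifourier g) = L2_inner f g"
proof -
  obtain f' where f': "integrable lborel f'" "f' \<in> L2" "AE x in lebesgue. f x = f' x" "ifourier f = ifourier f'"
    using L12_borel_version[OF assms(1)] .
  obtain g' where g': "integrable lborel g'" "g' \<in> L2" "AE x in lebesgue. g x = g' x" "ifourier g = ifourier g'"
    using L12_borel_version[OF assms(2)] .
  have [measurable]: "f \<in> borel_measurable lebesgue" "g \<in> borel_measurable lebesgue"
    "f' \<in> borel_measurable lebesgue" "g' \<in> borel_measurable lebesgue"
    using assms f' g' by (auto simp: L12_def L2_iff)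
  have "L2_inner f g = L2_inner f' g'"
    unfolding L2_inner_def
  proof (rule integral_cong_AE)
    show "AE x in lebesgue. f x * cnj (g x) = f' x * cnj (g' x)"
      using f'(3) g'(3) by eventually_elim simp
  qed measurable
  then show ?thesis using parseval_borel[OF f'(1,2) g'(1,2)] f'(4) g'(4) by simp
qed

lemma plancherel:
  assumes "f \<in> L12"
  shows "nsq (ifourier f) = nsq f"
proof -
  obtain f' where f': "integrable lborel f'" "f' \<in> L2" "AE x in lebesgue. f x = f' x" "ifourier f = ifourier f'"
    using L12_borel_version[OF assms(1)] .
  show ?thesis unfolding f'(4) plancherel_borel[OF f'(1,2)] nsq_cong_AE[OF f'(3)] ..
qed

lemma fourier_L2_ifourier:
  assumes "f \<in> L12"
  shows "fourier_L2 (ifourier f) f"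
proof -
  obtain f' where f': "integrable lborel f'" "f' \<in> L2" "AE x in lebesgue. f x = f' x" "ifourier f = ifourier f'"
    using L12_borel_version[OF assms(1)] .
  have fL: "f \<in> L2" using assms by (simp add: L12_def)
  have lim: "L2_lim \<phi> f' \<Longrightarrow> L2_lim \<phi> f" for \<phi>
  proof -
    assume a: "L2_lim \<phi> f'"
    have "nsq (\<lambda>x. \<phi> n x - f x) = nsq (\<lambda>x. \<phi> n x - f' x)" for n
      using f'(3) by (intro nsq_cong_AE) auto
    then have "L2_dist (\<phi> n) f = L2_dist (\<phi> n) f'" for n
      using a fL f'(2) by (auto simp: L2_lim_def L2_dist_eq)
    then show "L2_lim \<phi> f" using a fL by (simp add: L2_lim_def)
  qed
  show ?thesis
    using fourier_L2_ifourier_borel[OF f'(1,2)] lim unfolding f'(4) fourier_L2_def by blast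
qed

lemma ifourier_dense:
  assumes "f \<in> L12" "e > 0"
  shows "\<exists>g\<in>L12. nsq (\<lambda>x. f x - ifourier g x) < ennreal e"
proof -
  obtain f' where f': "integrable lborel f'" "f' \<in> L2" "AE x in lebesgue. f x = f' x" "ifourier f = ifourier f'"
    using L12_borel_version[OF assms(1)] .
  obtain g where g: "g \<in> L12" "nsq (\<lambda>x. f' x - ifourier g x) < ennreal e"
    using ifourier_dense_borel[OF f'(1,2) assms(2)] by blast
  have "nsq (\<lambda>x. f x - ifourier g x) = nsq (\<lambda>x. f' x - ifourier g x)"
    using f'(3) by (intro nsq_cong_AE) auto
  with g show ?thesis by (intro bexI[where x=g]) simp_all
qed

lemma cis_two_pi_int: "cis (x + 2 * pi * of_int n) = cis x"
  using cis_multiple_2pi[of "of_int n"] by (simp flip: cis_mult)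

section \<open>Density of trigonometric polynomials\<close>

text \<open>The open interval is used because the approximating Urysohn functions vanish at its ends.\<close>

definition interval_exp :: "int \<Rightarrow> real \<Rightarrow> complex" where
  "interval_exp k x = complex_of_real (indicator {0<..<2 * pi} x) * cis (of_int k * x)"

lemma bounded_on_interval_L2:
  assumes [measurable]: "g \<in> borel_measurable borel" and B: "\<And>x. norm (g x) \<le> B"
  shows "(\<lambda>x. complex_of_real (indicator {0<..<2 * pi} x) * g x) \<in> L2"
proof -
  have "(\<lambda>x. complex_of_real (indicator {0<..<2 * pi} x)) \<in> L2" by (rule indicator_L2) auto
  then have w: "(\<lambda>x. complex_of_real B * complex_of_real (indicator {0<..<2 * pi} x)) \<in> L2" by (rule L2_cmult)
  have "norm (complex_of_real (indicator {0<..<2 * pi} x) * g x) \<le> norm (complex_of_real B * complex_of_real (indicator {0<..<2 * pi} x))" for x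
    using B[of x] order_trans[OF norm_ge_zero B[of x]] by (auto simp: norm_mult indicator_def)
  then have "nsq (\<lambda>x. complex_of_real (indicator {0<..<2 * pi} x) * g x) < \<infinity>"
    using nsq_mono w unfolding L2_iff by (metis (no_types, lifting) order.strict_trans1)
  then show ?thesis unfolding L2_iff by (auto intro!: borel_imp_lebesgue_measurable)
qed

lemma interval_exp_L2: "interval_exp k \<in> L2"
  unfolding interval_exp_def[abs_def] by (rule bounded_on_interval_L2[where B=1]) auto

text \<open>Induction over the polynomial. A linear form on the circle is a combination of \<open>cis x\<close> and
  \<open>cis (- x)\<close>, and multiplication by these shifts the frequency. For products the statement has to be
  proved with an additional factor \<open>g\<close> that collects what was already multiplied.\<close>

lemma trig_polynomial_in_span:
  assumes p: "real_polynomial_function p"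
    and g: "\<And>m. (\<lambda>x. g x * interval_exp m x) \<in> L2_span interval_exp"
  shows "(\<lambda>x. g x * complex_of_real (p (cis x)) * interval_exp m x) \<in> L2_span interval_exp"
  using p g
proof (induction p arbitrary: g m rule: real_polynomial_function.induct)
  case (linear f)
  note V = closed_subspace_L2_span[OF interval_exp_L2]
  interpret bounded_linear f by fact
  define a where "a = (complex_of_real (f 1) - \<i> * complex_of_real (f \<i>)) / 2"
  define b where "b = (complex_of_real (f 1) + \<i> * complex_of_real (f \<i>)) / 2"
  have eq: "complex_of_real (f (cis x)) = a * cis x + b * cis (- x)" for x
  proof -
    have "cis x = cos x *\<^sub>R 1 + sin x *\<^sub>R \<i>" by (simp add: complex_eq_iff)
    then have "f (cis x) = cos x * f 1 + sin x * f \<i>" by (simp only: add scaleR real_scaleR_def)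
    then show ?thesis by (simp add: a_def b_def complex_eq_iff field_simps)
  qed
  have sh: "cis x * interval_exp m x = interval_exp (m + 1) x"
     "cis (- x) * interval_exp m x = interval_exp (m - 1) x" for x m
    by (simp_all add: interval_exp_def cis_mult mult.left_commute distrib_right left_diff_distrib add.commute)
  have "(\<lambda>x. a * (g x * interval_exp (m + 1) x) + b * (g x * interval_exp (m - 1) x)) \<in> L2_span interval_exp"
    by (intro closed_subspaceD(3)[OF V] closed_subspaceD(4)[OF V] linear.prems)
  also have "(\<lambda>x. a * (g x * interval_exp (m + 1) x) + b * (g x * interval_exp (m - 1) x))
     = (\<lambda>x. g x * complex_of_real (f (cis x)) * interval_exp m x)"
    unfolding eq sh[symmetric] by (simp add: algebra_simps)
  finally show ?case .
next
  case (const c)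
  note V = closed_subspace_L2_span[OF interval_exp_L2]
  have "(\<lambda>x. complex_of_real c * (g x * interval_exp m x)) \<in> L2_span interval_exp"
    by (intro closed_subspaceD(4)[OF V] const.prems)
  then show ?case by (simp add: mult_ac)
next
  case (add f1 f2)
  note V = closed_subspace_L2_span[OF interval_exp_L2]
  have "(\<lambda>x. g x * complex_of_real (f1 (cis x)) * interval_exp m x + g x * complex_of_real (f2 (cis x)) * interval_exp m x) \<in> L2_span interval_exp"
    by (intro closed_subspaceD(3)[OF V] add.IH add.prems)
  then show ?case by (simp add: algebra_simps)
next
  case (mult f1 f2)
  have "(\<lambda>x. (g x * complex_of_real (f1 (cis x))) * complex_of_real (f2 (cis x)) * interval_exp m x) \<in> L2_span interval_exp"
    by (intro mult.IH mult.prems)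
  then show ?case by (simp add: mult_ac)
qed

text \<open>The argument function has a jump, so continuity of \<open>F\<close> is obtained from its graph, which
  is the continuous image of a compact interval and therefore closed.\<close>

lemma periodic_continuous_on_circle:
  fixes f :: "real \<Rightarrow> real"
  assumes f: "continuous_on UNIV f" "f 0 = f (2 * pi)"
  obtains F where "continuous_on (sphere 0 1) F" "\<And>x. x \<in> {0..2 * pi} \<Longrightarrow> F (cis x) = f x"
proof -
  define F where "F z = f (Arg2pi z)" for z
  have F: "F (cis x) = f x" if x: "x \<in> {0..2 * pi}" for x
  proof (cases "x = 2 * pi")
    case True
    have "Arg2pi 1 = 0" by (simp add: Arg2pi_eq_0)
    then show ?thesis using f(2) True by (simp add: F_def)
  next
    case False
    then have "Arg2pi (cis x) = x" using x by (intro Arg2pi_unique[of 1]) (auto simp: cis_conv_exp)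
    then show ?thesis by (simp add: F_def)
  qed
  have surj: "\<exists>x\<in>{0..2 * pi}. z = cis x" if "z \<in> sphere 0 1" for z
    using that Arg2pi_eq[of z] Arg2pi_ge_0[of z] Arg2pi_lt_2pi[of z]
    by (intro bexI[of _ "Arg2pi z"]) (auto simp: cis_conv_exp)
  have graph: "(\<lambda>z. (z, F z)) ` sphere 0 1 = (\<lambda>x. (cis x, f x)) ` {0..2 * pi}"
  proof (intro equalityI subsetI)
    fix y assume "y \<in> (\<lambda>z. (z, F z)) ` sphere 0 1"
    then show "y \<in> (\<lambda>x. (cis x, f x)) ` {0..2 * pi}" using surj F by fastforce
  next
    fix y assume "y \<in> (\<lambda>x. (cis x, f x)) ` {0..2 * pi}"
    then obtain x where "x \<in> {0..2 * pi}" "y = (cis x, F (cis x))" using F by auto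
    then show "y \<in> (\<lambda>z. (z, F z)) ` sphere 0 1" by auto
  qed
  have fc: "continuous_on {0..2 * pi} f" using f(1) continuous_on_subset by blast
  have cisc: "continuous_on {0..2 * pi} cis"
    unfolding cis_conv_exp by (intro continuous_intros)
  have "compact ((\<lambda>x. (cis x, f x)) ` {0..2 * pi})"
    by (intro compact_continuous_image continuous_on_Pair fc cisc) auto
  then have "closed ((\<lambda>z. (z, F z)) ` sphere 0 1)"
    unfolding graph by (rule compact_imp_closed)
  moreover have "F \<in> sphere 0 1 \<rightarrow> f ` {0..2 * pi}" using surj F by fastforce
  moreover have "compact (f ` {0..2 * pi})" by (intro compact_continuous_image fc) auto
  ultimately have "continuous_on (sphere 0 1) F" by (intro continuous_from_closed_graph)
  then show ?thesis using F that by blast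
qed

text \<open>The Weierstrass theorem on the unit circle, transported to the interval.\<close>

lemma continuous_in_trig_span:
  fixes f :: "real \<Rightarrow> real"
  assumes f: "continuous_on UNIV f" "\<And>x. 0 \<le> f x \<and> f x \<le> 1" "\<And>x. x \<notin> {0<..<2 * pi} \<Longrightarrow> f x = 0"
  shows "(\<lambda>x. complex_of_real (f x)) \<in> L2_span interval_exp"
proof (rule closed_subspace_limit[OF closed_subspace_L2_span[OF interval_exp_L2]])
  let ?I = "\<lambda>x. complex_of_real (indicator {0<..<2 * pi} x)"
  have fI: "complex_of_real (f x) = ?I x * complex_of_real (f x)" for x
    using f(3)[of x] by (auto simp: indicator_def)
  have [measurable]: "f \<in> borel_measurable borel" using f(1) by (rule borel_measurable_continuous_onI)
  show "(\<lambda>x. complex_of_real (f x)) \<in> L2"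
    using f(2) by (subst fI, intro bounded_on_interval_L2[where B=1]) auto
  fix e :: real assume e: "e > 0"
  \<comment> \<open>A uniform error \<open>d\<close> on the interval costs \<open>2 pi d\<^sup>2 = e/2\<close>.\<close>
  define d where "d = sqrt (e / (4 * pi))"
  have d: "d > 0" using e by (simp add: d_def)
  obtain F where F: "continuous_on (sphere 0 1) F" "\<And>x. x \<in> {0..2 * pi} \<Longrightarrow> F (cis x) = f x"
    using periodic_continuous_on_circle[OF f(1)] f(3) by auto
  obtain p where p: "polynomial_function p" "\<And>z. z \<in> sphere 0 1 \<Longrightarrow> norm (F z - p z) < d"
    using Stone_Weierstrass_polynomial_function[OF compact_sphere F(1) d] by blast
  have rp: "real_polynomial_function p" using p(1) by (simp add: real_polynomial_function_eq)
  have "p \<circ> cis \<in> borel_measurable borel"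
    unfolding cis_conv_exp[abs_def]
    by (intro borel_measurable_continuous_onI continuous_on_compose continuous_intros continuous_on_polymonial_function p(1))
  then have [measurable]: "(\<lambda>x. p (cis x)) \<in> borel_measurable borel" by (simp add: comp_def)
  have "(\<lambda>x. 1 * complex_of_real (p (cis x)) * interval_exp 0 x) \<in> L2_span interval_exp"
    by (rule trig_polynomial_in_span[OF rp]) (use in_L2_span[OF interval_exp_L2] in simp)
  then have "(\<lambda>x. ?I x * complex_of_real (p (cis x))) \<in> L2_span interval_exp"
    by (simp add: interval_exp_def mult.commute)
  moreover have "nsq (\<lambda>x. complex_of_real (f x) - ?I x * complex_of_real (p (cis x))) < ennreal e"
  proof -
    have "nsq (\<lambda>x. complex_of_real (f x) - ?I x * complex_of_real (p (cis x))) \<le> nsq (\<lambda>x. complex_of_real d * ?I x)"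
    proof (rule nsq_mono)
      fix x
      show "norm (complex_of_real (f x) - ?I x * complex_of_real (p (cis x))) \<le> norm (complex_of_real d * ?I x)"
      proof (cases "x \<in> {0<..<2 * pi}")
        case True
        then have "\<bar>f x - p (cis x)\<bar> < d" using F(2)[of x] p(2)[of "cis x"] by simp
        then show ?thesis using True d by (simp add: indicator_def norm_of_real flip: of_real_diff)
      next
        case False then show ?thesis using f(3)[OF False] by (auto simp: indicator_def)
      qed
    qed
    also have "\<dots> = ennreal (d\<^sup>2) * ennreal (2 * pi)"
      by (subst nsq_cmult) (auto simp: nsq_indicator intro!: borel_imp_lebesgue_measurable)
    also have "\<dots> = ennreal (e / 2)" using e by (simp add: d_def flip: ennreal_mult)
    also have "\<dots> < ennreal e" using e by (intro ennreal_lessI) auto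
    finally show ?thesis .
  qed
  ultimately show "\<exists>g\<in>L2_span interval_exp. nsq (\<lambda>x. complex_of_real (f x) - g x) < ennreal e"
    by (intro bexI[where x="\<lambda>x. ?I x * complex_of_real (p (cis x))"])
qed

lemma indicator_in_trig_span:
  assumes "S \<in> sets lebesgue" "S \<subseteq> {0<..<2 * pi}"
  shows "(\<lambda>x. complex_of_real (indicator S x)) \<in> L2_span interval_exp"
  by (rule closed_subspace_indicator[OF closed_subspace_L2_span[OF interval_exp_L2] continuous_in_trig_span assms])

section \<open>Fundamental domains for translations\<close>

definition translation_tile :: "real set \<Rightarrow> bool" where
  "translation_tile W \<longleftrightarrow> W \<in> sets lebesgue \<and> (\<forall>y. \<exists>!n::int. y + 2 * pi * of_int n \<in> W)"

lemma translation_tile_interval: "translation_tile {0..<2 * pi}"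
  unfolding translation_tile_def
proof (intro conjI allI)
  fix y :: real
  have c: "0 < 2 * pi" by simp
  show "\<exists>!n::int. y + 2 * pi * of_int n \<in> {0..<2 * pi}"
  proof (rule ex1I[of _ "- \<lfloor>y / (2 * pi)\<rfloor>"])
    have "of_int \<lfloor>y / (2 * pi)\<rfloor> \<le> y / (2 * pi)" "y / (2 * pi) < of_int \<lfloor>y / (2 * pi)\<rfloor> + 1"
      by linarith+
    then have "of_int \<lfloor>y / (2 * pi)\<rfloor> * (2 * pi) \<le> y" "y < (of_int \<lfloor>y / (2 * pi)\<rfloor> + 1) * (2 * pi)"
      using c by (simp_all only: pos_le_divide_eq pos_divide_less_eq)
    then show "y + 2 * pi * of_int (- \<lfloor>y / (2 * pi)\<rfloor>) \<in> {0..<2 * pi}"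
      by (simp add: algebra_simps)
    fix n :: int assume "y + 2 * pi * of_int n \<in> {0..<2 * pi}"
    then have "of_int (- n) * (2 * pi) \<le> y" "y < (of_int (- n) + 1) * (2 * pi)" by (simp_all add: algebra_simps)
    then have "of_int (- n) \<le> y / (2 * pi)" "y / (2 * pi) < of_int (- n) + 1"
      using c by (simp_all only: pos_le_divide_eq pos_divide_less_eq)
    then have "\<lfloor>y / (2 * pi)\<rfloor> = - n" by (simp add: floor_eq_iff)
    then show "n = - \<lfloor>y / (2 * pi)\<rfloor>" by simp
  qed
qed auto

text \<open>The integers are enumerated because integrals of nonnegative series are available for sequences.\<close>

lemma translation_tile_sum:
  assumes "translation_tile W"
  shows "(\<Sum>i. indicator W (y + 2 * pi * of_int (int_decode i)) :: ennreal) = 1"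
proof -
  obtain n where n: "y + 2 * pi * of_int n \<in> W" "\<And>m. y + 2 * pi * of_int m \<in> W \<Longrightarrow> m = n"
    using assms unfolding translation_tile_def by metis
  have "indicator W (y + 2 * pi * of_int (int_decode i)) = (if i = int_encode n then 1 else 0 :: ennreal)" for i
  proof -
    have "y + 2 * pi * of_int (int_decode i) \<in> W \<longleftrightarrow> int_decode i = n" using n by blast
    also have "\<dots> \<longleftrightarrow> i = int_encode n"
      using int_decode_inverse[of i] int_encode_inverse[of n] by auto
    finally show ?thesis by (simp add: indicator_def)
  qed
  moreover have "(\<lambda>i. if i = int_encode n then 1 else 0 :: ennreal) sums 1"
    using sums_single[of "int_encode n" "\<lambda>_. 1::ennreal"] by simp
  ultimately show ?thesis by (simp add: sums_iff)
qed

text \<open>Insert the sum of the translates of the indicator of \<open>U\<close>, which is one, and shift every term back: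
  this exchanges the roles of \<open>W\<close> and \<open>U\<close>.\<close>

lemma nn_integral_translation_tile:
  assumes W: "translation_tile W" and U: "translation_tile U"
    and p [measurable]: "p \<in> borel_measurable lebesgue" and per: "\<And>x n. p (x + 2 * pi * of_int n) = p x"
  shows "(\<integral>\<^sup>+x. p x * indicator W x \<partial>lebesgue) = (\<integral>\<^sup>+x. p x * indicator U x \<partial>lebesgue)"
proof -
  let ?t = "\<lambda>i. 2 * pi * of_int (int_decode i)"
  have [measurable]: "W \<in> sets lebesgue" "U \<in> sets lebesgue" using W U unfolding translation_tile_def by blast+
  have sh: "(\<lambda>x. indicator A (x + a) :: ennreal) \<in> borel_measurable lebesgue" if "A \<in> sets lebesgue" for A and a :: real
    using borel_measurable_lebesgue_affine[of "indicator A :: real \<Rightarrow> ennreal" 1 a] that by (simp add: add.commute)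
  have "(\<integral>\<^sup>+x. p x * indicator W x \<partial>lebesgue) = (\<integral>\<^sup>+x. (\<Sum>i. p x * indicator W x * indicator U (x + ?t i)) \<partial>lebesgue)"
    by (simp add: translation_tile_sum[OF U])
  also have "\<dots> = (\<Sum>i. \<integral>\<^sup>+x. p x * indicator W x * indicator U (x + ?t i) \<partial>lebesgue)"
    by (intro nn_integral_suminf borel_measurable_times_ennreal sh) auto
  also have "\<dots> = (\<Sum>i. \<integral>\<^sup>+x. p x * indicator U x * indicator W (x - ?t i) \<partial>lebesgue)"
  proof (intro suminf_cong)
    fix i
    have "(\<integral>\<^sup>+x. p x * indicator W x * indicator U (x + ?t i) \<partial>lebesgue)
      = ennreal \<bar>1\<bar> * (\<integral>\<^sup>+x. p (- ?t i + 1 * x) * indicator W (- ?t i + 1 * x) * indicator U (- ?t i + 1 * x + ?t i) \<partial>lebesgue)"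
      by (rule nn_integral_real_affine_lebesgue) (auto intro!: borel_measurable_times_ennreal sh)
    also have "\<dots> = (\<integral>\<^sup>+x. p x * indicator U x * indicator W (x - ?t i) \<partial>lebesgue)"
      using per[of _ "- int_decode i"] by (simp add: mult_ac add.commute)
    finally show "(\<integral>\<^sup>+x. p x * indicator W x * indicator U (x + ?t i) \<partial>lebesgue) = (\<integral>\<^sup>+x. p x * indicator U x * indicator W (x - ?t i) \<partial>lebesgue)" .
  qed
  also have "\<dots> = (\<integral>\<^sup>+x. (\<Sum>i. p x * indicator U x * indicator W (x - ?t i)) \<partial>lebesgue)"
    using sh[of W "- ?t i" for i] by (intro nn_integral_suminf[symmetric] borel_measurable_times_ennreal) auto
  also have "\<dots> = (\<integral>\<^sup>+x. p x * indicator U x \<partial>lebesgue)"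
  proof -
    have "translation_tile W \<Longrightarrow> (\<Sum>i. indicator W (x - ?t i) :: ennreal) = 1" for x
    proof -
      obtain n where n: "x + 2 * pi * of_int n \<in> W" "\<And>m. x + 2 * pi * of_int m \<in> W \<Longrightarrow> m = n"
        using W unfolding translation_tile_def by metis
      have "indicator W (x - ?t i) = (if i = int_encode (- n) then 1 else 0 :: ennreal)" for i
      proof -
        have "x - ?t i = x + 2 * pi * of_int (- int_decode i)" by simp
        then have "x - ?t i \<in> W \<longleftrightarrow> - int_decode i = n" using n by metis
        also have "\<dots> \<longleftrightarrow> i = int_encode (- n)" using int_decode_inverse[of i] int_encode_inverse[of "- n"] by auto
        finally show ?thesis by (simp add: indicator_def)
      qed
      moreover have "(\<lambda>i. if i = int_encode (- n) then 1 else 0 :: ennreal) sums 1"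
        using sums_single[of "int_encode (- n)" "\<lambda>_. 1::ennreal"] by simp
      ultimately show ?thesis by (simp add: sums_iff)
    qed
    then show ?thesis using W by simp
  qed
  finally show ?thesis .
qed

lemma emeasure_translation_tile:
  assumes "translation_tile W"
  shows "emeasure lebesgue W = ennreal (2 * pi)"
proof -
  have "W \<in> sets lebesgue" using assms unfolding translation_tile_def by blast
  moreover have "(\<integral>\<^sup>+x. 1 * indicator W x \<partial>lebesgue) = (\<integral>\<^sup>+x. 1 * indicator {0..<2 * pi} x \<partial>(lebesgue::real measure))"
    by (rule nn_integral_translation_tile[OF assms translation_tile_interval]) auto
  ultimately show ?thesis by simp
qed

text \<open>The summand one makes the integrand nonnegative, so that the integral can be transported to other
  fundamental domains by \<open>nn_integral_translation_tile\<close>.\<close>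

lemma nn_integral_trig_interval:
  assumes n: "n \<noteq> (0::int)"
  shows "(\<integral>\<^sup>+x. ennreal (1 + cos (of_int n * x)) * indicator {0..<2 * pi} x \<partial>lebesgue) = ennreal (2 * pi)"
    "(\<integral>\<^sup>+x. ennreal (1 + sin (of_int n * x)) * indicator {0..<2 * pi} x \<partial>lebesgue) = ennreal (2 * pi)"
proof -
  have ae: "AE x in lborel. indicator {0..<2 * pi} x = (indicator {0..2 * pi} x :: ennreal)"
    using AE_lborel_singleton[of "2 * pi"] by eventually_elim (auto simp: indicator_def)
  have sc: "sin (of_int n * (2 * pi)) = 0" "cos (of_int n * (2 * pi)) = 1"
    using sin_int_2pin[of n] cos_int_2pin[of n] by (simp_all add: mult_ac)
  have "(\<integral>\<^sup>+x. ennreal (1 + cos (of_int n * x)) * indicator {0..<2 * pi} x \<partial>lborel)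
     = (\<integral>\<^sup>+x. ennreal (1 + cos (of_int n * x)) * indicator {0..2 * pi} x \<partial>lborel)"
    using ae by (intro nn_integral_cong_AE) (auto elim!: eventually_mono)
  also have "\<dots> = ennreal ((2 * pi + sin (of_int n * (2 * pi)) / of_int n) - (0 + sin (of_int n * 0) / of_int n))"
  proof (rule nn_integral_FTC_Icc)
    show "((\<lambda>x. x + sin (of_int n * x) / of_int n) has_real_derivative 1 + cos (of_int n * x)) (at x)" for x :: real
      using n by (auto intro!: derivative_eq_intros)
    show "0 \<le> 1 + cos (of_int n * x)" for x :: real
      using cos_ge_minus_one[of "of_int n * x"] by linarith
  qed auto
  also have "\<dots> = ennreal (2 * pi)" by (simp only: sc) simp
  finally show "(\<integral>\<^sup>+x. ennreal (1 + cos (of_int n * x)) * indicator {0..<2 * pi} x \<partial>lebesgue) = ennreal (2 * pi)"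
    by (simp only: nn_integral_completion)
  have "(\<integral>\<^sup>+x. ennreal (1 + sin (of_int n * x)) * indicator {0..<2 * pi} x \<partial>lborel)
     = (\<integral>\<^sup>+x. ennreal (1 + sin (of_int n * x)) * indicator {0..2 * pi} x \<partial>lborel)"
    using ae by (intro nn_integral_cong_AE) (auto elim!: eventually_mono)
  also have "\<dots> = ennreal ((2 * pi - cos (of_int n * (2 * pi)) / of_int n) - (0 - cos (of_int n * 0) / of_int n))"
  proof (rule nn_integral_FTC_Icc)
    show "((\<lambda>x. x - cos (of_int n * x) / of_int n) has_real_derivative 1 + sin (of_int n * x)) (at x)" for x :: real
      using n by (auto intro!: derivative_eq_intros)
    show "0 \<le> 1 + sin (of_int n * x)" for x :: real
      using sin_ge_minus_one[of "of_int n * x"] by linarith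
  qed auto
  also have "\<dots> = ennreal (2 * pi)" by (simp only: sc) simp
  finally show "(\<integral>\<^sup>+x. ennreal (1 + sin (of_int n * x)) * indicator {0..<2 * pi} x \<partial>lebesgue) = ennreal (2 * pi)"
    by (simp only: nn_integral_completion)
qed

lemma integral_real_periodic_tile:
  assumes W: "translation_tile W" and q: "q \<in> borel_measurable borel" "\<And>x. \<bar>q x\<bar> \<le> (1::real)"
    "\<And>x n. q (x + 2 * pi * of_int n) = q x"
    "(\<integral>\<^sup>+x. ennreal (1 + q x) * indicator {0..<2 * pi} x \<partial>lebesgue) = ennreal (2 * pi)"
  shows "integrable lebesgue (\<lambda>x. q x * indicator W x)" "(\<integral>x. q x * indicator W x \<partial>lebesgue) = 0"
proof -
  have [measurable]: "W \<in> sets lebesgue" using W unfolding translation_tile_def by blast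
  have [measurable]: "q \<in> borel_measurable lebesgue" using q(1) by (rule borel_imp_lebesgue_measurable)
  have iW: "integrable lebesgue (indicator W :: real \<Rightarrow> real)"
    using emeasure_translation_tile[OF W] by (intro integrable_real_indicator) auto
  show i: "integrable lebesgue (\<lambda>x. q x * indicator W x)"
    by (rule Bochner_Integration.integrable_bound[OF iW]) (use q(2) in \<open>auto simp: indicator_def\<close>)
  have nonneg: "0 \<le> 1 + q x" for x
    using q(2)[of x] by linarith
  have "(\<integral>\<^sup>+x. ennreal ((1 + q x) * indicator W x) \<partial>lebesgue) = (\<integral>\<^sup>+x. ennreal (1 + q x) * indicator W x \<partial>lebesgue)"
    by (intro nn_integral_cong) (auto simp: indicator_def)
  also have "\<dots> = ennreal (2 * pi)"
    using nn_integral_translation_tile[OF W translation_tile_interval, of "\<lambda>x. ennreal (1 + q x)"] q(3,4) by simp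
  finally have "(\<integral>x. (1 + q x) * indicator W x \<partial>lebesgue) = 2 * pi"
    using nonneg by (subst integral_eq_nn_integral) auto
  moreover have "(\<integral>x. (1 + q x) * indicator W x \<partial>lebesgue) = (\<integral>x. indicator W x + q x * indicator W x \<partial>lebesgue)"
    by (simp add: distrib_right)
  moreover have "\<dots> = measure lebesgue W + (\<integral>x. q x * indicator W x \<partial>lebesgue)"
    using i iW by (subst Bochner_Integration.integral_add) auto
  moreover have "measure lebesgue W = 2 * pi"
    using emeasure_translation_tile[OF W] by (simp add: measure_def)
  ultimately show "(\<integral>x. q x * indicator W x \<partial>lebesgue) = 0" by simp
qed

text \<open>Orthogonality of the characters on any fundamental domain, transported from the standard
  interval.\<close>

lemma integral_cis_tile:
  assumes W: "translation_tile W"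
  shows "(\<integral>x. cis (of_int n * x) * complex_of_real (indicator W x) \<partial>lebesgue) = (if n = 0 then 2 * pi else 0)"
proof (cases "n = 0")
  case True
  have "measure lebesgue W = 2 * pi"
    using emeasure_translation_tile[OF W] by (simp add: measure_def)
  moreover have "W \<in> sets lebesgue" using W unfolding translation_tile_def by blast
  ultimately show ?thesis using True by simp
next
  case False
  have per: "cos (of_int n * (x + 2 * pi * of_int m)) = cos (of_int n * x)" "sin (of_int n * (x + 2 * pi * of_int m)) = sin (of_int n * x)" for x m
    using cis_two_pi_int[of "of_int n * x" "n * m"] by (simp_all add: complex_eq_iff algebra_simps)
  note c = integral_real_periodic_tile[OF W, of "\<lambda>x. cos (of_int n * x)", OF _ _ per(1) nn_integral_trig_interval(1)[OF False]]
  note s = integral_real_periodic_tile[OF W, of "\<lambda>x. sin (of_int n * x)", OF _ _ per(2) nn_integral_trig_interval(2)[OF False]]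
  let ?f = "\<lambda>x. cis (of_int n * x) * complex_of_real (indicator W x)"
  have eq: "?f x = complex_of_real (cos (of_int n * x) * indicator W x) + \<i> * complex_of_real (sin (of_int n * x) * indicator W x)" for x
    by (simp add: complex_eq_iff)
  have "(\<integral>x. ?f x \<partial>lebesgue) = (\<integral>x. complex_of_real (cos (of_int n * x) * indicator W x) \<partial>lebesgue)
      + (\<integral>x. \<i> * complex_of_real (sin (of_int n * x) * indicator W x) \<partial>lebesgue)"
    unfolding eq using c(1) s(1)
    by (intro Bochner_Integration.integral_add integrable_of_real integrable_mult_right) auto
  also have "\<dots> = 0"
    by (simp only: integral_mult_right_zero integral_complex_of_real) (use c(2) s(2) in simp)
  finally show ?thesis using False by simp
qed

lemma lebesgue_integral_real_affine_complex:
  fixes f :: "real \<Rightarrow> complex"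
  assumes f: "f \<in> borel_measurable lebesgue" and c: "c \<noteq> 0"
  shows "(\<integral>x. f x \<partial>lebesgue) = \<bar>c\<bar> *\<^sub>R (\<integral>x. f (t + c * x) \<partial>lebesgue)"
proof -
  let ?D = "distr lebesgue lebesgue (\<lambda>x. t + c * x)"
  have "(\<integral>x. f x \<partial>lebesgue) = (\<integral>x. f x \<partial>density ?D (\<lambda>_. ennreal \<bar>c\<bar>))"
    using lebesgue_real_affine[OF c, of t] by auto
  also have "\<dots> = (\<integral>x. \<bar>c\<bar> *\<^sub>R f x \<partial>?D)"
    using f by (intro integral_density) auto
  also have "\<dots> = \<bar>c\<bar> *\<^sub>R (\<integral>x. f x \<partial>?D)" by simp
  also have "(\<integral>x. f x \<partial>?D) = (\<integral>x. f (t + c * x) \<partial>lebesgue)"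
    using f c by (intro integral_distr lebesgue_measurable_affine) auto
  finally show ?thesis .
qed

section \<open>Linearity of the inverse transform\<close>

lemma L12_cmult: "f \<in> L12 \<Longrightarrow> (\<lambda>x. c * f x) \<in> L12"
  by (auto simp: L12_def intro: L2_cmult)

lemma L12_diff: "f \<in> L12 \<Longrightarrow> g \<in> L12 \<Longrightarrow> (\<lambda>x. f x - g x) \<in> L12"
  by (auto simp: L12_def intro: L2_diff)

lemma L12_sum: "(\<And>i. i \<in> F \<Longrightarrow> f i \<in> L12) \<Longrightarrow> (\<lambda>x. \<Sum>i\<in>F. f i x) \<in> L12"
  by (auto simp: L12_def intro: L2_sum)

lemma integrable_cis_mult:
  assumes "f \<in> L12" shows "integrable lebesgue (\<lambda>x. cis (t * x) * f x)"
proof -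
  have i: "integrable lebesgue f" using assms by (simp add: L12_def)
  have [measurable]: "f \<in> borel_measurable lebesgue" using i by (rule borel_measurable_integrable)
  have [measurable]: "(\<lambda>x. cis (t * x)) \<in> borel_measurable lebesgue"
    by (rule borel_imp_lebesgue_measurable) measurable
  show ?thesis by (rule Bochner_Integration.integrable_bound[OF i]) (auto simp: norm_mult)
qed

lemma ifourier_diff: "f \<in> L12 \<Longrightarrow> g \<in> L12 \<Longrightarrow> ifourier (\<lambda>x. f x - g x) t = ifourier f t - ifourier g t"
  unfolding ifourier_def right_diff_distrib
  by (subst Bochner_Integration.integral_diff) (auto simp: integrable_cis_mult right_diff_distrib)

lemma ifourier_sum: "(\<And>i. i \<in> F \<Longrightarrow> f i \<in> L12) \<Longrightarrow> ifourier (\<lambda>x. \<Sum>i\<in>F. c i * f i x) t = (\<Sum>i\<in>F. c i * ifourier (f i) t)"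
proof -
  assume f: "\<And>i. i \<in> F \<Longrightarrow> f i \<in> L12"
  have "(\<integral>x. cis (t * x) * (\<Sum>i\<in>F. c i * f i x) \<partial>lebesgue) = (\<integral>x. (\<Sum>i\<in>F. c i * (cis (t * x) * f i x)) \<partial>lebesgue)"
    by (simp add: sum_distrib_left mult_ac)
  also have "\<dots> = (\<Sum>i\<in>F. \<integral>x. c i * (cis (t * x) * f i x) \<partial>lebesgue)"
    by (intro Bochner_Integration.integral_sum integrable_mult_right integrable_cis_mult f)
  also have "\<dots> = (\<Sum>i\<in>F. c i * (\<integral>x. cis (t * x) * f i x \<partial>lebesgue))" by (simp only: integral_mult_right_zero)
  finally show ?thesis by (simp add: ifourier_def sum_distrib_left mult_ac)
qed

section \<open>The wavelet system on the frequency side\<close>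

text \<open>A fundamental domain for both groups: the translations by multiples of \<open>2 pi\<close> on the line and the
  dyadic dilations on the punctured line.\<close>

definition wavelet_tile :: "real set \<Rightarrow> bool" where
  "wavelet_tile W \<longleftrightarrow> translation_tile W \<and> 0 \<notin> W \<and> (\<forall>x. x \<noteq> 0 \<longrightarrow> (\<exists>!j::int. 2 powi j * x \<in> W))"

text \<open>The transform of the wavelet to be constructed; by \<open>emeasure_translation_tile\<close> the set \<open>W\<close> has
  measure \<open>2 pi\<close>, which explains the factor.\<close>

definition hat_wavelet :: "real set \<Rightarrow> real \<Rightarrow> complex" where
  "hat_wavelet W x = complex_of_real (1 / sqrt (2 * pi) * indicator W x)"

text \<open>The transforms of the members of \<^const>\<open>wavelet_system\<close>: a translation becomes a modulation,
  a dilation the inverse dilation.\<close>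

definition hat_system :: "real set \<Rightarrow> int \<times> int \<Rightarrow> real \<Rightarrow> complex" where
  "hat_system W = (\<lambda>(j, k) x. complex_of_real (2 powr (- of_int j / 2)) *
     (cis (- (of_int k * (2 powi (- j) * x))) * hat_wavelet W (2 powi (- j) * x)))"

lemma translation_tileD: "translation_tile W \<Longrightarrow> W \<in> sets lebesgue"
  unfolding translation_tile_def by blast

lemma wavelet_tileD:
  assumes "wavelet_tile W"
  shows "translation_tile W" "W \<in> sets lebesgue" "0 \<notin> W" "x \<noteq> 0 \<Longrightarrow> \<exists>!j::int. 2 powi j * x \<in> W"
  using assms translation_tileD unfolding wavelet_tile_def by blast+

lemma hat_wavelet_L12:
  assumes "translation_tile W" shows "hat_wavelet W \<in> L12"
proof -
  have W: "W \<in> sets lebesgue" using translation_tileD assms by blast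
  have f: "emeasure lebesgue W < \<infinity>" using emeasure_translation_tile[OF assms] by simp
  have eq: "hat_wavelet W = (\<lambda>x. complex_of_real (1 / sqrt (2 * pi)) * complex_of_real (indicator W x))"
    by (auto simp: hat_wavelet_def)
  have "integrable lebesgue (indicator W :: real \<Rightarrow> real)" using W f by (rule integrable_real_indicator)
  then show ?thesis unfolding eq by (intro L12_cmult) (auto simp: L12_def indicator_L2[OF W f])
qed

lemma L12_dilate:
  assumes f: "f \<in> L12" and c: "c \<noteq> 0"
  shows "(\<lambda>x. f (c * x)) \<in> L12"
proof -
  have m: "f \<in> borel_measurable lebesgue" using f by (auto simp: L12_def L2_iff)
  have fc: "(\<lambda>x. f (c * x)) \<in> borel_measurable lebesgue" using borel_measurable_lebesgue_affine[OF m c, of 0] by simp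
  have "nsq f = ennreal \<bar>c\<bar> * nsq (\<lambda>x. f (c * x))" using nsq_affine[OF m c, of 0] by simp
  then have 1: "(\<lambda>x. f (c * x)) \<in> L2"
    using f c fc by (auto simp: L12_def L2_iff ennreal_mult_less_top)
  have "(\<integral>\<^sup>+x. ennreal (norm (f x)) \<partial>lebesgue) = ennreal \<bar>c\<bar> * (\<integral>\<^sup>+x. ennreal (norm (f (0 + c * x))) \<partial>lebesgue)"
    using m c by (intro nn_integral_real_affine_lebesgue) auto
  moreover have "(\<integral>\<^sup>+x. ennreal (norm (f x)) \<partial>lebesgue) < \<infinity>" using f by (auto simp: L12_def integrable_iff_bounded)
  ultimately have "integrable lebesgue (\<lambda>x. f (c * x))"
    using c fc by (auto simp: integrable_iff_bounded ennreal_mult_less_top)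
  with 1 show ?thesis by (simp add: L12_def)
qed

lemma L12_modulate: "f \<in> L12 \<Longrightarrow> (\<lambda>x. cis (t * x) * f x) \<in> L12"
proof -
  assume f: "f \<in> L12"
  have [measurable]: "f \<in> borel_measurable lebesgue" using f by (auto simp: L12_def L2_iff)
  have [measurable]: "(\<lambda>x. cis (t * x)) \<in> borel_measurable lebesgue"
    by (rule borel_imp_lebesgue_measurable) measurable
  have "nsq (\<lambda>x. cis (t * x) * f x) = nsq f" by (simp add: nsq_def norm_mult)
  then show ?thesis using f integrable_cis_mult[OF f] by (auto simp: L12_def L2_iff)
qed

lemma hat_system_L12:
  assumes "translation_tile W" shows "hat_system W i \<in> L12"
proof (cases i)
  case (Pair j k)
  have "(\<lambda>x. cis (- of_int k * x) * hat_wavelet W x) \<in> L12" by (rule L12_modulate[OF hat_wavelet_L12[OF assms]])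
  from L12_dilate[OF this, of "2 powi (- j)"]
  have "(\<lambda>x. cis (- of_int k * (2 powi (- j) * x)) * hat_wavelet W (2 powi (- j) * x)) \<in> L12" by simp
  then show ?thesis unfolding Pair hat_system_def prod.case by (intro L12_cmult) simp
qed

lemma hat_system_L2: "translation_tile W \<Longrightarrow> hat_system W i \<in> L2"
  using hat_system_L12[of W i] by (simp add: L12_def)

lemma powi_two_powr: "(2::real) powi j = 2 powr (of_int j)"
  by (simp add: powr_real_of_int')

text \<open>The substitution \<open>z = 2 powi j * y\<close> in the inverse Fourier integral.\<close>

lemma wavelet_system_ifourier:
  assumes "translation_tile W"
  shows "wavelet_system (ifourier (hat_wavelet W)) i = ifourier (hat_system W i)"
proof
  fix x
  obtain j k where i: "i = (j, k)" by (cases i)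
  let ?c = "complex_of_real (1 / sqrt (2 * pi))"
  let ?f = "\<lambda>y. cis (- (of_int k * y)) * hat_wavelet W y"
  have m: "(\<lambda>z. cis (x * z) * hat_system W i z) \<in> borel_measurable lebesgue"
    using integrable_cis_mult[OF hat_system_L12[OF assms]] by auto
  have p: "(2::real) powi j \<noteq> 0" "(2::real) powi j > 0" by auto
  have "ifourier (hat_system W i) x = ?c * (\<bar>2 powi j\<bar> *\<^sub>R (\<integral>y. cis (x * (0 + 2 powi j * y)) * hat_system W i (0 + 2 powi j * y) \<partial>lebesgue))"
    unfolding ifourier_def by (subst lebesgue_integral_real_affine_complex[OF m p(1), of 0]) simp
  also have "(\<integral>y. cis (x * (0 + 2 powi j * y)) * hat_system W i (0 + 2 powi j * y) \<partial>lebesgue)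
     = (\<integral>y. complex_of_real (2 powr (- of_int j / 2)) * (cis ((2 powi j * x - of_int k) * y) * hat_wavelet W y) \<partial>lebesgue)"
  proof (intro Bochner_Integration.integral_cong refl)
    fix y :: real
    have 1: "2 powi (- j) * (0 + 2 powi j * y) = y" using p by (simp add: power_int_minus)
    have 2: "cis ((2 powi j * x - of_int k) * y) = cis (x * (0 + 2 powi j * y)) * cis (- (of_int k * y))"
      by (simp add: cis_mult algebra_simps)
    show "cis (x * (0 + 2 powi j * y)) * hat_system W i (0 + 2 powi j * y) =
       complex_of_real (2 powr (- of_int j / 2)) * (cis ((2 powi j * x - of_int k) * y) * hat_wavelet W y)"
      unfolding i hat_system_def prod.case 1 2 by (simp only: mult_ac)
  qed
  also have "\<dots> = complex_of_real (2 powr (- of_int j / 2)) * (\<integral>y. cis ((2 powi j * x - of_int k) * y) * hat_wavelet W y \<partial>lebesgue)"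
    by (simp only: integral_mult_right_zero)
  finally have "ifourier (hat_system W i) x = complex_of_real (2 powi j * 2 powr (- of_int j / 2)) * ifourier (hat_wavelet W) (2 powi j * x - of_int k)"
    using p by (simp add: ifourier_def scaleR_conv_of_real mult_ac)
  also have "2 powi j * 2 powr (- of_int j / 2) = (2 powr (of_int j / 2) :: real)"
    unfolding powi_two_powr by (simp flip: powr_add)
  finally show "wavelet_system (ifourier (hat_wavelet W)) i x = ifourier (hat_system W i) x"
    by (simp add: wavelet_system_def i)
qed

text \<open>Members of different scale have disjoint supports, because a dyadic orbit meets \<open>W\<close> only once.
  On one scale, rescaling reduces the inner product to the integral of a character over \<open>W\<close>.\<close>

lemma hat_system_orthonormal:
  assumes W: "wavelet_tile W"
  shows "L2_inner (hat_system W i) (hat_system W i') = (if i = i' then 1 else 0)"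
proof -
  obtain j k where i: "i = (j, k)" by (cases i)
  obtain j' k' where i': "i' = (j', k')" by (cases i')
  note T = wavelet_tileD(1)[OF W]
  show ?thesis
  proof (cases "j = j'")
    case False
    have "hat_wavelet W (2 powi (- j) * x) * cnj (hat_wavelet W (2 powi (- j') * x)) = 0" for x
    proof (cases "x = 0")
      case True then show ?thesis using wavelet_tileD(3)[OF W] by (simp add: hat_wavelet_def)
    next
      case False
      then have "\<not> (2 powi (- j) * x \<in> W \<and> 2 powi (- j') * x \<in> W)"
        using wavelet_tileD(4)[OF W False] \<open>j \<noteq> j'\<close> by (metis neg_equal_iff_equal)
      then show ?thesis by (auto simp: hat_wavelet_def indicator_def)
    qed
    then have z: "hat_system W i x * cnj (hat_system W i' x) = 0" for x
      unfolding i i' hat_system_def prod.case by (auto simp: mult_ac)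
    show ?thesis using False unfolding L2_inner_def z by (simp add: i i')
  next
    case True
    have p: "(2::real) powi j \<noteq> 0" "(2::real) powi j > 0" by auto
    let ?F = "\<lambda>x. hat_system W i x * cnj (hat_system W i' x)"
    have m: "?F \<in> borel_measurable lebesgue"
      using integrable_L2_product[OF hat_system_L2[OF T] hat_system_L2[OF T]] by auto
    have "L2_inner (hat_system W i) (hat_system W i') = \<bar>2 powi j\<bar> *\<^sub>R (\<integral>y. ?F (0 + 2 powi j * y) \<partial>lebesgue)"
      unfolding L2_inner_def by (rule lebesgue_integral_real_affine_complex[OF m p(1)])
    also have "(\<integral>y. ?F (0 + 2 powi j * y) \<partial>lebesgue)
       = (\<integral>y. complex_of_real (2 powr (- of_int j) / (2 * pi)) * (cis (of_int (k' - k) * y) * complex_of_real (indicator W y)) \<partial>lebesgue)"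
    proof (intro Bochner_Integration.integral_cong refl)
      fix y :: real
      have 1: "2 powi (- j) * (0 + 2 powi j * y) = y" using p by (simp add: power_int_minus)
      have 2: "cis (of_int (k' - k) * y) = cis (- (of_int k * y)) * cnj (cis (- (of_int k' * y)))"
        by (simp add: cis_mult cis_cnj algebra_simps)
      have 3: "hat_wavelet W y * cnj (hat_wavelet W y) = complex_of_real (1 / (2 * pi)) * complex_of_real (indicator W y)"
      proof -
        have "hat_wavelet W y * cnj (hat_wavelet W y) = complex_of_real ((1 / sqrt (2 * pi) * indicator W y) * (1 / sqrt (2 * pi) * indicator W y))"
          by (simp only: hat_wavelet_def complex_cnj_complex_of_real flip: of_real_mult)
        also have "(1 / sqrt (2 * pi) * indicator W y) * (1 / sqrt (2 * pi) * indicator W y) = 1 / (2 * pi) * (indicator W y :: real)"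
          by (auto simp: indicator_def)
        finally show ?thesis by (simp only: of_real_mult)
      qed
      have 4: "complex_of_real (2 powr (- of_int j / 2)) * complex_of_real (2 powr (- of_int j / 2)) = complex_of_real (2 powr (- of_int j))"
        unfolding of_real_mult[symmetric] powr_add[symmetric] by simp
      have "?F (0 + 2 powi j * y) = (complex_of_real (2 powr (- of_int j / 2)) * complex_of_real (2 powr (- of_int j / 2)))
         * ((cis (- (of_int k * y)) * cnj (cis (- (of_int k' * y)))) * (hat_wavelet W y * cnj (hat_wavelet W y)))"
        unfolding i i' True[symmetric] hat_system_def prod.case 1 complex_cnj_mult complex_cnj_complex_of_real by (simp only: mult_ac)
      also have "\<dots> = complex_of_real (2 powr (- of_int j) / (2 * pi)) * (cis (of_int (k' - k) * y) * complex_of_real (indicator W y))"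
        unfolding 2[symmetric] 3 4 by simp
      finally show "?F (0 + 2 powi j * y) = \<dots>" .
    qed
    also have "\<dots> = complex_of_real (2 powr (- of_int j) / (2 * pi)) * (if k' - k = 0 then 2 * pi else 0)"
      by (simp only: integral_mult_right_zero integral_cis_tile[OF T])
    finally have "L2_inner (hat_system W i) (hat_system W i') = complex_of_real (2 powi j * 2 powr (- of_int j)) * (if k' = k then 1 else 0)"
      using p by (auto simp: scaleR_conv_of_real)
    also have "2 powi j * 2 powr (- of_int j) = (1::real)"
      unfolding powi_two_powr by (simp flip: powr_add)
    finally show ?thesis using True by (auto simp: i i')
  qed
qed

section \<open>Completeness of the wavelet system\<close>

lemma closed_subspace_dilate:
  assumes V: "L2_closed_subspace V" and c: "c \<noteq> 0"
  shows "L2_closed_subspace {f \<in> L2. (\<lambda>x. f (c * x)) \<in> V}" (is "L2_closed_subspace ?U")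
  unfolding L2_closed_subspace_def
proof (intro conjI ballI allI impI)
  show "?U \<subseteq> L2" "(\<lambda>x. 0) \<in> ?U" using closed_subspaceD(2)[OF V] by (auto simp: L2_zero)
  show "(\<lambda>x. f x + g x) \<in> ?U" if "f \<in> ?U" "g \<in> ?U" for f g
    using that closed_subspaceD(3)[OF V] by (auto intro: L2_add)
  show "(\<lambda>x. a * f x) \<in> ?U" if "f \<in> ?U" for a f
    using that closed_subspaceD(4)[OF V] by (auto intro: L2_cmult)
  fix f assume f: "f \<in> L2" and lim: "\<forall>e>0. \<exists>g\<in>?U. nsq (\<lambda>x. f x - g x) < ennreal e"
  have dil: "ennreal \<bar>c\<bar> * nsq (\<lambda>x. g (c * x)) = nsq g" "(\<lambda>x. g (c * x)) \<in> L2" if "g \<in> L2" for g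
  proof -
    have m: "g \<in> borel_measurable lebesgue" using that by (simp add: L2_iff)
    show eq: "ennreal \<bar>c\<bar> * nsq (\<lambda>x. g (c * x)) = nsq g" using nsq_affine[OF m c, of 0] by simp
    have "(\<lambda>x. g (c * x)) \<in> borel_measurable lebesgue" using borel_measurable_lebesgue_affine[OF m c, of 0] by simp
    moreover have "nsq (\<lambda>x. g (c * x)) < \<infinity>"
    proof -
      have "ennreal \<bar>c\<bar> * nsq (\<lambda>x. g (c * x)) < \<infinity>" using eq that by (simp add: L2_iff)
      then show ?thesis using c by (auto simp: ennreal_mult_less_top)
    qed
    ultimately show "(\<lambda>x. g (c * x)) \<in> L2" by (simp add: L2_iff)
  qed
  have "(\<lambda>x. f (c * x)) \<in> V"
  proof (rule closed_subspace_limit[OF V dil(2)[OF f]])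
    fix e :: real assume e: "e > 0"
    then have "\<bar>c\<bar> * e > 0" using c by simp
    then obtain g where g: "g \<in> ?U" "nsq (\<lambda>x. f x - g x) < ennreal (\<bar>c\<bar> * e)" using lim by meson
    have "ennreal \<bar>c\<bar> * nsq (\<lambda>x. f (c * x) - g (c * x)) < ennreal \<bar>c\<bar> * ennreal e"
      using dil(1)[OF L2_diff[OF f, of g]] g e by (simp add: ennreal_mult)
    then have "nsq (\<lambda>x. f (c * x) - g (c * x)) < ennreal e"
      by (meson mult_left_mono not_le zero_le)
    then show "\<exists>g\<in>V. nsq (\<lambda>x. f (c * x) - g x) < ennreal e" using g(1) by (intro bexI[where x="\<lambda>x. g (c * x)"]) auto
  qed
  with f show "f \<in> ?U" by simp
qed

lemma tile_exponential_in_span: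
  assumes W: "translation_tile W"
  shows "(\<lambda>x. complex_of_real (indicator W x) * cis (of_int k * x)) \<in> L2_span (hat_system W)"
proof -
  have "(\<lambda>x. complex_of_real (sqrt (2 * pi)) * hat_system W (0, - k) x) \<in> L2_span (hat_system W)"
    by (intro closed_subspaceD(4)[OF closed_subspace_L2_span] in_L2_span hat_system_L2 W)
  also have "(\<lambda>x. complex_of_real (sqrt (2 * pi)) * hat_system W (0, - k) x) = (\<lambda>x. complex_of_real (indicator W x) * cis (of_int k * x))"
    by (auto simp: hat_system_def hat_wavelet_def)
  finally show ?thesis .
qed

text \<open>The periodic extension of \<open>S\<close> is approximated by trigonometric polynomials on the standard
  interval. The error is periodic as well, hence has the same norm on \<open>W\<close>, where the extension of \<open>S\<close>
  is \<open>S\<close> again.\<close>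

lemma indicator_subset_tile_in_span:
  assumes W: "translation_tile W" and S: "S \<in> sets lebesgue" "S \<subseteq> W"
  shows "(\<lambda>x. complex_of_real (indicator S x)) \<in> L2_span (hat_system W)"
proof (rule closed_subspace_limit[OF closed_subspace_L2_span[OF hat_system_L2[OF W]]])
  note Wm = translation_tileD[OF W]
  have "emeasure lebesgue S \<le> emeasure lebesgue W" using S Wm by (intro emeasure_mono) auto
  then show "(\<lambda>x. complex_of_real (indicator S x)) \<in> L2"
    using S(1) emeasure_translation_tile[OF W] by (intro indicator_L2) (auto simp: order.strict_trans1)
  define P where "P = (\<Union>n::int. (\<lambda>x. x + 2 * pi * of_int n) -` S)"
  have Pm [measurable]: "P \<in> sets lebesgue"
    unfolding P_def
  proof (intro sets.countable_UN'')
    fix n :: int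
    show "(\<lambda>x. x + 2 * pi * of_int n) -` S \<in> sets lebesgue"
      using measurable_sets[OF lebesgue_measurable_affine[of 1 "2 * pi * of_int n"] S(1)] by (simp add: add.commute)
  qed auto
  have Pper: "x + 2 * pi * of_int m \<in> P \<longleftrightarrow> x \<in> P" for x m
  proof
    assume "x + 2 * pi * of_int m \<in> P"
    then obtain n :: int where "x + 2 * pi * of_int m + 2 * pi * of_int n \<in> S" by (auto simp: P_def)
    then have "x + 2 * pi * of_int (m + n) \<in> S" by (simp add: algebra_simps)
    then show "x \<in> P" unfolding P_def by blast
  next
    assume "x \<in> P"
    then obtain n :: int where "x + 2 * pi * of_int n \<in> S" by (auto simp: P_def)
    then have "x + 2 * pi * of_int m + 2 * pi * of_int (n - m) \<in> S" by (simp add: algebra_simps)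
    then show "x + 2 * pi * of_int m \<in> P" unfolding P_def by blast
  qed
  have SP: "x \<in> S \<longleftrightarrow> x \<in> W \<and> x \<in> P" for x
  proof
    assume x: "x \<in> S"
    then have "x + 2 * pi * of_int 0 \<in> S" by simp
    then show "x \<in> W \<and> x \<in> P" using x S(2) unfolding P_def by blast
  next
    assume x: "x \<in> W \<and> x \<in> P"
    then obtain n :: int where n: "x + 2 * pi * of_int n \<in> S" by (auto simp: P_def)
    then have "x + 2 * pi * of_int n \<in> W" "x + 2 * pi * of_int 0 \<in> W" using S(2) x by auto
    then have "n = 0" using W unfolding translation_tile_def by blast
    then show "x \<in> S" using n by simp
  qed
  fix e :: real assume e: "e > 0"
  let ?I = "{0<..<2 * pi}"
  have "(\<lambda>x. complex_of_real (indicator (P \<inter> ?I) x)) \<in> L2_span interval_exp"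
    by (rule indicator_in_trig_span) auto
  then obtain F c where F: "finite F"
    "nsq (\<lambda>x. complex_of_real (indicator (P \<inter> ?I) x) - (\<Sum>k\<in>F. c k * interval_exp k x)) < ennreal e"
    unfolding L2_span_iff[OF interval_exp_L2] using e by meson
  define q where "q x = complex_of_real (indicator P x) - (\<Sum>k\<in>F. c k * cis (of_int k * x))" for x
  have qm [measurable]: "q \<in> borel_measurable lebesgue"
  proof -
    have "(\<lambda>x. \<Sum>k\<in>F. c k * cis (of_int k * x)) \<in> borel_measurable lebesgue"
      by (rule borel_imp_lebesgue_measurable) measurable
    then show ?thesis unfolding q_def[abs_def] using Pm
      by (intro borel_measurable_diff borel_measurable_of_real borel_measurable_indicator) auto
  qed
  have qper: "q (x + 2 * pi * of_int m) = q x" for x m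
  proof -
    have "cis (of_int k * (x + 2 * pi * of_int m)) = cis (of_int k * x)" for k
      using cis_two_pi_int[of "of_int k * x" "k * m"] by (simp add: algebra_simps)
    then show ?thesis unfolding q_def using Pper[of x m] by (simp add: indicator_def)
  qed
  have "nsq (\<lambda>x. complex_of_real (indicator (P \<inter> ?I) x) - (\<Sum>k\<in>F. c k * interval_exp k x))
     = (\<integral>\<^sup>+x. ennreal ((norm (q x))\<^sup>2) * indicator {0..<2 * pi} x \<partial>lebesgue)"
    unfolding nsq_def
  proof (rule nn_integral_cong_AE)
    have "AE x in lebesgue. x \<noteq> (0::real)" using AE_lborel_singleton[of 0] by (rule AE_completion)
    then show "AE x in lebesgue. ennreal ((norm (complex_of_real (indicator (P \<inter> ?I) x) - (\<Sum>k\<in>F. c k * interval_exp k x)))\<^sup>2)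
      = ennreal ((norm (q x))\<^sup>2) * indicator {0..<2 * pi} x"
      by eventually_elim (auto simp: indicator_def interval_exp_def q_def)
  qed
  also have "\<dots> = (\<integral>\<^sup>+x. ennreal ((norm (q x))\<^sup>2) * indicator W x \<partial>lebesgue)"
    by (rule nn_integral_translation_tile[OF translation_tile_interval W]) (auto simp: qper)
  also have "\<dots> = nsq (\<lambda>x. complex_of_real (indicator S x) - (\<Sum>k\<in>F. c k * (complex_of_real (indicator W x) * cis (of_int k * x))))"
    unfolding nsq_def by (intro nn_integral_cong) (auto simp: indicator_def q_def SP)
  finally have "nsq (\<lambda>x. complex_of_real (indicator S x) - (\<Sum>k\<in>F. c k * (complex_of_real (indicator W x) * cis (of_int k * x)))) < ennreal e"
    using F by simp
  moreover have "(\<lambda>x. \<Sum>k\<in>F. c k * (complex_of_real (indicator W x) * cis (of_int k * x))) \<in> L2_span (hat_system W)"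
    by (intro closed_subspace_sum closed_subspaceD(4) closed_subspace_L2_span hat_system_L2 W tile_exponential_in_span)
  ultimately show "\<exists>g\<in>L2_span (hat_system W). nsq (\<lambda>x. complex_of_real (indicator S x) - g x) < ennreal e"
    by (rule bexI)
qed

lemma hat_system_dilate:
  fixes j k m :: int and x :: real
  shows "hat_system W (j, k) (2 powi m * x) = complex_of_real (2 powr (- of_int m / 2)) * hat_system W (j - m, k) x"
proof -
  have 1: "2 powi (- j) * (2 powi m * x) = 2 powi (- (j - m)) * x"
    by (simp add: algebra_simps flip: power_int_add)
  have 2: "2 powr (- of_int j / 2) = 2 powr (- of_int m / 2) * (2 powr (- of_int (j - m) / 2) :: real)"
    unfolding powr_add[symmetric] by (simp add: field_simps)
  show ?thesis unfolding hat_system_def prod.case 1 2 of_real_mult by (simp only: mult.assoc)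
qed

text \<open>Dilations permute the system up to scalars.\<close>

lemma hat_span_dilate:
  assumes W: "translation_tile W" and f: "f \<in> L2_span (hat_system W)"
  shows "(\<lambda>x. f (2 powi m * x)) \<in> L2_span (hat_system W)"
proof -
  note V = closed_subspace_L2_span[OF hat_system_L2[OF W]]
  have "L2_span (hat_system W) \<subseteq> {f \<in> L2. (\<lambda>x. f (2 powi m * x)) \<in> L2_span (hat_system W)}"
  proof (rule L2_span_least[OF closed_subspace_dilate[OF V]])
    show "(2::real) powi m \<noteq> 0" by simp
    fix i :: "int \<times> int"
    obtain j k where i: "i = (j, k)" by (cases i)
    have "(\<lambda>x. complex_of_real (2 powr (- of_int m / 2)) * hat_system W (j - m, k) x) \<in> L2_span (hat_system W)"
      by (intro closed_subspaceD(4)[OF V] in_L2_span hat_system_L2 W)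
    then show "hat_system W i \<in> {f \<in> L2. (\<lambda>x. f (2 powi m * x)) \<in> L2_span (hat_system W)}"
      by (simp add: i hat_system_dilate hat_system_L2 W)
  qed
  with f show ?thesis by blast
qed

text \<open>Subsets of \<open>W\<close> are dealt with by \<open>indicator_subset_tile_in_span\<close>; dilating them gives the subsets
  of the sets \<open>D j\<close>, and these cover all of the line except the origin.\<close>

lemma hat_system_complete:
  assumes W: "wavelet_tile W"
  shows "L2_span (hat_system W) = L2"
proof -
  note T = wavelet_tileD(1)[OF W]
  note V = closed_subspace_L2_span[OF hat_system_L2[OF T]]
  note Wm [measurable] = wavelet_tileD(2)[OF W]
  show ?thesis
  proof (rule closed_subspace_eq_L2[OF V])
    fix S :: "real set" assume S: "S \<in> sets lebesgue" "emeasure lebesgue S < \<infinity>"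
    define D where "D j = {x. 2 powi j * x \<in> W}" for j :: int
    have Dm: "D j \<in> sets lebesgue" for j
    proof -
      have "(\<lambda>x. 0 + 2 powi j * x) -` W \<inter> space lebesgue \<in> sets lebesgue"
        by (intro measurable_sets[OF lebesgue_measurable_affine] Wm) auto
      then show ?thesis by (simp add: D_def vimage_def)
    qed
    have piece: "(\<lambda>x. complex_of_real (indicator (S \<inter> D j) x)) \<in> L2_span (hat_system W)" for j
    proof -
      define R where "R = W \<inter> (\<lambda>x. 0 + 2 powi (- j) * x) -` S"
      have "(\<lambda>x. 0 + 2 powi (- j) * x) -` S \<inter> space lebesgue \<in> sets lebesgue"
        by (intro measurable_sets[OF lebesgue_measurable_affine] S) auto
      then have "R \<in> sets lebesgue" using Wm by (auto simp: R_def)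
      then have "(\<lambda>x. complex_of_real (indicator R x)) \<in> L2_span (hat_system W)"
        by (intro indicator_subset_tile_in_span T) (auto simp: R_def)
      then have "(\<lambda>x. complex_of_real (indicator R (2 powi j * x))) \<in> L2_span (hat_system W)"
        by (rule hat_span_dilate[OF T])
      moreover have "indicator R (2 powi j * x) = (indicator (S \<inter> D j) x :: real)" for x
      proof -
        have e: "2 powi (- j) * (2 powi j * x) = x" by (simp add: power_int_minus flip: mult.assoc)
        show ?thesis by (auto simp: indicator_def R_def D_def e)
      qed
      ultimately show ?thesis by simp
    qed
    define G where "G n = (\<Union>j\<in>{- int n..int n}. S \<inter> D j)" for n
    have Dx: "\<exists>!j. x \<in> D j" if "x \<noteq> 0" for x using wavelet_tileD(4)[OF W that] by (simp add: D_def)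
    have D0: "0 \<notin> D j" for j using wavelet_tileD(3)[OF W] by (simp add: D_def)
    have Gsum: "complex_of_real (indicator (G n) x) = (\<Sum>j\<in>{- int n..int n}. complex_of_real (indicator (S \<inter> D j) x))" for n x
    proof (cases "\<exists>j. x \<in> D j")
      case False
      then show ?thesis by (auto simp: G_def indicator_def)
    next
      case True
      then obtain j where j: "x \<in> D j" by blast
      have x: "x \<noteq> 0" using D0 j by metis
      have iff: "x \<in> D i \<longleftrightarrow> i = j" for i using Dx[OF x] j by blast
      have "(\<Sum>i\<in>{- int n..int n}. complex_of_real (indicator (S \<inter> D i) x)) = (\<Sum>i\<in>{- int n..int n}. if i = j then complex_of_real (indicator S x) else 0)"
        by (intro sum.cong refl) (auto simp: indicator_def iff)
      also have "\<dots> = (if j \<in> {- int n..int n} then complex_of_real (indicator S x) else 0)" by simp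
      also have "\<dots> = complex_of_real (indicator (G n) x)" by (auto simp: G_def indicator_def iff)
      finally show ?thesis by simp
    qed
    have Gm: "G n \<in> sets lebesgue" for n using S Dm by (auto simp: G_def)
    show "(\<lambda>x. complex_of_real (indicator S x)) \<in> L2_span (hat_system W)"
    proof (rule closed_subspace_tendsto[OF V indicator_L2[OF S]])
      show "(\<lambda>x. complex_of_real (indicator (G n) x)) \<in> L2_span (hat_system W)" for n
        unfolding Gsum by (intro closed_subspace_sum[OF V] piece)
      show "(\<lambda>n. nsq (\<lambda>x. complex_of_real (indicator S x) - complex_of_real (indicator (G n) x))) \<longlonglongrightarrow> 0"
      proof (rule nsq_dominated_convergence[OF _ indicator_L2[OF S]])
        show "(\<lambda>x. complex_of_real (indicator S x) - complex_of_real (indicator (G n) x)) \<in> borel_measurable lebesgue" for n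
          using S(1) Gm by measurable
        show "norm (complex_of_real (indicator S x) - complex_of_real (indicator (G n) x)) \<le> norm (complex_of_real (indicator S x))" for n x
          by (auto simp: indicator_def G_def)
        have "AE x in lebesgue. x \<noteq> (0::real)" using AE_lborel_singleton[of 0] by (rule AE_completion)
        then show "AE x in lebesgue. (\<lambda>n. complex_of_real (indicator S x) - complex_of_real (indicator (G n) x)) \<longlonglongrightarrow> 0"
        proof eventually_elim
          case (elim x)
          then obtain j where j: "x \<in> D j" using Dx by blast
          have "x \<in> G n \<longleftrightarrow> x \<in> S" if "n \<ge> nat \<bar>j\<bar>" for n
          proof -
            have "j \<in> {- int n..int n}" using that by auto
            then show ?thesis using j by (auto simp: G_def)
          qed
          then show ?case
            by (intro tendsto_eventually) (auto simp: eventually_sequentially indicator_def)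
        qed
      qed
    qed
  qed
qed

text \<open>The wavelet is the inverse transform of the normalised indicator of \<open>W\<close>. Since \<^const>\<open>ifourier\<close> is
  isometric with dense range, it takes the complete orthonormal system on the frequency side to a
  complete orthonormal system.\<close>

theorem wavelet_set_of_tile:
  assumes W: "wavelet_tile W"
  shows "wavelet_set W"
proof -
  note T = wavelet_tileD(1)[OF W]
  let ?w = "ifourier (hat_wavelet W)"
  let ?\<psi> = "wavelet_system ?w"
  have \<psi>: "?\<psi> i = ifourier (hat_system W i)" for i by (rule wavelet_system_ifourier[OF T])
  have \<psi>L: "?\<psi> i \<in> L2" for i unfolding \<psi> by (intro ifourier_L2 hat_system_L12 T)
  note V = closed_subspace_L2_span[of ?\<psi>, OF \<psi>L]
  have img: "ifourier g \<in> L2_span ?\<psi>" if g: "g \<in> L12" for g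
    unfolding L2_span_iff[of ?\<psi>, OF \<psi>L]
  proof (intro conjI allI impI ifourier_L2[OF g])
    fix e :: real assume e: "e > 0"
    have "g \<in> L2_span (hat_system W)" using g by (simp add: hat_system_complete[OF W] L12_def)
    then obtain F c where F: "finite F" "nsq (\<lambda>x. g x - (\<Sum>i\<in>F. c i * hat_system W i x)) < ennreal e"
      unfolding L2_span_iff[OF hat_system_L2[OF T]] using e by meson
    have S: "(\<lambda>x. \<Sum>i\<in>F. c i * hat_system W i x) \<in> L12"
      by (intro L12_sum L12_cmult hat_system_L12 T)
    have "ifourier (\<lambda>x. g x - (\<Sum>i\<in>F. c i * hat_system W i x)) t = ifourier g t - (\<Sum>i\<in>F. c i * ?\<psi> i t)" for t
      unfolding ifourier_diff[OF g S] \<psi> by (subst ifourier_sum) (auto intro: hat_system_L12 T)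
    then have "(\<lambda>t. ifourier g t - (\<Sum>i\<in>F. c i * ?\<psi> i t)) = ifourier (\<lambda>x. g x - (\<Sum>i\<in>F. c i * hat_system W i x))"
      by (intro ext) (rule sym)
    then have "nsq (\<lambda>t. ifourier g t - (\<Sum>i\<in>F. c i * ?\<psi> i t)) = nsq (ifourier (\<lambda>x. g x - (\<Sum>i\<in>F. c i * hat_system W i x)))"
      by (rule arg_cong)
    also have "\<dots> = nsq (\<lambda>x. g x - (\<Sum>i\<in>F. c i * hat_system W i x))" by (intro plancherel L12_diff g S)
    finally show "\<exists>F c. finite F \<and> nsq (\<lambda>t. ifourier g t - (\<Sum>i\<in>F. c i * ?\<psi> i t)) < ennreal e"
      using F by (intro exI[of _ F] exI[of _ c]) simp
  qed
  have dense: "f \<in> L2_span ?\<psi>" if f: "f \<in> L12" for f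
  proof (rule closed_subspace_limit[OF V])
    show "f \<in> L2" using f by (simp add: L12_def)
    show "\<exists>g\<in>L2_span ?\<psi>. nsq (\<lambda>x. f x - g x) < ennreal e" if "e > 0" for e
      using ifourier_dense[OF f that] img by blast
  qed
  have span: "L2_span ?\<psi> = L2"
  proof (rule closed_subspace_eq_L2[OF V])
    fix S :: "real set" assume S: "S \<in> sets lebesgue" "emeasure lebesgue S < \<infinity>"
    have "integrable lebesgue (indicator S :: real \<Rightarrow> real)" using S by (rule integrable_real_indicator)
    then have "(\<lambda>x. complex_of_real (indicator S x)) \<in> L12"
      using indicator_L2[OF S] by (simp add: L12_def)
    then show "(\<lambda>x. complex_of_real (indicator S x)) \<in> L2_span ?\<psi>" by (rule dense)
  qed
  have on: "L2_inner (?\<psi> i) (?\<psi> i') = (if i = i' then 1 else 0)" for i i'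
    unfolding \<psi> parseval[OF hat_system_L12[OF T] hat_system_L12[OF T]] by (rule hat_system_orthonormal[OF W])
  have "orthonormal_basis_L2 ?\<psi>"
    unfolding orthonormal_basis_L2_def
  proof (intro conjI allI ballI impI \<psi>L on)
    fix f and e :: real assume "f \<in> L2" "e > 0"
    then have "f \<in> L2_span ?\<psi>" by (simp add: span)
    then show "\<exists>F c. finite F \<and> L2_dist f (\<lambda>x. \<Sum>i\<in>F. c i * ?\<psi> i x) < e"
      using \<open>e > 0\<close> unfolding L2_span_def by blast
  qed
  then have "orthonormal_wavelet ?w"
    by (simp add: orthonormal_wavelet_def ifourier_L2 hat_wavelet_L12 T)
  moreover have "measure lebesgue W = 2 * pi"
    using emeasure_translation_tile[OF T] by (simp add: measure_def)
  then have "fourier_L2 ?w (\<lambda>x. complex_of_real (1 / sqrt (measure lebesgue W) * indicator W x))"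
    using fourier_L2_ifourier[OF hat_wavelet_L12[OF T]] by (simp only: hat_wavelet_def[abs_def])
  ultimately show ?thesis unfolding wavelet_set_def using wavelet_tileD(2)[OF W] by blast
qed

section \<open>Reduction modulo translations in coordinates\<close>

text \<open>Up to the factor \<open>2 pi\<close> the inverse of \<^const>\<open>xi\<close>: the representative of \<open>x\<close> modulo one in
  \<open>[-1,-1/2) \<union> [1/2,1)\<close>.\<close>

definition lift :: "real \<Rightarrow> real" where
  "lift x = (if x < 1/2 then x - 1 else x)"

lemma lift_in_E: "x \<in> {0..<1} \<Longrightarrow> 2 * pi * lift x \<in> E"
  by (auto simp: lift_def E_def algebra_simps)

lemma lift_nonzero: "x \<in> {0..<1} \<Longrightarrow> lift x \<noteq> 0"
  by (auto simp: lift_def)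

lemma xi_E:
  assumes "e \<in> E" shows "xi e \<in> {0..<1}" "2 * pi * lift (xi e) = e"
proof -
  have "xi e \<in> {0..<1} \<and> 2 * pi * lift (xi e) = e"
  proof (cases "e \<in> {pi..<2 * pi}")
    case True
    then have "xi e = e / (2 * pi)" "1/2 \<le> e / (2 * pi)" "e / (2 * pi) < 1" "0 \<le> e / (2 * pi)"
      by (auto simp: xi_def field_simps)
    then show ?thesis by (simp add: lift_def)
  next
    case False
    then have e: "- 2 * pi \<le> e" "e < - pi" using assms by (auto simp: E_def)
    have "xi e = e / (2 * pi) + 1" using False by (simp add: xi_def)
    moreover have "-1 \<le> e / (2 * pi)" "e / (2 * pi) < - 1/2"
      using e by (auto simp: field_simps)
    moreover have "2 * pi * (e / (2 * pi)) = e" by simp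
    ultimately show ?thesis by (simp add: lift_def)
  qed
  then show "xi e \<in> {0..<1}" "2 * pi * lift (xi e) = e" by auto
qed

lemma xi_lift: "x \<in> {0..<1} \<Longrightarrow> xi (2 * pi * lift x) = x"
proof -
  assume x: "x \<in> {0..<1}"
  show ?thesis
  proof (cases "x < 1/2")
    case True
    then have "2 * pi * lift x < pi" using x by (auto simp: lift_def algebra_simps intro: order.strict_trans2[OF _ pi_ge_zero])
    then show ?thesis using True x by (simp add: xi_def lift_def)
  next
    case False
    then have "2 * pi * lift x \<in> {pi..<2 * pi}" using x by (auto simp: lift_def)
    then show ?thesis using False by (simp add: xi_def lift_def)
  qed
qed

lemma bij_xi: "bij_betw xi E {0..<1}"
  by (rule bij_betw_byWitness[where f'="\<lambda>x. 2 * pi * lift x"]) (auto simp: xi_E xi_lift lift_in_E simp del: atLeastLessThan_iff)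

lemma bij_chart: "bij_betw (\<lambda>x. 2 * pi * lift x) {0..<1} E"
  by (rule bij_betw_byWitness[where f'=xi]) (auto simp: xi_E xi_lift lift_in_E simp del: atLeastLessThan_iff)

lemma inv_into_xi: "x \<in> {0..<1} \<Longrightarrow> inv_into E xi x = 2 * pi * lift x"
  by (rule inv_into_f_eq[OF bij_betw_imp_inj_on[OF bij_xi] lift_in_E xi_lift])

lemma xi_eq_frac:
  assumes "e \<in> E" shows "xi e = frac (e / (2 * pi))"
proof -
  have "e / (2 * pi) = lift (xi e)" using xi_E(2)[OF assms] by (simp add: field_simps)
  then have "e / (2 * pi) - xi e \<in> \<int>" by (simp add: lift_def)
  then show ?thesis using xi_E(1)[OF assms] by (intro sym[of "frac _"]) (simp add: frac_unique_iff)
qed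

lemma E_translation_unique: "\<exists>!j::int. y + 2 * of_int j * pi \<in> E"
proof -
  define r where "r = frac (y / (2 * pi))"
  have r: "r \<in> {0..<1}" by (simp add: r_def frac_lt_1)
  have "lift r - y / (2 * pi) \<in> \<int>"
  proof -
    have "r - y / (2 * pi) \<in> \<int>" by (simp add: r_def frac_def)
    moreover have "lift r - r \<in> \<int>" by (simp add: lift_def)
    ultimately have "(lift r - r) + (r - y / (2 * pi)) \<in> \<int>" by (rule Ints_add[rotated])
    then show ?thesis by simp
  qed
  then obtain j where "lift r - y / (2 * pi) = of_int j" by (elim Ints_cases)
  then have "lift r = of_int j + y / (2 * pi)" by simp
  then have "2 * pi * lift r = y + 2 * of_int j * pi" by (simp add: field_simps)
  then have ex: "y + 2 * of_int j * pi \<in> E" using lift_in_E[OF r] by simp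
  show ?thesis
  proof (rule ex1I[where a=j])
    show "y + 2 * of_int j * pi \<in> E" by (rule ex)
    fix i :: int assume i: "y + 2 * of_int i * pi \<in> E"
    have "frac ((y + 2 * of_int i * pi) / (2 * pi)) = frac ((y + 2 * of_int j * pi) / (2 * pi))"
      by (simp add: add_divide_distrib frac_def)
    then have "xi (y + 2 * of_int i * pi) = xi (y + 2 * of_int j * pi)"
      using i ex by (simp add: xi_eq_frac)
    then have "y + 2 * of_int i * pi = y + 2 * of_int j * pi"
      by (rule inj_onD[OF bij_betw_imp_inj_on[OF bij_xi] _ i ex])
    then show "i = j" by simp
  qed
qed

lemma tau_in_E: "tau y \<in> E" and tau_eqI: "y + 2 * of_int j * pi \<in> E \<Longrightarrow> tau y = y + 2 * of_int j * pi"
proof -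
  show "tau y \<in> E" unfolding tau_def using theI'[OF E_translation_unique[of y]] .
  assume "y + 2 * of_int j * pi \<in> E"
  then have "(THE j::int. y + 2 * of_int j * pi \<in> E) = j"
    using E_translation_unique[of y] by (intro the1_equality)
  then show "tau y = y + 2 * of_int j * pi" by (simp add: tau_def)
qed

lemma tau_translate: "\<exists>j::int. tau y = y + 2 * of_int j * pi"
  unfolding tau_def by blast

lemma xi_tau: "xi (tau y) = frac (y / (2 * pi))"
proof -
  obtain j :: int where "tau y = y + 2 * of_int j * pi" using tau_translate by blast
  then show ?thesis using xi_eq_frac[OF tau_in_E[of y]] by (simp add: add_divide_distrib frac_def)
qed

lemma tau_eq_iff: "tau y = tau z \<longleftrightarrow> (\<exists>n::int. z = y + 2 * pi * of_int n)"
proof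
  assume "tau y = tau z"
  moreover obtain i j :: int where "tau y = y + 2 * of_int i * pi" "tau z = z + 2 * of_int j * pi" using tau_translate by meson
  ultimately have "z = y + 2 * pi * of_int (i - j)" by (simp add: algebra_simps)
  then show "\<exists>n::int. z = y + 2 * pi * of_int n" by blast
next
  assume "\<exists>n::int. z = y + 2 * pi * of_int n"
  then obtain n :: int where n: "z = y + 2 * pi * of_int n" by blast
  obtain j :: int where j: "tau z = z + 2 * of_int j * pi" using tau_translate by blast
  then have "tau z = y + 2 * of_int (n + j) * pi" by (simp add: n algebra_simps)
  then show "tau y = tau z" using tau_eqI[of y "n + j"] tau_in_E[of z] by simp
qed

section \<open>Reduction modulo dilations\<close>

text \<open>The exponent is read off from the binary logarithm of \<open>y / c\<close>.\<close>

lemma dyadic_scale: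
  assumes "y > 0" "c > (0::real)" obtains k :: int where "c \<le> 2 powi k * y" "2 powi k * y < 2 * c"
proof -
  define k where "k = - \<lfloor>log 2 (y / c)\<rfloor>"
  have p: "y / c > 0" using assms by simp
  have "2 powr (of_int k) * (y / c) = 2 powr (of_int k + log 2 (y / c))"
    using p by (simp add: powr_add)
  moreover have "0 \<le> of_int k + log 2 (y / c)" "of_int k + log 2 (y / c) < 1"
    unfolding k_def by linarith+
  then have "1 \<le> 2 powr (of_int k + log 2 (y / c))" "2 powr (of_int k + log 2 (y / c)) < 2"
    using powr_mono[of 0 "of_int k + log 2 (y / c)" 2] powr_less_mono[of "of_int k + log 2 (y / c)" 1 2] by simp_all
  ultimately have "1 \<le> 2 powi k * (y / c)" "2 powi k * (y / c) < 2" by (simp_all add: powi_two_powr)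
  then show ?thesis using assms that[of k] by (simp add: field_simps)
qed

lemma powi_two_add: "(2::real) powi (a + b) = 2 powi a * 2 powi b"
  by (simp add: power_int_add)

lemma E_dilation_unique:
  assumes x: "x \<noteq> 0" shows "\<exists>!k::int. 2 powi k * x \<in> E"
proof -
  have ex: "\<exists>k::int. 2 powi k * x \<in> E"
  proof (cases "x > 0")
    case True
    obtain k where "pi \<le> 2 powi k * x" "2 powi k * x < 2 * pi" using dyadic_scale[OF True pi_gt_zero] .
    then show ?thesis by (auto simp: E_def)
  next
    case False
    then have "2 * pi\<^sup>2 / - x > 0" using x by (intro divide_pos_pos) auto
    then obtain k where k: "pi \<le> 2 powi k * (2 * pi\<^sup>2 / - x)" "2 powi k * (2 * pi\<^sup>2 / - x) < 2 * pi"
      using dyadic_scale pi_gt_zero by blast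
    have z: "(2::real) powi k > 0" "- x > 0" using False x by auto
    have "pi * - x \<le> 2 powi k * (2 * pi\<^sup>2)" "2 powi k * (2 * pi\<^sup>2) < 2 * pi * - x"
      using k z(2) by (simp_all only: times_divide_eq_right pos_le_divide_eq pos_divide_less_eq)
    then have "pi * - x \<le> pi * (2 powi k * (2 * pi))" "pi * (2 powi k * (2 * pi)) < pi * (2 * - x)"
      by (simp_all add: power2_eq_square algebra_simps)
    then have "- x \<le> 2 powi k * (2 * pi)" "2 powi k * pi < - x"
      unfolding mult_le_cancel_left_pos[OF pi_gt_zero] mult_less_cancel_left_pos[OF pi_gt_zero] by (simp_all add: mult.commute)
    then have "2 powi (- k) * (- x) \<le> 2 powi (- k) * (2 powi k * (2 * pi))" "2 powi (- k) * (2 powi k * pi) < 2 powi (- k) * (- x)"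
      by - ((intro mult_left_mono mult_strict_left_mono; simp)+)
    moreover have "2 powi (- k) * (2 powi k * c) = (c::real)" for c by (simp add: power_int_minus flip: mult.assoc)
    ultimately have "2 powi (- k) * x \<in> E" by (auto simp: E_def)
    then show ?thesis by blast
  qed
  have le: "k \<le> l" if "2 powi k * x \<in> E" "2 powi l * x \<in> E" for k l :: int
  proof (rule ccontr)
    assume "\<not> k \<le> l"
    then have "l + 1 \<le> k" by simp
    then have "(2::real) powi (l + 1) \<le> 2 powi k" by (rule power_int_increasing) simp
    then have 1: "2 * (2 powi l * \<bar>x\<bar>) \<le> 2 powi k * \<bar>x\<bar>"
      using mult_right_mono[of "2 powi (l + 1)" "2 powi k" "\<bar>x\<bar>"] by (simp add: powi_two_add mult_ac)
    have ab: "2 powi l * \<bar>x\<bar> = \<bar>2 powi l * x\<bar>" "2 powi k * \<bar>x\<bar> = \<bar>2 powi k * x\<bar>" by (simp_all add: abs_mult)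
    have 1: "2 * \<bar>2 powi l * x\<bar> \<le> \<bar>2 powi k * x\<bar>" using 1 unfolding ab .
    show False
    proof (cases "x > 0")
      case True
      then have pos: "2 powi l * x > 0" "2 powi k * x > 0" by simp_all
      then have "pi \<le> 2 powi l * x" "2 powi k * x < 2 * pi" using that pi_gt_zero by (auto simp: E_def)
      then show False using 1 pos by linarith
    next
      case False
      then have neg: "2 powi l * x \<le> 0" "2 powi k * x \<le> 0" by (auto simp: mult_le_0_iff)
      then have "2 powi l * x < - pi" "- 2 * pi \<le> 2 powi k * x" using that pi_gt_zero by (auto simp: E_def)
      then show False using 1 neg by linarith
    qed
  qed
  show ?thesis using ex le by (metis order_antisym)
qed

lemma delta_eqI: "x \<noteq> 0 \<Longrightarrow> 2 powi k * x \<in> E \<Longrightarrow> delta x = 2 powi k * x"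
proof -
  assume "x \<noteq> 0" "2 powi k * x \<in> E"
  then have "(THE k::int. 2 powi k * x \<in> E) = k"
    using E_dilation_unique[of x] by (intro the1_equality)
  then show "delta x = 2 powi k * x" by (simp add: delta_def)
qed

lemma delta_in_E: "x \<noteq> 0 \<Longrightarrow> delta x \<in> E"
  unfolding delta_def using theI'[OF E_dilation_unique[of x]] .

lemma delta_dilate: "\<exists>k::int. delta x = 2 powi k * x"
  unfolding delta_def by blast

lemma delta_scale:
  assumes "x \<noteq> 0" shows "delta (2 powi n * x) = delta x"
proof -
  obtain k where k: "delta x = 2 powi k * x" using delta_dilate by blast
  then have "2 powi (k - n) * (2 powi n * x) = delta x" by (simp flip: mult.assoc powi_two_add)
  then show ?thesis using delta_eqI[of "2 powi n * x" "k - n"] delta_in_E[OF assms] assms by simp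
qed

lemma delta_eq_iff:
  assumes "y \<noteq> 0" "z \<noteq> 0"
  shows "delta y = delta z \<longleftrightarrow> (\<exists>n::int. z = 2 powi n * y)"
proof
  assume e: "delta y = delta z"
  obtain i j where "delta y = 2 powi i * y" "delta z = 2 powi j * z" using delta_dilate by meson
  then have "2 powi (- j) * (2 powi j * z) = 2 powi (- j) * (2 powi i * y)" using e by simp
  then have "z = 2 powi (i - j) * y" by (simp flip: mult.assoc powi_two_add)
  then show "\<exists>n::int. z = 2 powi n * y" by blast
next
  assume "\<exists>n::int. z = 2 powi n * y"
  then show "delta y = delta z" using delta_scale[OF assms(1)] by auto
qed

text \<open>The fibres of \<^const>\<open>tau\<close> are the classes modulo \<open>2 pi\<close>, those of \<^const>\<open>delta\<close> the dyadic
  orbits.\<close>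

lemma wavelet_tileI:
  assumes W: "W \<in> sets lebesgue" "0 \<notin> W" and tau: "bij_betw tau W E" and delta: "bij_betw delta W E"
  shows "wavelet_tile W"
  unfolding wavelet_tile_def translation_tile_def
proof (intro conjI allI impI W)
  fix y :: real
  obtain w where w: "w \<in> W" "tau w = tau y" using tau tau_in_E[of y] by (metis bij_betw_iff_bijections)
  then obtain n :: int where n: "w = y + 2 * pi * of_int n" using tau_eq_iff[of y w] by auto
  show "\<exists>!n::int. y + 2 * pi * of_int n \<in> W"
  proof (rule ex1I[of _ n])
    show "y + 2 * pi * of_int n \<in> W" using w n by simp
    fix m :: int assume m: "y + 2 * pi * of_int m \<in> W"
    have "tau (y + 2 * pi * of_int m) = tau w" using tau_eq_iff w(2) by metis
    then have "y + 2 * pi * of_int m = w" by (rule inj_onD[OF bij_betw_imp_inj_on[OF tau] _ m w(1)])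
    then show "m = n" using n by simp
  qed
next
  fix x :: real assume x: "x \<noteq> 0"
  obtain w where w: "w \<in> W" "delta w = delta x" using delta delta_in_E[OF x] by (metis bij_betw_iff_bijections)
  have "w \<noteq> 0" using w W by auto
  then obtain n :: int where n: "w = 2 powi n * x" using delta_eq_iff[OF x, of w] w by auto
  show "\<exists>!j::int. 2 powi j * x \<in> W"
  proof (rule ex1I[of _ n])
    show "2 powi n * x \<in> W" using w n by simp
    fix m :: int assume m: "2 powi m * x \<in> W"
    have "delta (2 powi m * x) = delta w" using delta_scale[OF x] w(2) by simp
    then have "2 powi m * x = w" by (rule inj_onD[OF bij_betw_imp_inj_on[OF delta] _ m w(1)])
    then have "(2::real) powi m = 2 powi n" using n x by simp
    then show "m = n" by (simp add: powi_two_powr powr_inj)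
  qed
qed

section \<open>Normal form of wavelet induced isomorphisms\<close>

lemma lebesgue_affine_vimage:
  assumes "S \<in> sets lebesgue" "c \<noteq> (0::real)" shows "{x. t + c * x \<in> S} \<in> sets lebesgue"
  using measurable_sets[OF lebesgue_measurable_affine[OF assms(2)] assms(1), of t] by (simp add: vimage_def)

lemma lebesgue_affine_image:
  assumes "S \<in> sets lebesgue" "c \<noteq> (0::real)" shows "(\<lambda>x. t + c * x) ` S \<in> sets lebesgue"
proof -
  have "(\<lambda>x. t + c * x) ` S = {y. - t / c + 1 / c * y \<in> S}"
  proof (intro equalityI subsetI)
    fix y assume "y \<in> (\<lambda>x. t + c * x) ` S"
    then show "y \<in> {y. - t / c + 1 / c * y \<in> S}" using assms(2) by (auto simp: field_simps)
  next
    fix y assume "y \<in> {y. - t / c + 1 / c * y \<in> S}"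
    then have "- t / c + 1 / c * y \<in> S" by simp
    then have "t + c * (- t / c + 1 / c * y) \<in> (\<lambda>x. t + c * x) ` S" by (rule imageI)
    then show "y \<in> (\<lambda>x. t + c * x) ` S" using assms(2) by (simp add: field_simps)
  qed
  then show ?thesis using lebesgue_affine_vimage[OF assms(1), of "1 / c" "- t / c"] assms(2) by simp
qed

lemma borel_measurable_piecewise:
  fixes f :: "real \<Rightarrow> real"
  assumes C: "countable I" "\<And>i. i \<in> I \<Longrightarrow> C i \<in> sets lebesgue" "S \<subseteq> (\<Union>i\<in>I. C i)" and S: "S \<in> sets lebesgue"
    and g: "\<And>i. i \<in> I \<Longrightarrow> g i \<in> borel_measurable lebesgue" "\<And>i x. i \<in> I \<Longrightarrow> x \<in> C i \<Longrightarrow> x \<in> S \<Longrightarrow> f x = g i x"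
  shows "f \<in> borel_measurable (lebesgue_on S)"
proof (rule measurable_piecewise_restrict[where C="C ` I"])
  show "countable (C ` I)" using C by simp
  show "\<Omega> \<inter> space (lebesgue_on S) \<in> sets (lebesgue_on S)" if "\<Omega> \<in> C ` I" for \<Omega>
    using that C S by (auto simp: sets_restrict_space)
  show "space (lebesgue_on S) \<subseteq> \<Union> (C ` I)" using C by auto
  fix \<Omega> assume "\<Omega> \<in> C ` I"
  then obtain i where i: "i \<in> I" "\<Omega> = C i" by auto
  have eq: "restrict_space (lebesgue_on S) \<Omega> = lebesgue_on (S \<inter> \<Omega>)"
    using S C(2)[OF i(1)] i by (intro restrict_restrict_space) auto
  have "g i \<in> borel_measurable (lebesgue_on (S \<inter> \<Omega>))" by (rule measurable_restrict_space1[OF g(1)[OF i(1)]])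
  then show "f \<in> borel_measurable (restrict_space (lebesgue_on S) \<Omega>)"
    unfolding eq using g(2)[OF i(1)] i(2) by (subst measurable_cong) auto
qed

text \<open>The exponent at \<open>x\<close> is the one that moves \<open>2 pi (lift x)\<close> into \<open>W\<close>, since this is how
  \<^const>\<open>delta\<close> is inverted on \<open>W\<close>. Its level sets are affine preimages of \<open>W\<close> on each half of \<open>[0,1)\<close>.\<close>

lemma wavelet_inducedD:
  assumes "wavelet_induced h"
  obtains m :: "real \<Rightarrow> int" where "bij_betw h {0..<1} {0..<1}"
    "\<And>x. x \<in> {0..<1} \<Longrightarrow> h x = frac (2 powi (m x) * lift x)"
    "\<And>k. {x\<in>{0..<1}. m x = k} \<in> sets lebesgue"
proof -
  obtain W where W: "W \<in> sets lebesgue" "0 \<notin> W" "bij_betw tau W E" "bij_betw delta W E"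
    and h: "\<And>x. x \<in> {0..<1} \<Longrightarrow> h x = h_tilde W x"
    using assms unfolding wavelet_induced_def wavelet_set_version_def measurable_bij_def by blast
  note tile = wavelet_tileI[OF W]
  define m where "m x = (THE j::int. 2 powi j * (2 * pi * lift x) \<in> W)" for x
  have m_iff: "m x = k \<longleftrightarrow> 2 powi k * (2 * pi * lift x) \<in> W" if x: "x \<in> {0..<1}" for x k
  proof -
    have "2 * pi * lift x \<noteq> 0" using lift_nonzero[OF x] by simp
    then have ex: "\<exists>!j::int. 2 powi j * (2 * pi * lift x) \<in> W" by (rule wavelet_tileD(4)[OF tile])
    show ?thesis using theI'[OF ex] ex unfolding m_def by metis
  qed
  have inv: "inv_into W delta (2 * pi * lift x) = 2 powi (m x) * (2 * pi * lift x)" if x: "x \<in> {0..<1}" for x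
  proof -
    let ?e = "2 * pi * lift x"
    have e: "?e \<noteq> 0" "?e \<in> E" using lift_nonzero[OF x] lift_in_E[OF x] by auto
    have w: "2 powi (m x) * ?e \<in> W" using m_iff[OF x] by blast
    have "delta (2 powi (m x) * ?e) = delta ?e" by (rule delta_scale[OF e(1)])
    also have "\<dots> = ?e" using delta_eqI[of ?e 0] e by simp
    finally show ?thesis by (rule inv_into_f_eq[OF bij_betw_imp_inj_on[OF W(4)] w])
  qed
  show thesis
  proof (rule that[of m])
    show "h x = frac (2 powi (m x) * lift x)" if x: "x \<in> {0..<1}" for x
      using h[OF x] inv[OF x] by (simp add: h_tilde_def h_map_def inv_into_xi[OF x] xi_tau)
    have "bij_betw (h_tilde W) {0..<1} {0..<1}"
      unfolding h_tilde_def h_map_def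
      by (intro bij_betw_trans[OF bij_betw_inv_into[OF bij_xi]] bij_betw_trans[OF bij_betw_trans[OF bij_betw_inv_into[OF W(4)] W(3)] bij_xi])
    then show "bij_betw h {0..<1} {0..<1}" using h by (subst bij_betw_cong) auto
    fix k :: int
    have 1: "{x. (- (2 powi k * (2 * pi))) + (2 powi k * (2 * pi)) * x \<in> W} \<in> sets lebesgue"
       "{x. 0 + (2 powi k * (2 * pi)) * x \<in> W} \<in> sets lebesgue" by (intro lebesgue_affine_vimage W; simp)+
    have "{x\<in>{0..<1}. m x = k} = ({0..<1/2} \<inter> {x. (- (2 powi k * (2 * pi))) + (2 powi k * (2 * pi)) * x \<in> W}) \<union>
       ({1/2..<1} \<inter> {x. 0 + (2 powi k * (2 * pi)) * x \<in> W})"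
    proof (intro set_eqI)
      fix x
      have e: "x < 1/2 \<Longrightarrow> - (2 powi k * (2 * pi)) + (2 powi k * (2 * pi)) * x = 2 powi k * (2 * pi * lift x)"
        "\<not> x < 1/2 \<Longrightarrow> 0 + (2 powi k * (2 * pi)) * x = 2 powi k * (2 * pi * lift x)"
        by (simp_all add: lift_def algebra_simps)
      show "x \<in> {x\<in>{0..<1}. m x = k} \<longleftrightarrow> x \<in> ({0..<1/2} \<inter> {x. (- (2 powi k * (2 * pi))) + (2 powi k * (2 * pi)) * x \<in> W}) \<union>
       ({1/2..<1} \<inter> {x. 0 + (2 powi k * (2 * pi)) * x \<in> W})"
      proof (cases "x \<in> {0..<1}")
        case True
        then show ?thesis using e m_iff[OF True, of k] by (cases "x < 1/2") (simp_all del: add_0)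
      qed auto
    qed
    also have "\<dots> \<in> sets lebesgue" using 1 by (intro sets.Un sets.Int) auto
    finally show "{x\<in>{0..<1}. m x = k} \<in> sets lebesgue" .
  qed
qed

text \<open>The set \<open>W\<close> consists of the points \<open>p x = 2 powi (m x) * (2 pi (lift x))\<close>. Then \<^const>\<open>delta\<close>
  inverts \<open>p\<close>, and \<^const>\<open>tau\<close> takes \<open>p x\<close> to the point of \<^const>\<open>E\<close> with coordinate \<open>h x\<close>; as \<open>h\<close> is
  bijective, so are both maps on \<open>W\<close>.\<close>

lemma wavelet_inducedI:
  fixes m :: "real \<Rightarrow> int"
  assumes bij: "bij_betw h {0..<1} {0..<1}"
    and h: "\<And>x. x \<in> {0..<1} \<Longrightarrow> h x = frac (2 powi (m x) * lift x)"
    and m: "\<And>k. {x\<in>{0..<1}. m x = k} \<in> sets lebesgue"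
  shows "wavelet_induced h"
proof -
  define p where "p x = 2 powi (m x) * (2 * pi * lift x)" for x
  define W where "W = p ` {0..<1}"
  have nz: "2 * pi * lift x \<noteq> 0" if "x \<in> {0..<1}" for x using lift_nonzero[OF that] by simp
  have W0: "0 \<notin> W" using lift_nonzero by (auto simp: W_def p_def)
  have Wm: "W \<in> sets lebesgue"
  proof -
    have "W = (\<Union>k. (\<lambda>x. - (2 powi k * (2 * pi)) + (2 powi k * (2 * pi)) * x) ` ({0..<1/2} \<inter> {x\<in>{0..<1}. m x = k})) \<union>
       (\<Union>k. (\<lambda>x. 0 + (2 powi k * (2 * pi)) * x) ` ({1/2..<1} \<inter> {x\<in>{0..<1}. m x = k}))" (is "_ = ?A \<union> ?B")
    proof (intro equalityI subsetI)
      fix y assume "y \<in> W"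
      then obtain x where x: "x \<in> {0..<1}" "y = p x" by (auto simp: W_def)
      show "y \<in> ?A \<union> ?B"
      proof (cases "x < 1/2")
        case True
        then have "y = - (2 powi m x * (2 * pi)) + (2 powi m x * (2 * pi)) * x"
          unfolding x(2) p_def lift_def by (simp add: algebra_simps)
        then show ?thesis using True x(1) by (intro UnI1 UN_I[of "m x"] image_eqI[of _ _ x]) auto
      next
        case False
        then have "y = 0 + (2 powi m x * (2 * pi)) * x"
          unfolding x(2) p_def lift_def by (simp add: algebra_simps)
        then show ?thesis using False x(1) by (intro UnI2 UN_I[of "m x"] image_eqI[of _ _ x]) auto
      qed
    next
      fix y assume "y \<in> ?A \<union> ?B"
      then show "y \<in> W"
      proof
        assume "y \<in> ?A"
        then obtain x where x: "x \<in> {0..<1/2}" "y = - (2 powi m x * (2 * pi)) + (2 powi m x * (2 * pi)) * x" by auto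
        then have "y = p x" unfolding x(2) p_def lift_def by (simp add: algebra_simps)
        then show ?thesis unfolding W_def using x(1) by (intro image_eqI[of _ _ x]) auto
      next
        assume "y \<in> ?B"
        then obtain x where x: "x \<in> {1/2..<1}" "y = 0 + (2 powi m x * (2 * pi)) * x" by auto
        then have "y = p x" unfolding x(2) p_def lift_def by (simp add: algebra_simps)
        then show ?thesis unfolding W_def using x(1) by (intro image_eqI[of _ _ x]) auto
      qed
    qed
    also have "\<dots> \<in> sets lebesgue"
      by (intro sets.Un sets.countable_UN'' lebesgue_affine_image sets.Int m) auto
    finally show ?thesis .
  qed
  have deltap: "delta (p x) = 2 * pi * lift x" if x: "x \<in> {0..<1}" for x
    unfolding p_def using delta_scale[OF nz[OF x]] delta_eqI[of "2 * pi * lift x" 0] nz[OF x] lift_in_E[OF x] by simp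
  have taup: "tau (p x) = 2 * pi * lift (h x)" if x: "x \<in> {0..<1}" for x
  proof -
    have "xi (tau (p x)) = h x" unfolding xi_tau using h[OF x] by (simp add: p_def)
    then show ?thesis using xi_E(2)[OF tau_in_E[of "p x"]] by simp
  qed
  have bdp: "bij_betw (delta \<circ> p) {0..<1} E"
    using bij_chart by (subst bij_betw_cong[where g="\<lambda>x. 2 * pi * lift x"]) (auto simp: deltap)
  have injp: "inj_on p {0..<1}" using bdp by (auto simp: bij_betw_def intro: inj_on_imageI2)
  have bp: "bij_betw p {0..<1} W" using injp by (auto simp: W_def bij_betw_def)
  have bd: "bij_betw delta W E" using bij_betw_comp_iff[OF bp] bdp by blast
  have "bij_betw ((\<lambda>x. 2 * pi * lift x) \<circ> h) {0..<1} E" by (rule bij_betw_trans[OF bij bij_chart])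
  then have "bij_betw (tau \<circ> p) {0..<1} E"
    by (subst bij_betw_cong[where g="(\<lambda>x. 2 * pi * lift x) \<circ> h"]) (auto simp: taup)
  then have bt: "bij_betw tau W E" using bij_betw_comp_iff[OF bp] by blast
  have Em: "E \<in> sets lebesgue" by (simp add: E_def)
  have dm: "delta \<in> borel_measurable (lebesgue_on W)"
  proof (rule borel_measurable_piecewise[where I="UNIV :: int set" and C="\<lambda>k. {x. 0 + 2 powi k * x \<in> E}" and g="\<lambda>k x. 2 powi k * x"])
    show "W \<subseteq> (\<Union>k::int. {x. 0 + 2 powi k * x \<in> E})"
    proof
      fix x assume "x \<in> W"
      then have "x \<noteq> 0" using W0 by auto
      then show "x \<in> (\<Union>k::int. {x. 0 + 2 powi k * x \<in> E})" using E_dilation_unique[of x] by auto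
    qed
    show "{x. 0 + 2 powi k * x \<in> E} \<in> sets lebesgue" for k by (rule lebesgue_affine_vimage[OF Em]) simp
    show "(\<lambda>x::real. 2 powi k * x) \<in> borel_measurable lebesgue" for k :: int by (rule measurable_completion) simp
    show "delta x = 2 powi k * x" if "x \<in> {x. 0 + 2 powi k * x \<in> E}" "x \<in> W" for k x
      using that W0 by (intro delta_eqI) auto
  qed (auto intro: Wm)
  have tm: "tau \<in> borel_measurable (lebesgue_on W)"
  proof (rule borel_measurable_piecewise[where I="UNIV :: int set" and C="\<lambda>k. {x. 2 * of_int k * pi + 1 * x \<in> E}" and g="\<lambda>k x. x + 2 * of_int k * pi"])
    show "W \<subseteq> (\<Union>k::int. {x. 2 * of_int k * pi + 1 * x \<in> E})"
    proof
      fix x assume "x \<in> W"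
      show "x \<in> (\<Union>k::int. {x. 2 * of_int k * pi + 1 * x \<in> E})"
        using ex1_implies_ex[OF E_translation_unique[of x]] by (auto simp: add.commute)
    qed
    show "{x. 2 * of_int k * pi + 1 * x \<in> E} \<in> sets lebesgue" for k :: int by (rule lebesgue_affine_vimage[OF Em]) simp
    show "(\<lambda>x::real. x + 2 * of_int k * pi) \<in> borel_measurable lebesgue" for k :: int by (rule measurable_completion) simp
    show "tau x = x + 2 * of_int k * pi" if "x \<in> {x. 2 * of_int k * pi + 1 * x \<in> E}" for k x
      using that by (intro tau_eqI) (simp add: add.commute)
  qed (auto intro: Wm)
  have ws: "wavelet_set W" by (rule wavelet_set_of_tile[OF wavelet_tileI[OF Wm W0 bt bd]])
  have "h x = h_tilde W x" if x: "x \<in> {0..<1}" for x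
  proof -
    have "inv_into W delta (2 * pi * lift x) = p x"
      using x by (intro inv_into_f_eq[OF bij_betw_imp_inj_on[OF bd] _ deltap[OF x]]) (simp add: W_def)
    moreover have "h x \<in> {0..<1}" using bij x by (rule bij_betw_apply)
    ultimately show ?thesis using taup[OF x] xi_lift[of "h x"]
      by (simp add: h_tilde_def h_map_def inv_into_xi[OF x])
  qed
  then show ?thesis unfolding wavelet_induced_def
    using ws Wm W0 dm tm bt bd by (intro exI[of _ W]) (auto simp: wavelet_set_version_def measurable_bij_def)
qed

section \<open>The Schroeder-Cantor-Bernstein map\<close>

text \<open>The part of \<open>A\<close> on which the Schroeder-Cantor-Bernstein map follows \<open>u\<close>.\<close>

definition scb_core :: "'a set \<Rightarrow> 'b set \<Rightarrow> ('a \<Rightarrow> 'b) \<Rightarrow> ('b \<Rightarrow> 'a) \<Rightarrow> 'a set" where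
  "scb_core A B u v = (\<Union>k. ((v \<circ> u) ^^ k) ` (A - v ` B))"

lemma scb_map_core: "x \<in> scb_core A B u v \<Longrightarrow> scb_map A B u v x = u x"
  by (simp add: scb_map_def scb_core_def)

lemma scb_core_step: "x \<in> scb_core A B u v \<Longrightarrow> v (u x) \<in> scb_core A B u v"
proof -
  assume "x \<in> scb_core A B u v"
  then obtain k a where "a \<in> A - v ` B" "x = ((v \<circ> u) ^^ k) a" by (auto simp: scb_core_def)
  then have "v (u x) = ((v \<circ> u) ^^ Suc k) a" "a \<in> A - v ` B" by auto
  then show ?thesis unfolding scb_core_def by blast
qed

lemma scb_core_base: "A - v ` B \<subseteq> scb_core A B u v"
proof
  fix x assume x: "x \<in> A - v ` B"
  have "x \<in> ((v \<circ> u) ^^ 0) ` (A - v ` B)" using x by simp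
  then show "x \<in> scb_core A B u v" unfolding scb_core_def by blast
qed

lemma scb_core_cases:
  assumes "x \<in> scb_core A B u v"
  shows "x \<in> A - v ` B \<or> (\<exists>y\<in>scb_core A B u v. x = v (u y))"
proof -
  obtain k a where a: "a \<in> A - v ` B" "x = ((v \<circ> u) ^^ k) a" using assms by (auto simp: scb_core_def)
  show ?thesis
  proof (cases k)
    case 0 then show ?thesis using a by simp
  next
    case (Suc n)
    then have "x = v (u (((v \<circ> u) ^^ n) a))" using a by simp
    moreover have "((v \<circ> u) ^^ n) a \<in> scb_core A B u v" using a(1) unfolding scb_core_def by blast
    ultimately show ?thesis by blast
  qed
qed

lemma scb_core_subset:
  assumes "u \<in> A \<rightarrow> B" "v \<in> B \<rightarrow> A" shows "scb_core A B u v \<subseteq> A"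
proof
  fix x assume "x \<in> scb_core A B u v"
  then obtain k a where a: "a \<in> A" "x = ((v \<circ> u) ^^ k) a" by (auto simp: scb_core_def)
  have "((v \<circ> u) ^^ k) a \<in> A" using assms a(1) by (induction k) (auto simp: Pi_iff)
  then show "x \<in> A" using a by simp
qed

text \<open>Pull \<open>x\<close> back along \<open>v \<circ> u\<close>. Outside the core no preimage ever lies outside the range of \<open>v\<close>, so
  either the process stops inside this range or it never stops; both cases belong to the second
  region.\<close>

lemma scb_map_outside_core:
  assumes x: "x \<in> A" "x \<notin> scb_core A B u v"
  shows "scb_map A B u v x = inv_into B v x"
proof -
  let ?f = "v \<circ> u"
  have "x \<in> (\<Union>k. (?f ^^ k) ` (v ` B - ?f ` A)) \<union> (\<Inter>k. (?f ^^ k) ` A)"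
  proof (rule ccontr)
    assume n: "\<not> ?thesis"
    have "x \<in> (?f ^^ k) ` A" for k
    proof (induction k)
      case 0 show ?case using x by simp
    next
      case (Suc k)
      then obtain a where a: "a \<in> A" "x = (?f ^^ k) a" by blast
      have "a \<notin> A - v ` B" using x(2) a(2) unfolding scb_core_def by blast
      moreover have "a \<notin> v ` B - ?f ` A" using n a(2) by blast
      ultimately obtain b where b: "b \<in> A" "a = ?f b" using a(1) by blast
      then have "x = (?f ^^ Suc k) b" using a(2) by (simp add: funpow_swap1)
      then show ?case using b by blast
    qed
    then show False using n by blast
  qed
  then show ?thesis using x(2) unfolding scb_map_def scb_core_def by (simp only: if_True if_False)
qed

text \<open>On the core the map is \<open>u\<close> and \<open>v \<circ> u\<close> stays in the core; off the core it inverts \<open>v\<close>. Hence the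
  images of the two parts are told apart by applying \<open>v\<close>.\<close>

lemma bij_scb_map:
  assumes u: "u \<in> A \<rightarrow> B" "inj_on u A" and v: "v \<in> B \<rightarrow> A" "inj_on v B"
  shows "bij_betw (scb_map A B u v) A B"
proof -
  let ?K = "scb_core A B u v" and ?h = "scb_map A B u v"
  have KA: "?K \<subseteq> A" using u(1) v(1) by (rule scb_core_subset)
  have out: "?h x \<in> B \<and> v (?h x) = x" if "x \<in> A" "x \<notin> ?K" for x
  proof -
    have "x \<in> v ` B" using that scb_core_base[of A v B u] by blast
    then show ?thesis using scb_map_outside_core[OF that] by (simp add: inv_into_into f_inv_into_f)
  qed
  have inn: "?h x = u x \<and> v (?h x) \<in> ?K" if "x \<in> ?K" for x
    using that scb_map_core scb_core_step by metis
  show ?thesis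
    unfolding bij_betw_def
  proof
    show "inj_on ?h A"
    proof (rule inj_onI)
      fix x y assume xy: "x \<in> A" "y \<in> A" "?h x = ?h y"
      show "x = y"
      proof (cases "x \<in> ?K \<longleftrightarrow> y \<in> ?K")
        case True
        show ?thesis
        proof (cases "x \<in> ?K")
          case True
          then have "y \<in> ?K" using \<open>x \<in> ?K \<longleftrightarrow> y \<in> ?K\<close> by simp
          then have "u x = u y" using inn[OF True] inn[of y] xy(3) by simp
          then show ?thesis using u(2) xy(1,2) by (meson inj_onD)
        next
          case False
          then have "y \<notin> ?K" using True by simp
          then show ?thesis using out[OF xy(1) False] out[OF xy(2)] xy(3) by metis
        qed
      next
        case False
        then show ?thesis using inn out xy by metis
      qed
    qed
    show "?h ` A = B"
    proof (intro equalityI subsetI)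
      fix y assume "y \<in> ?h ` A"
      then obtain x where x: "x \<in> A" "y = ?h x" by blast
      show "y \<in> B"
      proof (cases "x \<in> ?K")
        case True then show ?thesis using inn[OF True] x u(1) by (auto simp: Pi_iff)
      next
        case False then show ?thesis using out[OF x(1) False] x(2) by simp
      qed
    next
      fix y assume y: "y \<in> B"
      then have vy: "v y \<in> A" using v(1) by (auto simp: Pi_iff)
      show "y \<in> ?h ` A"
      proof (cases "v y \<in> ?K")
        case True
        then obtain z where z: "z \<in> ?K" "v y = v (u z)" using scb_core_cases[OF True] y by blast
        moreover have "u z \<in> B" using z KA u(1) by (auto simp: Pi_iff)
        ultimately have "y = u z" using v(2) y by (meson inj_onD)
        then show ?thesis using inn[OF z(1)] z(1) KA by (intro image_eqI[of _ _ z]) auto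
      next
        case False
        then have "?h (v y) \<in> B" "v (?h (v y)) = v y" using out[OF vy] by auto
        then have "?h (v y) = y" using v(2) y by (meson inj_onD)
        then show ?thesis using vy by (metis imageI)
      qed
    qed
  qed
qed

section \<open>Piecewise rational affine maps\<close>

text \<open>The orbit relation of the group of increasing affine maps with rational coefficients. The group is
  countable and contains all branches of the maps considered here; this is what controls measurability
  of images and null sets.\<close>

definition rat_rel :: "real \<Rightarrow> real \<Rightarrow> bool" where
  "rat_rel x y \<longleftrightarrow> (\<exists>a\<in>\<rat>. \<exists>b\<in>\<rat>. 0 < a \<and> y = b + a * x)"

lemma rat_relI: "a \<in> \<rat> \<Longrightarrow> b \<in> \<rat> \<Longrightarrow> 0 < a \<Longrightarrow> y = b + a * x \<Longrightarrow> rat_rel x y"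
  unfolding rat_rel_def by blast

lemma rat_rel_refl: "rat_rel x x"
  by (rule rat_relI[of 1 0]) auto

lemma rat_rel_sym: "rat_rel x y \<Longrightarrow> rat_rel y x"
proof -
  assume "rat_rel x y"
  then obtain a b where "a \<in> \<rat>" "b \<in> \<rat>" "0 < a" "y = b + a * x" unfolding rat_rel_def by blast
  then show ?thesis by (intro rat_relI[of "1 / a" "- b / a"]) (auto simp: field_simps)
qed

lemma rat_rel_trans: "rat_rel x y \<Longrightarrow> rat_rel y z \<Longrightarrow> rat_rel x z"
proof -
  assume "rat_rel x y" "rat_rel y z"
  then obtain a b c d where "a \<in> \<rat>" "b \<in> \<rat>" "0 < a" "y = b + a * x" "c \<in> \<rat>" "d \<in> \<rat>" "0 < c" "z = d + c * y"
    unfolding rat_rel_def by blast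
  then show ?thesis by (intro rat_relI[of "c * a" "d + c * b"]) (auto simp: algebra_simps)
qed

lemma borel_measurable_lebesgue_on_iff:
  fixes f :: "real \<Rightarrow> real"
  assumes "S \<in> sets lebesgue"
  shows "f \<in> borel_measurable (lebesgue_on S) \<longleftrightarrow> (\<forall>t. {x\<in>S. t < f x} \<in> sets lebesgue)"
proof -
  have "{x\<in>S. t < f x} \<in> sets (lebesgue_on S) \<longleftrightarrow> {x\<in>S. t < f x} \<in> sets lebesgue" for t
    using assms by (subst sets_restrict_space_iff) auto
  then show ?thesis by (simp add: borel_measurable_iff_greater)
qed

lemma sets_lebesgue_eq:
  fixes f g :: "real \<Rightarrow> real"
  assumes "S \<in> sets lebesgue" "f \<in> borel_measurable (lebesgue_on S)" "g \<in> borel_measurable borel"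
  shows "{x\<in>S. f x = g x} \<in> sets lebesgue"
proof -
  have [measurable]: "f \<in> borel_measurable (lebesgue_on S)" by fact
  have [measurable]: "g \<in> borel_measurable (lebesgue_on S)"
    using assms(3) by (intro measurable_restrict_space1 measurable_completion) simp
  have "{x \<in> space (lebesgue_on S). f x = g x} \<in> sets (lebesgue_on S)" by measurable
  then show ?thesis using assms(1) by (simp add: sets_restrict_space_iff)
qed

text \<open>Measurable maps that are given by countably many rational affine branches.\<close>

definition rat_pieces :: "(real \<Rightarrow> real) \<Rightarrow> real set \<Rightarrow> bool" where
  "rat_pieces f S \<longleftrightarrow> S \<in> sets lebesgue \<and> f \<in> borel_measurable (lebesgue_on S) \<and> (\<forall>x\<in>S. rat_rel x (f x))"

lemma emeasure_affine_image: "emeasure lebesgue ((\<lambda>x. b + a * x) ` S) = ennreal \<bar>a\<bar> * emeasure lebesgue (S :: real set)"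
  using emeasure_lebesgue_affine[of a b S] by (simp add: add.commute)

text \<open>For every pair of coefficients the set where the map agrees with that affine function is measurable;
  enumerate the pairs and make these sets disjoint. The set \<open>Q\<close> restricts the slopes, as needed for
  estimates of the measure of images.\<close>

lemma rat_pieces_decompose:
  assumes f: "rat_pieces f S" and X: "X \<in> sets lebesgue" "X \<subseteq> S"
    and c: "\<And>x. x \<in> X \<Longrightarrow> \<exists>a\<in>Q. \<exists>b\<in>\<rat>. f x = b + a * x" and Q: "Q \<subseteq> {a\<in>\<rat>. 0 < a}"
  obtains P :: "nat \<Rightarrow> real set" and a b :: "nat \<Rightarrow> real" where "\<And>i. P i \<in> sets lebesgue" "disjoint_family P" "(\<Union>i. P i) = X"
    "\<And>i x. x \<in> P i \<Longrightarrow> f x = b i + a i * x" "\<And>i. P i \<noteq> {} \<Longrightarrow> a i \<in> Q"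
proof -
  define e where "e = from_nat_into (Q \<times> \<rat> :: (real \<times> real) set)"
  have cnt: "countable (Q \<times> \<rat> :: (real \<times> real) set)"
    using Q countable_rat by (intro countable_SIGMA) (auto intro: countable_subset)
  define M where "M i = (if Q = {} then {} else {x\<in>X. f x = snd (e i) + fst (e i) * x})" for i
  have fX: "f \<in> borel_measurable (lebesgue_on X)"
    using f unfolding rat_pieces_def by (intro measurable_restrict_mono[OF _ X(2)]) blast
  have M: "M i \<in> sets lebesgue" for i
  proof -
    have "{x\<in>X. f x = snd (e i) + fst (e i) * x} \<in> sets lebesgue" by (rule sets_lebesgue_eq[OF X(1) fX]) simp
    then show ?thesis by (simp add: M_def)
  qed
  have cover: "(\<Union>i. M i) = X"
  proof (intro equalityI subsetI)
    fix x assume x: "x \<in> X"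
    then obtain a b where ab: "(a, b) \<in> Q \<times> \<rat>" "f x = b + a * x" using c by blast
    obtain i where i: "e i = (a, b)" using from_nat_into_surj[OF cnt ab(1)] unfolding e_def by blast
    have "x \<in> M i" using ab x i by (auto simp: M_def)
    then show "x \<in> (\<Union>i. M i)" by blast
  qed (auto simp: M_def split: if_splits)
  show thesis
  proof (rule that[of "disjointed M" "snd \<circ> e" "fst \<circ> e"])
    show "disjointed M i \<in> sets lebesgue" for i
      using sets.range_disjointed_sets[of M lebesgue] M by blast
    show "disjoint_family (disjointed M)" by (rule disjoint_family_disjointed)
    show "(\<Union>i. disjointed M i) = X" using cover by (simp add: UN_disjointed_eq)
    show "f x = (snd \<circ> e) i + (fst \<circ> e) i * x" if "x \<in> disjointed M i" for i x
      using that disjointed_subset[of M i] by (auto simp: M_def split: if_splits)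
    show "(fst \<circ> e) i \<in> Q" if "disjointed M i \<noteq> {}" for i
    proof -
      have "Q \<noteq> {}" using that disjointed_subset[of M i] by (auto simp: M_def)
      then have "e i \<in> Q \<times> \<rat>" unfolding e_def by (intro from_nat_into) auto
      then show ?thesis by auto
    qed
  qed
qed

text \<open>Measurable images of measurable sets need not be measurable, but here the image is a countable union
  of affine images.\<close>

lemma rat_pieces_image_sets:
  assumes f: "rat_pieces f S" and X: "X \<in> sets lebesgue" "X \<subseteq> S"
  shows "f ` X \<in> sets lebesgue"
proof -
  have c: "\<exists>a\<in>{a\<in>\<rat>. 0 < a}. \<exists>b\<in>\<rat>. f x = b + a * x" if "x \<in> X" for x
    using f X(2) that unfolding rat_pieces_def rat_rel_def by blast
  obtain P :: "nat \<Rightarrow> real set" and b a :: "nat \<Rightarrow> real" where P: "\<And>i. P i \<in> sets lebesgue" "disjoint_family P" "(\<Union>i. P i) = X"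
    "\<And>i x. x \<in> P i \<Longrightarrow> f x = b i + a i * x" "\<And>i. P i \<noteq> {} \<Longrightarrow> a i \<in> {a\<in>\<rat>. 0 < a}"
    by (rule rat_pieces_decompose[OF f X _ subset_refl], rule c, assumption, rule that)
  have "f ` X = (\<Union>i. (\<lambda>x. b i + a i * x) ` P i)"
    unfolding P(3)[symmetric] image_UN using P(4) by (intro SUP_cong refl image_cong) auto
  moreover have "(\<lambda>x. b i + a i * x) ` P i \<in> sets lebesgue" for i
  proof (cases "P i = {}")
    case False
    then have "a i \<noteq> 0" using P(5)[OF False] by auto
    then show ?thesis by (rule lebesgue_affine_image[OF P(1)])
  qed simp
  ultimately show ?thesis by auto
qed

lemma rat_pieces_image_le:
  assumes f: "rat_pieces f S" and X: "X \<in> sets lebesgue" "X \<subseteq> S"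
    and c: "\<And>x. x \<in> X \<Longrightarrow> \<exists>a\<in>\<rat>. \<exists>b\<in>\<rat>. 0 < a \<and> a \<le> c \<and> f x = b + a * x"
  shows "emeasure lebesgue (f ` X) \<le> ennreal c * emeasure lebesgue X"
proof -
  have c': "\<exists>a\<in>{a\<in>\<rat>. 0 < a \<and> a \<le> c}. \<exists>b\<in>\<rat>. f x = b + a * x" if "x \<in> X" for x
    using c[OF that] by blast
  have Q: "{a\<in>\<rat>. 0 < a \<and> a \<le> c} \<subseteq> {a\<in>\<rat>. 0 < a}" by blast
  obtain P :: "nat \<Rightarrow> real set" and b a :: "nat \<Rightarrow> real" where P: "\<And>i. P i \<in> sets lebesgue" "disjoint_family P" "(\<Union>i. P i) = X"
    "\<And>i x. x \<in> P i \<Longrightarrow> f x = b i + a i * x" "\<And>i. P i \<noteq> {} \<Longrightarrow> a i \<in> {a\<in>\<rat>. 0 < a \<and> a \<le> c}"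
    by (rule rat_pieces_decompose[OF f X _ Q], rule c', assumption, rule that)
  have eq: "f ` X = (\<Union>i. (\<lambda>x. b i + a i * x) ` P i)"
    unfolding P(3)[symmetric] image_UN using P(4) by (intro SUP_cong refl image_cong) auto
  have m: "(\<lambda>x. b i + a i * x) ` P i \<in> sets lebesgue" for i
  proof (cases "P i = {}")
    case False
    then have "a i \<noteq> 0" using P(5)[OF False] by auto
    then show ?thesis by (rule lebesgue_affine_image[OF P(1)])
  qed simp
  have "emeasure lebesgue (f ` X) \<le> (\<Sum>i. emeasure lebesgue ((\<lambda>x. b i + a i * x) ` P i))"
    unfolding eq by (rule emeasure_subadditive_countably) (use m in auto)
  also have "\<dots> \<le> (\<Sum>i. ennreal c * emeasure lebesgue (P i))"
  proof (intro suminf_le summableI)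
    fix i
    show "emeasure lebesgue ((\<lambda>x. b i + a i * x) ` P i) \<le> ennreal c * emeasure lebesgue (P i)"
    proof (cases "P i = {}")
      case False
      then have "\<bar>a i\<bar> \<le> c" using P(5)[OF False] by auto
      then show ?thesis unfolding emeasure_affine_image by (intro mult_right_mono ennreal_leI) auto
    qed simp
  qed
  also have "\<dots> = ennreal c * emeasure lebesgue X"
    unfolding P(3)[symmetric] using P(1,2) by (subst suminf_emeasure[symmetric]) auto
  finally show ?thesis .
qed

lemma rat_pieces_inv_measurable:
  assumes f: "rat_pieces f S" and inj: "inj_on f S" and T: "T \<in> sets lebesgue" "T \<subseteq> f ` S"
  shows "inv_into S f \<in> borel_measurable (lebesgue_on T)"
  unfolding borel_measurable_lebesgue_on_iff[OF T(1)]
proof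
  fix t
  have S: "S \<in> sets lebesgue" using f by (simp add: rat_pieces_def)
  have "{x\<in>T. t < inv_into S f x} = T \<inter> f ` (S \<inter> {t<..})"
  proof (intro set_eqI iffI)
    fix x assume "x \<in> {x\<in>T. t < inv_into S f x}"
    then have x: "x \<in> T" "t < inv_into S f x" by auto
    then have "x \<in> f ` S" using T(2) by blast
    then have "inv_into S f x \<in> S" "f (inv_into S f x) = x" by (auto intro: inv_into_into f_inv_into_f)
    then show "x \<in> T \<inter> f ` (S \<inter> {t<..})" using x by (intro IntI image_eqI[of _ _ "inv_into S f x"]) auto
  next
    fix x assume "x \<in> T \<inter> f ` (S \<inter> {t<..})"
    then obtain s where s: "x \<in> T" "s \<in> S" "t < s" "x = f s" by auto
    then show "x \<in> {x\<in>T. t < inv_into S f x}" using inv_into_f_f[OF inj s(2)] by simp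
  qed
  moreover have "f ` (S \<inter> {t<..}) \<in> sets lebesgue" by (rule rat_pieces_image_sets[OF f]) (use S in auto)
  ultimately show "{x\<in>T. t < inv_into S f x} \<in> sets lebesgue" using T by auto
qed

section \<open>The two classes of maps\<close>

text \<open>Writing the two formulas in terms of \<^const>\<open>lift\<close> unifies them.\<close>

lemma WI1_D:
  assumes "u \<in> WI1"
  shows "u \<in> {0..<1} \<rightarrow> {0..<1}" "u \<in> borel_measurable (lebesgue_on {0..<1})"
    "x \<in> {0..<1} \<Longrightarrow> \<exists>k\<ge>1. u x = (if x < 1/2 then 1 else 0) + lift x / 2 ^ k"
proof -
  show "u \<in> {0..<1} \<rightarrow> {0..<1}" "u \<in> borel_measurable (lebesgue_on {0..<1})" using assms by (simp_all add: WI1_def)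
  obtain P Q where PQ: "measurable_partition P {1/2..<1}" "measurable_partition Q {0..<1/2}"
    "\<And>k x. k \<ge> 1 \<Longrightarrow> x \<in> P k \<Longrightarrow> u x = x / 2 ^ k" "\<And>k x. k \<ge> 1 \<Longrightarrow> x \<in> Q k \<Longrightarrow> u x = (x - 1) / 2 ^ k + 1"
    using assms unfolding WI1_def by blast
  assume x: "x \<in> {0..<1}"
  show "\<exists>k\<ge>1. u x = (if x < 1/2 then 1 else 0) + lift x / 2 ^ k"
  proof (cases "x < 1/2")
    case True
    then have "x \<in> (\<Union>k\<in>{1..}. Q k)" using x PQ(2) by (auto simp: measurable_partition_def)
    then obtain k where "k \<ge> 1" "x \<in> Q k" by auto
    then show ?thesis using PQ(4) True by (intro exI[of _ k]) (simp add: lift_def)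
  next
    case False
    then have "x \<in> (\<Union>k\<in>{1..}. P k)" using x PQ(1) by (auto simp: measurable_partition_def)
    then obtain k where "k \<ge> 1" "x \<in> P k" by auto
    then show ?thesis using PQ(3) False by (intro exI[of _ k]) (simp add: lift_def)
  qed
qed

text \<open>The dyadic multiples of \<open>[1/2,1)\<close> are pairwise disjoint, and so are those of \<open>[-1,-1/2)\<close>.\<close>

lemma half_scale_unique:
  fixes y z :: real
  assumes "y / 2 ^ k = z / 2 ^ l" "(1/2 \<le> y \<and> y < 1 \<and> 1/2 \<le> z \<and> z < 1) \<or> (-1 \<le> y \<and> y < -1/2 \<and> -1 \<le> z \<and> z < -1/2)"
  shows "y = z"
proof -
  have *: False if kl: "k < l" and "y / 2 ^ k = z / 2 ^ l" "(1/2 \<le> y \<and> y < 1 \<and> 1/2 \<le> z \<and> z < 1) \<or> (-1 \<le> y \<and> y < -1/2 \<and> -1 \<le> z \<and> z < -1/2)" for k l and y z :: real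
  proof -
    obtain d where d: "l = Suc (k + d)" using less_imp_Suc_add[OF kl] by blast
    have p: "(1::real) \<le> 2 ^ d" by simp
    have z: "z = y * (2 * 2 ^ d)" using that(2) by (simp add: d power_add field_simps)
    show False using that(3)
    proof
      assume a: "1/2 \<le> y \<and> y < 1 \<and> 1/2 \<le> z \<and> z < 1"
      then have "1/2 * (2 * 1) \<le> y * (2 * 2 ^ d)" using p by (intro mult_mono) auto
      then show False using a z by simp
    next
      assume a: "-1 \<le> y \<and> y < -1/2 \<and> -1 \<le> z \<and> z < -1/2"
      then have "(-y) * (2 * 1) \<le> (-y) * (2 * 2 ^ d)" using p by (intro mult_left_mono) auto
      moreover have "(-y) * (2 * 2 ^ d) = - z" using z by simp
      ultimately have "- y * 2 \<le> - z" by linarith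
      then show False using a by linarith
    qed
  qed
  have "k = l"
  proof (rule linorder_cases[of k l])
    assume "k < l" then show ?thesis using *[OF _ assms] by blast
  next
    assume "l < k" then show ?thesis using *[of l k z y] assms by auto
  qed auto
  then show ?thesis using assms(1) by simp
qed

text \<open>The two halves of \<open>[0,1)\<close> are interchanged, and on each half the dyadic scale of the image
  determines the exponent.\<close>

lemma WI1_inj: assumes "u \<in> WI1" shows "inj_on u {0..<1}"
proof (rule inj_onI)
  fix x y assume xy: "x \<in> {0..<1}" "y \<in> {0..<1}" "u x = u y"
  obtain k where k: "k \<ge> 1" "u x = (if x < 1/2 then 1 else 0) + lift x / 2 ^ k" using WI1_D(3)[OF assms xy(1)] by blast
  obtain l where l: "l \<ge> 1" "u y = (if y < 1/2 then 1 else 0) + lift y / 2 ^ l" using WI1_D(3)[OF assms xy(2)] by blast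
  have half: "(x < 1/2 \<longrightarrow> 1/2 \<le> u x) \<and> (\<not> x < 1/2 \<longrightarrow> u x < 1/2)" if "x \<in> {0..<1}" "k \<ge> 1" "u x = (if x < 1/2 then 1 else 0) + lift x / 2 ^ k" for x and k :: nat
  proof -
    have p: "(2::real) \<le> 2 ^ k" using that(2) self_le_power[of "2::real" k] by simp
    have "\<bar>lift x\<bar> \<le> 1" "\<not> x < 1/2 \<longrightarrow> lift x < 1" using that(1) by (auto simp: lift_def)
    then have "lift x / 2 ^ k \<ge> - (1/2)" "\<not> x < 1/2 \<longrightarrow> lift x / 2 ^ k < 1/2"
      using p by (auto simp: field_simps abs_le_iff)
    then have "x < 1/2 \<Longrightarrow> 1/2 \<le> 1 + lift x / 2 ^ k" "\<not> x < 1/2 \<Longrightarrow> 0 + lift x / 2 ^ k < 1/2" by linarith+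
    then show ?thesis unfolding that(3) by simp
  qed
  have h: "x < 1/2 \<longleftrightarrow> y < 1/2" using half[OF xy(1) k] half[OF xy(2) l] xy(3) by auto
  then have "lift x / 2 ^ k = lift y / 2 ^ l" using k(2) l(2) xy(3) by (auto split: if_splits)
  moreover have "(1/2 \<le> lift x \<and> lift x < 1 \<and> 1/2 \<le> lift y \<and> lift y < 1) \<or> (-1 \<le> lift x \<and> lift x < -1/2 \<and> -1 \<le> lift y \<and> lift y < -1/2)"
    using xy(1,2) h by (auto simp: lift_def)
  ultimately have "lift x = lift y" by (rule half_scale_unique)
  then show "x = y" using h by (auto simp: lift_def split: if_splits)
qed

lemma lift_rat: "\<exists>b\<in>\<rat>. lift x = b + x"
  by (cases "x < 1/2") (auto simp: lift_def intro: bexI[of _ "-1"] bexI[of _ 0])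

lemma WI1_slope:
  assumes "u \<in> WI1" "x \<in> {0..<1}" shows "\<exists>a\<in>\<rat>. \<exists>b\<in>\<rat>. 0 < a \<and> a \<le> 1/2 \<and> u x = b + a * x"
proof -
  obtain k where k: "k \<ge> 1" "u x = (if x < 1/2 then 1 else 0) + lift x / 2 ^ k" using WI1_D(3)[OF assms] by blast
  obtain b where b: "b \<in> \<rat>" "lift x = b + x" using lift_rat by blast
  have p: "(2::real) \<le> 2 ^ k" using k(1) self_le_power[of "2::real" k] by simp
  show ?thesis
  proof (intro bexI conjI)
    show "u x = ((if x < 1/2 then 1 else 0) + b / 2 ^ k) + (1 / 2 ^ k) * x" using k b by (simp add: field_simps)
  qed (use p b in \<open>auto simp: field_simps intro!: Rats_divide Rats_add Rats_power\<close>)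
qed

lemma WI1_rat_pieces:
  assumes "u \<in> WI1" shows "rat_pieces u {0..<1}"
  unfolding rat_pieces_def rat_rel_def
proof (intro conjI ballI WI1_D(2)[OF assms])
  show "\<exists>a\<in>\<rat>. \<exists>b\<in>\<rat>. 0 < a \<and> u x = b + a * x" if "x \<in> {0..<1}" for x
    using WI1_slope[OF assms that] by blast
qed simp

lemma WI2_D:
  assumes "v \<in> WI2"
  shows "v \<in> {0..<1} \<rightarrow> {0..<1}" "v \<in> borel_measurable (lebesgue_on {0..<1})" "inj_on v {0..<1}"
    "x \<in> {0..<1} \<Longrightarrow> \<exists>k l::nat. v x = (x + real l) / 2 ^ k"
  using assms by (simp_all add: WI2_def)

lemma WI2_slope:
  assumes "v \<in> WI2" "x \<in> {0..<1}" shows "\<exists>a\<in>\<rat>. \<exists>b\<in>\<rat>. 0 < a \<and> a \<le> 1 \<and> v x = b + a * x"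
proof -
  obtain k l :: nat where k: "v x = (x + real l) / 2 ^ k" using WI2_D(4)[OF assms] by blast
  show ?thesis
  proof (intro bexI conjI)
    show "v x = (real l / 2 ^ k) + (1 / 2 ^ k) * x" using k by (simp add: field_simps)
  qed (auto intro!: Rats_divide Rats_power)
qed

lemma WI2_rat_pieces:
  assumes "v \<in> WI2" shows "rat_pieces v {0..<1}"
  unfolding rat_pieces_def rat_rel_def
proof (intro conjI ballI WI2_D(2)[OF assms])
  show "\<exists>a\<in>\<rat>. \<exists>b\<in>\<rat>. 0 < a \<and> v x = b + a * x" if "x \<in> {0..<1}" for x
    using WI2_slope[OF assms that] by blast
qed simp

section \<open>Schroeder-Cantor-Bernstein maps are wavelet induced\<close>

lemma scb_core_measurable:
  assumes u: "u \<in> WI1" and v: "v \<in> WI2"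
  shows "scb_core {0..<1} {0..<1} u v \<in> sets lebesgue"
proof -
  let ?A = "{0..<1::real}"
  note up = WI1_rat_pieces[OF u] and vp = WI2_rat_pieces[OF v]
  have "((v \<circ> u) ^^ k) ` (?A - v ` ?A) \<in> sets lebesgue \<and> ((v \<circ> u) ^^ k) ` (?A - v ` ?A) \<subseteq> ?A" for k
  proof (induction k)
    case 0
    have "v ` ?A \<in> sets lebesgue" by (rule rat_pieces_image_sets[OF vp]) auto
    then show ?case by auto
  next
    case (Suc k)
    let ?X = "((v \<circ> u) ^^ k) ` (?A - v ` ?A)"
    have eq: "((v \<circ> u) ^^ Suc k) ` (?A - v ` ?A) = v ` u ` ?X" by (simp add: image_comp comp_assoc)
    have 1: "u ` ?X \<subseteq> ?A"
      by (intro image_subsetI funcset_mem[OF WI1_D(1)[OF u]]) (use Suc in blast)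
    have "v ` u ` ?X \<subseteq> ?A"
      by (intro image_subsetI funcset_mem[OF WI2_D(1)[OF v]]) (use 1 in blast)
    moreover have "u ` ?X \<in> sets lebesgue" using Suc by (intro rat_pieces_image_sets[OF up]) blast+
    then have "v ` u ` ?X \<in> sets lebesgue" by (intro rat_pieces_image_sets[OF vp] 1)
    ultimately show ?case unfolding eq by blast
  qed
  then show ?thesis unfolding scb_core_def by (intro sets.countable_UN'') auto
qed

lemma sets_lebesgue_unit: "{0..<1::real} \<in> sets lebesgue"
  by simp

lemma frac_measurable [measurable]: "frac \<in> borel_measurable (borel :: real measure)"
  unfolding frac_def[abs_def] by measurable

text \<open>Several exponents can give the same value of \<open>h x\<close>; taking the first one in an enumeration of the
  integers makes the choice measurable.\<close>

lemma measurable_exponent: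
  assumes hm: "h \<in> borel_measurable (lebesgue_on {0..<1})"
    and ex: "\<And>x. x \<in> {0..<1} \<Longrightarrow> \<exists>m::int. h x = frac (2 powi m * lift x)"
  obtains m :: "real \<Rightarrow> int" where "\<And>x. x \<in> {0..<1} \<Longrightarrow> h x = frac (2 powi (m x) * lift x)"
    "\<And>k. {x\<in>{0..<1}. m x = k} \<in> sets lebesgue"
proof -
  define P where "P i x \<longleftrightarrow> h x = frac (2 powi (int_decode i) * lift x)" for i x
  define m where "m x = int_decode (LEAST i. P i x)" for x
  have exP: "\<exists>i. P i x" if x: "x \<in> {0..<1}" for x
  proof -
    obtain n where "h x = frac (2 powi n * lift x)" using ex[OF x] by blast
    then show ?thesis by (intro exI[of _ "int_encode n"]) (simp add: P_def)
  qed
  have Pm: "{x\<in>{0..<1}. P i x} \<in> sets lebesgue" for i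
    unfolding P_def
  proof (rule sets_lebesgue_eq[OF _ hm])
    have [measurable]: "lift \<in> borel_measurable borel" unfolding lift_def[abs_def] by measurable
    show "(\<lambda>x. frac (2 powi (int_decode i) * lift x)) \<in> borel_measurable borel" by measurable
  qed simp
  show thesis
  proof (rule that[of m])
    show "h x = frac (2 powi (m x) * lift x)" if "x \<in> {0..<1}" for x
      using LeastI_ex[OF exP[OF that]] by (simp add: m_def P_def)
    fix k
    let ?i = "int_encode k"
    have "{x\<in>{0..<1}. m x = k} = {x\<in>{0..<1}. P ?i x} - (\<Union>j\<in>{..<?i}. {x\<in>{0..<1}. P j x})"
    proof (intro set_eqI iffI)
      fix x assume "x \<in> {x\<in>{0..<1}. m x = k}"
      then have x: "x \<in> {0..<1}" "m x = k" by auto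
      have L: "(LEAST i. P i x) = ?i" using x(2) int_decode_inverse[of "LEAST i. P i x"] by (simp add: m_def)
      have "P ?i x" using LeastI_ex[OF exP[OF x(1)]] unfolding L .
      moreover have "\<not> P j x" if "j < ?i" for j using not_less_Least[of j "\<lambda>i. P i x"] that unfolding L by simp
      ultimately show "x \<in> {x\<in>{0..<1}. P ?i x} - (\<Union>j\<in>{..<?i}. {x\<in>{0..<1}. P j x})" using x(1) by auto
    next
      fix x assume x: "x \<in> {x\<in>{0..<1}. P ?i x} - (\<Union>j\<in>{..<?i}. {x\<in>{0..<1}. P j x})"
      have "(LEAST i. P i x) = ?i"
      proof (rule Least_equality)
        show "P ?i x" using x by simp
        show "?i \<le> j" if "P j x" for j
        proof (rule ccontr)
          assume "\<not> ?i \<le> j"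
          then show False using x that by auto
        qed
      qed
      then show "x \<in> {x\<in>{0..<1}. m x = k}" using x by (simp add: m_def)
    qed
    also have "\<dots> \<in> sets lebesgue" using Pm by (intro sets.Diff sets.finite_UN) auto
    finally show "{x\<in>{0..<1}. m x = k} \<in> sets lebesgue" .
  qed
qed

lemma WI1_frac:
  assumes "u \<in> WI1" "x \<in> {0..<1}"
  shows "\<exists>m::int. u x = frac (2 powi m * lift x)"
proof -
  obtain k where k: "k \<ge> 1" "u x = (if x < 1/2 then 1 else 0) + lift x / 2 ^ k" using WI1_D(3)[OF assms] by blast
  have "u x \<in> {0..<1}" using WI1_D(1)[OF assms(1)] assms(2) by (auto simp: Pi_iff)
  moreover have "2 powi (- int k) * lift x = lift x / 2 ^ k" by (simp add: power_int_minus field_simps)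
  ultimately have "frac (2 powi (- int k) * lift x) = u x"
    using k(2) by (auto simp: frac_unique_iff)
  then show ?thesis by metis
qed

text \<open>Multiplying \<open>v y = (y + l) / 2^k\<close> by \<open>2^k\<close> recovers \<open>y\<close> modulo one.\<close>

lemma WI2_inverse_frac:
  assumes "v \<in> WI2" "y \<in> {0..<1}"
  shows "\<exists>m::int. y = frac (2 powi m * lift (v y))"
proof -
  obtain k l :: nat where k: "v y = (y + real l) / 2 ^ k" using WI2_D(4)[OF assms] by blast
  obtain b :: int where b: "lift (v y) = of_int b + v y"
    by (cases "v y < 1/2") (auto simp: lift_def intro: that[of "-1"] that[of 0])
  have "2 ^ k * v y = y + real l" using k by simp
  then have "2 powi (int k) * lift (v y) - y = of_int (2 ^ k * b + int l)"
    by (simp add: b distrib_left)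
  then have "2 powi (int k) * lift (v y) - y \<in> \<int>" by (metis Ints_of_int)
  then have "frac (2 powi (int k) * lift (v y)) = y" using assms(2) by (simp add: frac_unique_iff)
  then show ?thesis by metis
qed

text \<open>At each point \<open>u \<diamondop> v\<close> is \<open>u\<close> or the inverse of \<open>v\<close>, and both have the normal form.\<close>

theorem diamond_wavelet_induced:
  assumes u: "u \<in> WI1" and v: "v \<in> WI2"
  shows "wavelet_induced (u \<diamondop> v)"
proof -
  let ?A = "{0..<1::real}" and ?h = "u \<diamondop> v"
  let ?K = "scb_core ?A ?A u v"
  note uD = WI1_D(1)[OF u] and vD = WI2_D(1)[OF v] WI2_D(3)[OF v]
  have bij: "bij_betw ?h ?A ?A" using uD WI1_inj[OF u] vD by (rule bij_scb_map)
  have K: "?K \<in> sets lebesgue" by (rule scb_core_measurable[OF u v])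
  have KA: "?K \<subseteq> ?A" using uD vD(1) by (rule scb_core_subset)
  have AK: "?A - ?K \<in> sets lebesgue" using K sets_lebesgue_unit by (rule sets.Diff[rotated])
  have out: "?A - ?K \<subseteq> v ` ?A" using scb_core_base[of ?A v ?A u] by blast
  have hm: "?h \<in> borel_measurable (lebesgue_on ?A)"
    unfolding borel_measurable_lebesgue_on_iff[OF sets_lebesgue_unit]
  proof
    fix t
    have "{x\<in>?A. t < ?h x} = (?K \<inter> {x\<in>?A. t < u x}) \<union> {x\<in>?A - ?K. t < inv_into ?A v x}"
    proof (intro set_eqI)
      fix x
      show "x \<in> {x\<in>?A. t < ?h x} \<longleftrightarrow> x \<in> (?K \<inter> {x\<in>?A. t < u x}) \<union> {x\<in>?A - ?K. t < inv_into ?A v x}"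
      proof (cases "x \<in> ?K")
        case True
        then show ?thesis using scb_map_core[OF True] by simp
      next
        case False
        then show ?thesis using scb_map_outside_core[of x ?A ?A u v] by auto
      qed
    qed
    moreover have "{x\<in>?A. t < u x} \<in> sets lebesgue"
      using WI1_D(2)[OF u] unfolding borel_measurable_lebesgue_on_iff[OF sets_lebesgue_unit] by blast
    moreover have "{x\<in>?A - ?K. t < inv_into ?A v x} \<in> sets lebesgue"
      using rat_pieces_inv_measurable[OF WI2_rat_pieces[OF v] vD(2) AK out]
      unfolding borel_measurable_lebesgue_on_iff[OF AK] by blast
    ultimately show "{x\<in>?A. t < ?h x} \<in> sets lebesgue" using K by auto
  qed
  have ex: "\<exists>m::int. ?h x = frac (2 powi m * lift x)" if x: "x \<in> ?A" for x
  proof (cases "x \<in> ?K")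
    case True
    then show ?thesis using WI1_frac[OF u x] by (simp add: scb_map_core)
  next
    case False
    then have "x \<in> v ` ?A" using out x by blast
    then have "inv_into ?A v x \<in> ?A" "v (inv_into ?A v x) = x" by (rule inv_into_into, rule f_inv_into_f)
    then show ?thesis using WI2_inverse_frac[OF v, of "inv_into ?A v x"] scb_map_outside_core[OF x False] by simp
  qed
  obtain m :: "real \<Rightarrow> int" where "\<And>x. x \<in> ?A \<Longrightarrow> ?h x = frac (2 powi (m x) * lift x)"
    "\<And>k. {x\<in>?A. m x = k} \<in> sets lebesgue"
    by (rule measurable_exponent[OF hm], rule ex, assumption, rule that)
  then show ?thesis by (rule wavelet_inducedI[OF bij])
qed

section \<open>Non-uniqueness of the representation\<close>

text \<open>Membership in \<^const>\<open>WI1\<close> from an exponent function instead of a pair of partitions.\<close>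

lemma WI1I_level:
  assumes S: "\<And>j. {x\<in>{0..<1}. k x = j} \<in> sets lebesgue"
    and k: "\<And>x. x \<in> {0..<1} \<Longrightarrow> k x \<ge> (1::nat)"
    and u: "\<And>x. x \<in> {0..<1} \<Longrightarrow> u x = (if x < 1/2 then 1 else 0) + lift x / 2 ^ k x"
  shows "u \<in> WI1"
proof -
  let ?P = "\<lambda>j. {1/2..<1} \<inter> {x\<in>{0..<1}. k x = j}" and ?Q = "\<lambda>j. {0..<1/2} \<inter> {x\<in>{0..<1}. k x = j}"
  have part: "measurable_partition ?P {1/2..<1}" "measurable_partition ?Q {0..<1/2}"
    using S k by (auto simp: measurable_partition_def disjoint_family_on_def)
  have range: "u x \<in> {0..<1}" if x: "x \<in> {0..<1}" for x
  proof -
    have p: "(1::real) \<le> 2 ^ k x" by simp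
    show ?thesis
    proof (cases "x < 1/2")
      case True
      have "(1 - x) * 1 \<le> 1 * 2 ^ k x" using x p by (intro mult_mono) auto
      then have "(1 - x) / 2 ^ k x \<le> 1" "0 < (1 - x) / 2 ^ k x" using x by (auto simp: divide_le_eq)
      moreover have "u x = 1 - (1 - x) / 2 ^ k x" using u[OF x] True by (simp add: lift_def field_simps)
      ultimately show ?thesis by simp
    next
      case False
      have "x < 1" using x by simp
      then have "x < 2 ^ k x" using p by linarith
      then have "x / 2 ^ k x < 1" "0 \<le> x / 2 ^ k x" using x by (auto simp: divide_less_eq)
      moreover have "u x = x / 2 ^ k x" using u[OF x] False by (simp add: lift_def)
      ultimately show ?thesis by simp
    qed
  qed
  have meas: "u \<in> borel_measurable (lebesgue_on {0..<1})"
  proof (rule borel_measurable_piecewise[where I="UNIV" and C="\<lambda>j. {x\<in>{0..<1}. k x = j}" and g="\<lambda>j x. (if x < 1/2 then 1 else 0) + lift x / 2 ^ j"])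
    have [measurable]: "lift \<in> borel_measurable borel" unfolding lift_def[abs_def] by measurable
    show "(\<lambda>x. (if x < 1/2 then 1 else 0) + lift x / 2 ^ j) \<in> borel_measurable lebesgue" for j
      by (rule borel_imp_lebesgue_measurable) measurable
    show "{x\<in>{0..<1}. k x = j} \<in> sets lebesgue" for j by (rule S)
    show "u x = (if x < 1/2 then 1 else 0) + lift x / 2 ^ j" if "x \<in> {x\<in>{0..<1}. k x = j}" for j x
      using u[of x] that by blast
  qed auto
  have val: "(\<forall>x\<in>?P j. u x = x / 2 ^ j) \<and> (\<forall>x\<in>?Q j. u x = (x - 1) / 2 ^ j + 1)" for j
  proof (intro conjI ballI)
    show "u x = x / 2 ^ j" if x: "x \<in> ?P j" for x
    proof -
      have "x \<in> {0..<1}" "\<not> x < 1/2" "k x = j" using x by auto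
      then show ?thesis using u[of x] by (simp only: lift_def if_False add_0)
    qed
    show "u x = (x - 1) / 2 ^ j + 1" if x: "x \<in> ?Q j" for x
    proof -
      have "x \<in> {0..<1}" "x < 1/2" "k x = j" using x by auto
      then show ?thesis using u[of x] by (simp only: lift_def if_True add.commute)
    qed
  qed
  have maps: "u \<in> {0..<1} \<rightarrow> {0..<1}" by (rule Pi_I) (rule range)
  show ?thesis unfolding WI1_def
    by (rule CollectI, intro conjI maps meas exI[of _ ?P] exI[of _ ?Q] part allI impI val[THEN conjunct1] val[THEN conjunct2])
qed

lemma id_WI2: "(\<lambda>x. x) \<in> WI2"
proof -
  have "(\<lambda>x::real. x) \<in> borel_measurable (lebesgue_on {0..<1})"
    by (intro measurable_restrict_space1 borel_imp_lebesgue_measurable) simp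
  moreover have "\<exists>k l::nat. x = (x + real l) / 2 ^ k" for x :: real
    by (rule exI[of _ 0], rule exI[of _ 0]) simp
  ultimately show ?thesis by (auto simp: WI2_def)
qed

lemma diamond_id: "x \<in> {0..<1} \<Longrightarrow> (u \<diamondop> (\<lambda>x. x)) x = x"
proof -
  assume x: "x \<in> {0..<1}"
  have "x \<notin> scb_core {0..<1} {0..<1} u (\<lambda>x. x)" by (simp add: scb_core_def)
  then have "(u \<diamondop> (\<lambda>x. x)) x = inv_into {0..<1} (\<lambda>x. x) x" by (rule scb_map_outside_core[OF x])
  also have "\<dots> = x" by (rule inv_into_f_f[OF _ x]) (simp add: inj_on_def)
  finally show ?thesis .
qed

text \<open>If \<open>v\<close> is the identity, the core is empty and \<open>u \<diamondop> v\<close> is the identity for every \<open>u\<close>; two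
  members of \<^const>\<open>WI1\<close> with different constant exponents differ everywhere.\<close>

lemma diamond_not_unique:
  "\<exists>h. wavelet_induced h \<and>
      (\<exists>u\<in>WI1. \<exists>v\<in>WI2. \<exists>u'\<in>WI1. \<exists>v'\<in>WI2.
        ae_eq h (u \<diamondop> v) \<and> ae_eq h (u' \<diamondop> v') \<and> \<not> (ae_eq u u' \<and> ae_eq v v'))"
proof -
  define u where "u j x = (if x < 1/2 then 1 else 0) + lift x / 2 ^ j" for j :: nat and x
  have u: "u j \<in> WI1" if "j \<ge> 1" for j
  proof (rule WI1I_level[where k="\<lambda>_. j"])
    show "{x\<in>{0..<1::real}. j = i} \<in> sets lebesgue" for i
    proof -
      have "{x\<in>{0..<1::real}. j = i} = (if j = i then {0..<1} else {})" by auto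
      then show ?thesis by simp
    qed
  qed (use that in \<open>auto simp: u_def\<close>)
  let ?h = "u 1 \<diamondop> (\<lambda>x. x)"
  have "ae_eq ?h ?h" by (simp add: ae_eq_def)
  moreover have "ae_eq ?h (u 2 \<diamondop> (\<lambda>x. x))"
    unfolding ae_eq_def by (rule AE_I2) (simp add: diamond_id)
  moreover have "\<not> ae_eq (u 1) (u 2)"
  proof
    assume "ae_eq (u 1) (u 2)"
    then have "AE x in lebesgue_on {0..<1}. u 1 x = u 2 x" by (simp add: ae_eq_def)
    moreover have "AE x in lebesgue_on {0..<1}. u 1 x \<noteq> u 2 x"
      by (rule AE_I2) (use lift_nonzero in \<open>auto simp: u_def\<close>)
    ultimately have "AE x in lebesgue_on {0..<1::real}. False" by eventually_elim simp
    then obtain N where N: "{x \<in> space (lebesgue_on {0..<1::real}). \<not> False} \<subseteq> N"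
        "emeasure (lebesgue_on {0..<1}) N = 0" "N \<in> sets (lebesgue_on {0..<1})" by (rule AE_E)
    have "emeasure (lebesgue_on {0..<1::real}) {0..<1} \<le> emeasure (lebesgue_on {0..<1}) N"
      by (rule emeasure_mono[OF _ N(3)]) (use N(1) in auto)
    then show False using N(2) by (simp add: emeasure_restrict_space)
  qed
  moreover have u12: "u 1 \<in> WI1" "u 2 \<in> WI1" by (rule u, simp)+
  moreover have "wavelet_induced ?h" by (rule diamond_wavelet_induced[OF u12(1) id_WI2])
  ultimately show ?thesis using id_WI2 by (intro exI[of _ ?h]) blast
qed

section \<open>Dyadic affine maps between sets of positive measure\<close>

text \<open>The dyadic interval of length \<open>1 / 2^k\<close> around \<open>x\<close>, in a form that makes the nesting of these
  intervals a matter of integer division.\<close>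

definition dyadic_cell :: "nat \<Rightarrow> real \<Rightarrow> real set" where
  "dyadic_cell k x = {y. \<lfloor>2 ^ k * y\<rfloor> = \<lfloor>2 ^ k * x\<rfloor>}"

lemma dyadic_cell_eq: "dyadic_cell k x = {of_int \<lfloor>2 ^ k * x\<rfloor> / 2 ^ k..<(of_int \<lfloor>2 ^ k * x\<rfloor> + 1) / 2 ^ k}"
proof -
  have "\<lfloor>2 ^ k * y\<rfloor> = n \<longleftrightarrow> of_int n / 2 ^ k \<le> y \<and> y < (of_int n + 1) / 2 ^ k" for y :: real and n :: int
    by (auto simp: floor_eq_iff field_simps)
  then show ?thesis by (auto simp: dyadic_cell_def)
qed

lemma dyadic_cell_mono: "dyadic_cell (Suc k) x \<subseteq> dyadic_cell k x"
proof
  fix y assume "y \<in> dyadic_cell (Suc k) x"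
  then have e: "\<lfloor>2 * 2 ^ k * y\<rfloor> = \<lfloor>2 * 2 ^ k * x\<rfloor>" by (simp add: dyadic_cell_def)
  have "\<lfloor>2 ^ k * z\<rfloor> = \<lfloor>2 * 2 ^ k * z\<rfloor> div 2" for z :: real
    using floor_divide_real_eq_div[of 2 "2 * 2 ^ k * z"] by simp
  then show "y \<in> dyadic_cell k x" by (simp add: dyadic_cell_def e)
qed

text \<open>Suppose not. The maps \<open>y \<mapsto> (y + l) / 2^k\<close> put a scaled copy of \<open>C\<close> into every short dyadic
  interval, and this copy avoids \<open>R\<close>. So \<open>R\<close> fills at most the fraction \<open>1 - c\<close> of such an interval, where
  \<open>c\<close> is the measure of \<open>C\<close>. An open set is an increasing union of unions of dyadic intervals, so \<open>R\<close>
  also fills at most this fraction of any open \<open>U\<close> containing it. This contradicts outer regularity.\<close>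

lemma affine_meets_of_positive_measure:
  assumes C: "C \<in> sets lebesgue" "C \<subseteq> {0..<1}" "emeasure lebesgue C > 0"
    and R: "R \<in> sets lebesgue" "R \<subseteq> {0..<1}" "emeasure lebesgue R > 0"
  shows "\<exists>k\<ge>k0. \<exists>l::nat. \<exists>y\<in>C. (y + real l) / 2 ^ k \<in> R"
proof (rule ccontr)
  assume none: "\<not> ?thesis"
  have fin: "emeasure lebesgue S \<le> 1" if "S \<subseteq> {0..<1::real}" for S
    using emeasure_mono[OF that, of lebesgue] by simp
  obtain c where c: "emeasure lebesgue C = ennreal c" "0 < c" "c \<le> 1"
    using fin[OF C(2)] C(3) by (cases "emeasure lebesgue C") (auto simp: top_unique)
  obtain r where r: "emeasure lebesgue R = ennreal r" "0 < r" "r \<le> 1"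
    using fin[OF R(2)] R(3) by (cases "emeasure lebesgue R") (auto simp: top_unique)
  have cell: "emeasure lebesgue (R \<inter> {real l / 2 ^ k..<(real l + 1) / 2 ^ k}) \<le> ennreal (1 - c) * emeasure lebesgue {real l / 2 ^ k..<(real l + 1) / 2 ^ k}"
    if k: "k \<ge> k0" for k l
  proof -
    let ?I = "{real l / 2 ^ k..<(real l + 1) / 2 ^ k}"
    let ?T = "(\<lambda>y. real l / 2 ^ k + 1 / 2 ^ k * y) ` C"
    have T: "?T \<in> sets lebesgue" by (rule lebesgue_affine_image[OF C(1)]) simp
    have TI: "?T \<subseteq> ?I" using C(2) by (auto simp: field_simps)
    have TR: "?T \<inter> R = {}"
    proof -
      have "real l / 2 ^ k + 1 / 2 ^ k * y \<notin> R" if "y \<in> C" for y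
      proof -
        have "real l / 2 ^ k + 1 / 2 ^ k * y = (y + real l) / 2 ^ k" by (simp add: field_simps)
        then show ?thesis using none k that by metis
      qed
      then show ?thesis by auto
    qed
    have I: "emeasure lebesgue ?I = ennreal (1 / 2 ^ k)"
      by (simp add: divide_right_mono flip: diff_divide_distrib)
    have eT: "emeasure lebesgue ?T = ennreal (1 / 2 ^ k * c)"
      unfolding emeasure_affine_image c(1) using c by (simp flip: ennreal_mult)
    have "emeasure lebesgue (R \<inter> ?I) \<le> emeasure lebesgue ?I" using R by (intro emeasure_mono) auto
    then obtain s where s: "emeasure lebesgue (R \<inter> ?I) = ennreal s" "0 \<le> s"
      unfolding I by (cases "emeasure lebesgue (R \<inter> ?I)") (auto simp: top_unique)
    have "emeasure lebesgue (R \<inter> ?I) + emeasure lebesgue ?T = emeasure lebesgue ((R \<inter> ?I) \<union> ?T)"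
      using R T TR by (intro plus_emeasure) auto
    also have "\<dots> \<le> emeasure lebesgue ?I" using R T TI by (intro emeasure_mono) auto
    finally have "ennreal s + ennreal (1 / 2 ^ k * c) \<le> ennreal (1 / 2 ^ k)" unfolding I eT s .
    then have "s + 1 / 2 ^ k * c \<le> 1 / 2 ^ k" using s c by (simp flip: ennreal_plus)
    moreover have "(1 - c) * (1 / 2 ^ k) = 1 / 2 ^ k - 1 / 2 ^ k * c" by (simp add: algebra_simps diff_divide_distrib)
    ultimately have "s \<le> (1 - c) * (1 / 2 ^ k)" by linarith
    then have "ennreal s \<le> ennreal ((1 - c) * (1 / 2 ^ k))" by (rule ennreal_leI)
    also have "\<dots> = ennreal (1 - c) * ennreal (1 / 2 ^ k)" using c by (intro ennreal_mult) auto
    finally show ?thesis unfolding I s .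
  qed
  have open_le: "emeasure lebesgue R \<le> ennreal (1 - c) * emeasure lebesgue U" if U: "open U" "R \<subseteq> U" for U
  proof -
    \<comment> \<open>The part of \<open>U\<close> filled by the dyadic intervals of level \<open>k0 + n\<close> inside \<open>U\<close>; the sets \<open>J n l\<close> are
      these intervals, listed without repetition.\<close>
    define K where "K n = {x. 0 \<le> x \<and> dyadic_cell (k0 + n) x \<subseteq> U}" for n
    define J where "J n l = (if {real l / 2 ^ (k0 + n)..<(real l + 1) / 2 ^ (k0 + n)} \<subseteq> U then {real l / 2 ^ (k0 + n)..<(real l + 1) / 2 ^ (k0 + n)} else {})" for n l
    have KJ: "K n = (\<Union>l. J n l)" for n
    proof (intro equalityI subsetI)
      fix x assume x: "x \<in> K n"
      then have n: "\<lfloor>2 ^ (k0 + n) * x\<rfloor> \<ge> 0" by (simp add: K_def)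
      define l where "l = nat \<lfloor>2 ^ (k0 + n) * x\<rfloor>"
      have l: "of_int \<lfloor>2 ^ (k0 + n) * x\<rfloor> = real l" using n by (simp add: l_def)
      have c: "dyadic_cell (k0 + n) x = {real l / 2 ^ (k0 + n)..<(real l + 1) / 2 ^ (k0 + n)}"
        using dyadic_cell_eq[of "k0 + n" x] unfolding l .
      have "x \<in> dyadic_cell (k0 + n) x" by (simp add: dyadic_cell_def)
      moreover have "dyadic_cell (k0 + n) x \<subseteq> U" using x by (simp add: K_def)
      ultimately have "x \<in> J n l" unfolding J_def c by (simp only: if_True)
      then show "x \<in> (\<Union>l. J n l)" by blast
    next
      fix x assume "x \<in> (\<Union>l. J n l)"
      then obtain l where l: "{real l / 2 ^ (k0 + n)..<(real l + 1) / 2 ^ (k0 + n)} \<subseteq> U"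
         "x \<in> {real l / 2 ^ (k0 + n)..<(real l + 1) / 2 ^ (k0 + n)}" by (auto simp: J_def split: if_splits)
      then have "real l \<le> 2 ^ (k0 + n) * x" "2 ^ (k0 + n) * x < real l + 1" by (auto simp: field_simps)
      then have "\<lfloor>2 ^ (k0 + n) * x\<rfloor> = int l" by (simp add: floor_eq_iff)
      then have "dyadic_cell (k0 + n) x \<subseteq> U" unfolding dyadic_cell_eq using l(1) by simp
      moreover have "0 \<le> x" using l(2) order_trans[of 0 "real l / 2 ^ (k0 + n)" x] by simp
      ultimately show "x \<in> K n" by (simp add: K_def)
    qed
    have Jm: "J n l \<in> sets lebesgue" for n l by (simp add: J_def)
    have Jd: "disjoint_family (J n)" for n
      unfolding disjoint_family_on_def
    proof (intro ballI impI)
      fix i j :: nat assume "i \<noteq> j"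
      show "J n i \<inter> J n j = {}"
      proof (rule ccontr)
        assume "J n i \<inter> J n j \<noteq> {}"
        then obtain x where x: "x \<in> J n i" "x \<in> J n j" by blast
        then have "real i \<le> 2 ^ (k0 + n) * x" "2 ^ (k0 + n) * x < real i + 1"
           "real j \<le> 2 ^ (k0 + n) * x" "2 ^ (k0 + n) * x < real j + 1"
          by (auto simp: J_def field_simps split: if_splits)
        then have "real i < real j + 1" "real j < real i + 1" by linarith+
        then show False using \<open>i \<noteq> j\<close> by simp
      qed
    qed
    have Km: "K n \<in> sets lebesgue" for n unfolding KJ using Jm by auto
    have step: "emeasure lebesgue (R \<inter> K n) \<le> ennreal (1 - c) * emeasure lebesgue U" for n
    proof -
      have "emeasure lebesgue (R \<inter> K n) = emeasure lebesgue (\<Union>l. R \<inter> J n l)" unfolding KJ Int_UN_distrib ..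
      also have "\<dots> = (\<Sum>l. emeasure lebesgue (R \<inter> J n l))"
      proof (rule suminf_emeasure[symmetric])
        show "disjoint_family (\<lambda>l. R \<inter> J n l)" by (rule disjoint_family_subset[OF Jd]) blast
        show "range (\<lambda>l. R \<inter> J n l) \<subseteq> sets lebesgue" using Jm R(1) by blast
      qed
      also have "\<dots> \<le> (\<Sum>l. ennreal (1 - c) * emeasure lebesgue (J n l))"
      proof (intro suminf_le summableI)
        fix l
        show "emeasure lebesgue (R \<inter> J n l) \<le> ennreal (1 - c) * emeasure lebesgue (J n l)"
        proof (cases "{real l / 2 ^ (k0 + n)..<(real l + 1) / 2 ^ (k0 + n)} \<subseteq> U")
          case True
          then show ?thesis using cell[OF le_add1[of k0 n], of l] by (simp only: J_def if_True)
        next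
          case False
          then show ?thesis by (simp add: J_def)
        qed
      qed
      also have "\<dots> = ennreal (1 - c) * emeasure lebesgue (K n)"
        unfolding KJ using Jm Jd[of n] by (subst suminf_emeasure[symmetric]) auto
      also have "\<dots> \<le> ennreal (1 - c) * emeasure lebesgue U"
      proof (intro mult_left_mono emeasure_mono)
        show "K n \<subseteq> U" unfolding KJ by (auto simp: J_def split: if_splits)
        show "U \<in> sets lebesgue" by (rule sets_completionI_sets) (simp add: U(1) borel_open)
      qed simp
      finally show ?thesis .
    qed
    have inc: "incseq (\<lambda>n. R \<inter> K n)"
      using dyadic_cell_mono by (intro incseq_SucI) (auto simp: K_def)
    have cover: "R = (\<Union>n. R \<inter> K n)"
    proof
      show "R \<subseteq> (\<Union>n. R \<inter> K n)"
      proof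
        fix x assume x: "x \<in> R"
        then obtain d where d: "d > 0" "ball x d \<subseteq> U" using U open_contains_ball by blast
        obtain n where n: "(1/2) ^ n < d" using real_arch_pow_inv[of d "1/2"] d by auto
        have "dyadic_cell (k0 + n) x \<subseteq> ball x d"
        proof
          fix y assume "y \<in> dyadic_cell (k0 + n) x"
          then have "\<bar>2 ^ (k0 + n) * y - 2 ^ (k0 + n) * x\<bar> < 1" unfolding dyadic_cell_def mem_Collect_eq by linarith
          then have "2 ^ (k0 + n) * \<bar>y - x\<bar> < 1" by (simp add: abs_mult flip: right_diff_distrib)
          moreover have "2 ^ n * \<bar>y - x\<bar> \<le> 2 ^ (k0 + n) * \<bar>y - x\<bar>" by (intro mult_right_mono power_increasing) auto
          ultimately have "2 ^ n * \<bar>y - x\<bar> < 1" by linarith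
          then have "\<bar>y - x\<bar> < (1/2) ^ n" by (simp add: power_divide field_simps)
          then show "y \<in> ball x d" using n by (simp add: dist_real_def abs_minus_commute)
        qed
        then show "x \<in> (\<Union>n. R \<inter> K n)" using x d R(2) by (auto simp: K_def)
      qed
    qed auto
    have "emeasure lebesgue R = (SUP n. emeasure lebesgue (R \<inter> K n))"
    proof -
      have "(SUP n. emeasure lebesgue (R \<inter> K n)) = emeasure lebesgue (\<Union>n. R \<inter> K n)"
        by (rule SUP_emeasure_incseq[OF _ inc]) (use Km R(1) in blast)
      then show ?thesis unfolding cover[symmetric] by (rule sym)
    qed
    also have "\<dots> \<le> ennreal (1 - c) * emeasure lebesgue U" by (intro SUP_least step)
    finally show ?thesis .
  qed
  have "c * r > 0" using c r by simp
  \<comment> \<open>Choosing \<open>U\<close> of measure at most \<open>r + c r\<close> is enough, as \<open>(1 - c) (1 + c) < 1\<close>.\<close>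
  then obtain U where U: "open U" "R \<subseteq> U" "U - R \<in> lmeasurable" "emeasure lebesgue (U - R) < ennreal (c * r)"
    by (rule sets_lebesgue_outer_open[OF R(1)])
  have "emeasure lebesgue U = emeasure lebesgue R + emeasure lebesgue (U - R)"
    using U R(1) by (subst plus_emeasure) (auto simp: Un_absorb1)
  also have "\<dots> \<le> ennreal (r + c * r)" using U(4) r c by (simp add: ennreal_plus add_left_mono)
  finally have "ennreal (1 - c) * emeasure lebesgue U \<le> ennreal (1 - c) * ennreal (r + c * r)" by (intro mult_left_mono) auto
  then have "ennreal r \<le> ennreal (1 - c) * ennreal (r + c * r)" using open_le[OF U(1,2)] r(1) by simp
  also have "\<dots> = ennreal ((1 - c) * (r + c * r))" using c r by (intro ennreal_mult[symmetric]) auto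
  finally have "r \<le> (1 - c) * (r + c * r)" using c r by (simp add: ennreal_le_iff)
  also have "\<dots> = r - r * c\<^sup>2" by (simp add: algebra_simps power2_eq_square)
  also have "\<dots> < r" using c r by simp
  finally show False by simp
qed

section \<open>Greedy construction of a dyadic injection\<close>

text \<open>The state after \<open>n\<close> steps: the points still unmatched and the targets still free. In step \<open>n\<close> every
  unmatched point whose image under \<open>T n\<close> is free is matched with this image; as \<open>T n\<close> is meant
  to be injective, no conflict arises within a step.\<close>

primrec greedy :: "(nat \<Rightarrow> 'a \<Rightarrow> 'b) \<Rightarrow> 'a set \<Rightarrow> 'b set \<Rightarrow> nat \<Rightarrow> 'a set \<times> 'b set" where
  "greedy T C R 0 = (C, R)"
| "greedy T C R (Suc n) = (let (U, V) = greedy T C R n; P = {y\<in>U. T n y \<in> V} in (U - P, V - T n ` P))"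

definition matched :: "(nat \<Rightarrow> 'a \<Rightarrow> 'b) \<Rightarrow> 'a set \<Rightarrow> 'b set \<Rightarrow> nat \<Rightarrow> 'a set" where
  "matched T C R n = {y\<in>fst (greedy T C R n). T n y \<in> snd (greedy T C R n)}"

lemma greedy_Suc:
  "fst (greedy T C R (Suc n)) = fst (greedy T C R n) - matched T C R n"
  "snd (greedy T C R (Suc n)) = snd (greedy T C R n) - T n ` matched T C R n"
  by (simp_all add: matched_def Let_def split_beta)

lemma greedy_fst: "fst (greedy T C R n) = C - (\<Union>i<n. matched T C R i)"
  by (induction n) (auto simp: greedy_Suc lessThan_Suc simp del: greedy.simps(2))

lemma greedy_snd: "snd (greedy T C R n) = R - (\<Union>i<n. T i ` matched T C R i)"
  by (induction n) (auto simp: greedy_Suc lessThan_Suc simp del: greedy.simps(2))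

lemma matched_iff: "y \<in> matched T C R n \<longleftrightarrow>
  (y \<in> C \<and> (\<forall>i<n. y \<notin> matched T C R i)) \<and> (T n y \<in> R \<and> (\<forall>i<n. T n y \<notin> T i ` matched T C R i))"
  unfolding matched_def[of T C R n] mem_Collect_eq greedy_fst greedy_snd Diff_iff UN_iff lessThan_iff Ball_def Bex_def by blast

text \<open>Run the greedy matching over all maps \<open>y \<mapsto> (y + l) / 2^k\<close> with \<open>k \<ge> k0\<close>, where \<open>k0\<close> is so large that
  the images of all of \<open>[0,1)\<close> cannot exhaust \<open>R\<close>. If the unmatched part of \<open>C\<close> had positive measure,
  some map \<open>T n\<close> would send one of its points to a target that is never used, and that point would
  have been matched in step \<open>n\<close> at the latest.\<close>

lemma dyadic_partial_injection:
  assumes C: "C \<in> sets lebesgue" "C \<subseteq> {0..<1}" and R: "R \<in> sets lebesgue" "R \<subseteq> {0..<1}" "emeasure lebesgue R > 0"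
  obtains D g where "D \<in> sets lebesgue" "D \<subseteq> C" "C - D \<in> null_sets lebesgue" "inj_on g D" "g ` D \<subseteq> R"
    "g \<in> borel_measurable (lebesgue_on D)" "\<And>y. y \<in> D \<Longrightarrow> \<exists>k l::nat. g y = (y + real l) / 2 ^ k"
proof -
  have "emeasure lebesgue R \<le> emeasure lebesgue {0..<1::real}" using R by (intro emeasure_mono) auto
  then obtain r where r: "emeasure lebesgue R = ennreal r" "0 < r"
    using R(3) by (cases "emeasure lebesgue R") (auto simp: top_unique)
  obtain k0 where k0: "(1/2) ^ k0 < r" using real_arch_pow_inv[of r "1/2"] r by auto
  define a where "a n = (1/2::real) ^ (k0 + fst (prod_decode n))" for n
  define b where "b n = real (snd (prod_decode n)) * a n" for n
  define T where "T n y = b n + a n * y" for n y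
  have a0: "a n > 0" for n by (simp add: a_def)
  have ale: "a n \<le> (1/2) ^ k0" for n unfolding a_def by (intro power_decreasing) auto
  have Tform: "T n y = (y + real (snd (prod_decode n))) / 2 ^ (k0 + fst (prod_decode n))" for n y
    by (simp add: T_def b_def a_def power_divide field_simps)
  have T_image: "T i ` X \<in> sets lebesgue" if "X \<in> sets lebesgue" for i X
    unfolding T_def[abs_def] using that a0[of i] by (intro lebesgue_affine_image) auto
  let ?P = "matched T C R"
  have Pm: "?P n \<in> sets lebesgue" for n
  proof (induction n rule: less_induct)
    case (less n)
    have "T i ` ?P i \<in> sets lebesgue" if "i < n" for i
      by (rule T_image[OF less[OF that]])
    then have V: "R - (\<Union>i<n. T i ` ?P i) \<in> sets lebesgue" using R by (intro sets.Diff sets.finite_UN) auto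
    have "{y. b n + a n * y \<in> R - (\<Union>i<n. T i ` ?P i)} \<in> sets lebesgue"
      using a0[of n] by (intro lebesgue_affine_vimage V) auto
    moreover have "C - (\<Union>i<n. ?P i) \<in> sets lebesgue" using C less by (intro sets.Diff sets.finite_UN) auto
    moreover have "?P n = (C - (\<Union>i<n. ?P i)) \<inter> {y. b n + a n * y \<in> R - (\<Union>i<n. T i ` ?P i)}"
    proof (intro set_eqI)
      fix y
      have Ty: "b n + a n * y = T n y" by (simp add: T_def)
      show "y \<in> ?P n \<longleftrightarrow> y \<in> (C - (\<Union>i<n. ?P i)) \<inter> {y. b n + a n * y \<in> R - (\<Union>i<n. T i ` ?P i)}"
        unfolding Int_iff mem_Collect_eq Diff_iff Ty using matched_iff[of y T C R n] by blast
    qed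
    ultimately show ?case by (simp only: sets.Int)
  qed
  define D where "D = (\<Union>n. ?P n)"
  define g where "g y = T (THE n. y \<in> ?P n) y" for y
  have PC: "?P n \<subseteq> C" for n using matched_iff[of _ T C R n] by blast
  have P_less: "y \<notin> ?P j" if "y \<in> ?P i" "i < j" for i j y
    using that matched_iff[of y T C R j] by blast
  have P_unique: "i = j" if "y \<in> ?P i" "y \<in> ?P j" for i j y
    using P_less that by (metis linorder_neqE_nat)
  have gP: "g y = T n y" if "y \<in> ?P n" for n y
  proof -
    have "(THE n. y \<in> ?P n) = n" using that P_unique by (intro the_equality) auto
    then show ?thesis by (simp add: g_def)
  qed
  have T_less: "T i y \<noteq> T j z" if "y \<in> ?P i" "z \<in> ?P j" "i < j" for i j y z
  proof -
    have "T j z \<notin> T i ` ?P i" using that(2,3) matched_iff[of z T C R j] by blast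
    then show ?thesis using that(1) by (metis imageI)
  qed
  have Dm: "D \<in> sets lebesgue" using Pm by (auto simp: D_def)
  have DC: "D \<subseteq> C" using PC by (auto simp: D_def)
  have inj: "inj_on g D"
  proof (rule inj_onI)
    fix y z assume "y \<in> D" "z \<in> D" and e: "g y = g z"
    then obtain i j where ij: "y \<in> ?P i" "z \<in> ?P j" by (auto simp: D_def)
    then have "T i y = T j z" using gP e by simp
    moreover from this have "i = j" using T_less ij by (metis linorder_neqE_nat)
    ultimately show "y = z" using a0[of j] by (simp add: T_def)
  qed
  have gR: "g ` D \<subseteq> R"
  proof (intro image_subsetI)
    fix y assume "y \<in> D"
    then obtain n where n: "y \<in> ?P n" by (auto simp: D_def)
    then have "T n y \<in> R" using matched_iff[of y T C R n] by blast
    then show "g y \<in> R" using gP[OF n] by simp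
  qed
  have gm: "g \<in> borel_measurable (lebesgue_on D)"
  proof (rule borel_measurable_piecewise[where I=UNIV and C="?P" and g=T])
    show "T n \<in> borel_measurable lebesgue" for n
      unfolding T_def[abs_def] by (rule measurable_completion) simp
  qed (use Pm Dm gP in \<open>auto simp: D_def\<close>)
  have rp: "rat_pieces g D"
    unfolding rat_pieces_def
  proof (intro conjI ballI Dm gm)
    fix y assume "y \<in> D"
    then obtain n where n: "y \<in> ?P n" by (auto simp: D_def)
    have "a n \<in> \<rat>" by (simp add: a_def)
    moreover from this have "b n \<in> \<rat>" by (simp add: b_def)
    ultimately show "rat_rel y (g y)" using gP[OF n] a0[of n] by (intro rat_relI[of "a n" "b n"]) (auto simp: T_def)
  qed
  have small: "emeasure lebesgue (g ` D) < emeasure lebesgue R"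
  proof -
    have "emeasure lebesgue (g ` D) \<le> ennreal ((1/2) ^ k0) * emeasure lebesgue D"
    proof (rule rat_pieces_image_le[OF rp Dm subset_refl])
      fix y assume "y \<in> D"
      then obtain n where n: "y \<in> ?P n" by (auto simp: D_def)
      have "a n \<in> \<rat>" by (simp add: a_def)
      moreover from this have "b n \<in> \<rat>" by (simp add: b_def)
      ultimately show "\<exists>a\<in>\<rat>. \<exists>b\<in>\<rat>. 0 < a \<and> a \<le> (1/2) ^ k0 \<and> g y = b + a * y"
        using gP[OF n] a0[of n] ale[of n] by (intro bexI[of _ "a n"] bexI[of _ "b n"]) (auto simp: T_def)
    qed
    also have "\<dots> \<le> ennreal ((1/2) ^ k0) * emeasure lebesgue {0..<1::real}"
      using DC C(2) by (intro mult_left_mono emeasure_mono) auto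
    also have "\<dots> = ennreal ((1/2) ^ k0)" by simp
    also have "\<dots> < ennreal r" using k0 r by (intro ennreal_lessI)
    finally show ?thesis by (simp add: r)
  qed
  have gDm: "g ` D \<in> sets lebesgue" by (rule rat_pieces_image_sets[OF rp Dm subset_refl])
  have posR: "emeasure lebesgue (R - g ` D) > 0"
  proof (rule ccontr)
    assume "\<not> ?thesis"
    then have "emeasure lebesgue (R - g ` D) = 0" by simp
    moreover have "emeasure lebesgue R = emeasure lebesgue (g ` D) + emeasure lebesgue (R - g ` D)"
      using gDm R(1) gR by (subst plus_emeasure) (auto simp: Un_absorb1)
    ultimately show False using small by simp
  qed
  have null: "C - D \<in> null_sets lebesgue"
  proof (rule ccontr)
    assume n: "C - D \<notin> null_sets lebesgue"
    have CD: "C - D \<in> sets lebesgue" using C Dm by auto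
    then have pos: "emeasure lebesgue (C - D) > 0" using n by (simp add: null_sets_def zero_less_iff_neq_zero)
    have "\<exists>k\<ge>k0. \<exists>l::nat. \<exists>y\<in>C - D. (y + real l) / 2 ^ k \<in> R - g ` D"
      using CD pos posR gDm R C by (intro affine_meets_of_positive_measure) auto
    then obtain k l y where kly: "k \<ge> k0" "y \<in> C - D" "(y + real l) / 2 ^ k \<in> R - g ` D" by blast
    define n where "n = prod_encode (k - k0, l)"
    have Ty: "T n y \<in> R - g ` D" using kly(1,3) by (simp add: Tform n_def)
    have "T i ` ?P i \<subseteq> g ` D" for i
    proof (intro image_subsetI)
      fix z assume "z \<in> ?P i"
      then show "T i z \<in> g ` D" using gP[of z i] by (intro image_eqI[of _ _ z]) (auto simp: D_def)
    qed
    then have "\<forall>i<n. T n y \<notin> T i ` ?P i" using Ty by blast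
    moreover have "y \<notin> ?P i" for i using kly(2) by (auto simp: D_def)
    ultimately have "y \<in> ?P n" using Ty kly(2) matched_iff[of y T C R n] by blast
    then show False using kly(2) by (auto simp: D_def)
  qed
  show thesis
  proof (rule that[OF Dm DC null inj gR gm])
    fix y assume "y \<in> D"
    then obtain n where n: "y \<in> ?P n" by (auto simp: D_def)
    show "\<exists>k l::nat. g y = (y + real l) / 2 ^ k"
      unfolding gP[OF n] Tform[of n y]
      by (rule exI[of _ "k0 + fst (prod_decode n)"], rule exI[of _ "snd (prod_decode n)"], rule refl)
  qed
qed

section \<open>Saturated null sets\<close>

text \<open>Enlarging an exceptional null set to a union of orbits makes it invariant under every map with
  rational affine branches.\<close>

definition rat_saturation :: "real set \<Rightarrow> real set" where
  "rat_saturation N = {x\<in>{0..<1}. \<exists>y\<in>N. rat_rel y x}"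

lemma null_rat_saturation:
  assumes "N \<in> null_sets lebesgue" shows "rat_saturation N \<in> null_sets lebesgue"
proof -
  have "(\<Union>a\<in>{a\<in>\<rat>. 0 < a}. \<Union>b\<in>\<rat>. (\<lambda>x. b + a * x) ` N) \<in> null_sets lebesgue"
  proof (intro null_sets_UN')
    show "countable {a::real\<in>\<rat>. 0 < a}" by (rule countable_subset[OF _ countable_rat]) auto
    show "countable (\<rat> :: real set)" by (rule countable_rat)
    fix a b :: real assume "a \<in> {a\<in>\<rat>. 0 < a}" "b \<in> \<rat>"
    then have a: "a \<noteq> 0" by auto
    have "(\<lambda>x. b + a * x) ` N \<in> sets lebesgue" using assms a by (intro lebesgue_affine_image) auto
    moreover have "emeasure lebesgue ((\<lambda>x. b + a * x) ` N) = 0"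
      using assms unfolding emeasure_affine_image by (simp only: null_setsD1 mult_zero_right)
    ultimately show "(\<lambda>x. b + a * x) ` N \<in> null_sets lebesgue" by (simp only: null_sets_def mem_Collect_eq simp_thms)
  qed
  moreover have "rat_saturation N \<subseteq> (\<Union>a\<in>{a\<in>\<rat>. 0 < a}. \<Union>b\<in>\<rat>. (\<lambda>x. b + a * x) ` N)"
    unfolding rat_saturation_def rat_rel_def by blast
  ultimately show ?thesis using null_sets_completion_subset by blast
qed

lemma rat_saturation_closed: "x \<in> rat_saturation N \<Longrightarrow> rat_rel x y \<Longrightarrow> y \<in> {0..<1} \<Longrightarrow> y \<in> rat_saturation N"
  unfolding rat_saturation_def using rat_rel_trans by blast

lemma rat_saturation_superset: "N \<subseteq> {0..<1} \<Longrightarrow> N \<subseteq> rat_saturation N"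
  unfolding rat_saturation_def using rat_rel_refl by blast

section \<open>Representation of wavelet induced isomorphisms\<close>

lemma rat_rel_frac: "rat_rel x (frac (2 powi m * lift x))"
proof -
  obtain b where b: "b \<in> \<rat>" "lift x = b + x" using lift_rat by blast
  have "frac (2 powi m * lift x) = (2 powi m * b - of_int \<lfloor>2 powi m * lift x\<rfloor>) + 2 powi m * x"
    unfolding frac_def b(2) by (simp add: algebra_simps)
  moreover have "(2::real) powi m \<in> \<rat>" by (cases "0 \<le> m") (auto simp: power_int_def)
  ultimately show ?thesis using b(1) by (intro rat_relI[of "2 powi m" "2 powi m * b - of_int \<lfloor>2 powi m * lift x\<rfloor>"]) auto
qed

text \<open>Only \<open>l \<ge> 0\<close> has to be checked: \<open>2^m x\<close> is nonnegative, and \<open>y < 1\<close>.\<close>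

lemma inverse_of_expanding_frac:
  assumes x: "x \<in> {0..<1}" and m: "0 \<le> m" and y: "y = frac (2 powi m * lift x)"
  shows "\<exists>k l::nat. x = (y + real l) / 2 ^ k"
proof -
  obtain b :: int where b: "lift x = of_int b + x"
    by (cases "x < 1/2") (auto simp: lift_def intro: that[of "-1"] that[of 0])
  define k where "k = nat m"
  have p: "(2::real) powi m = 2 ^ k" using m by (simp add: k_def power_int_def)
  define j where "j = \<lfloor>2 ^ k * lift x\<rfloor> - 2 ^ k * b"
  have e: "2 ^ k * x = y + of_int j" unfolding y p frac_def j_def b by (simp add: algebra_simps)
  have "0 \<le> 2 ^ k * x" using x by simp
  moreover have "y < 1" unfolding y by (rule frac_lt_1)
  ultimately have "of_int j > (- 1 :: real)" using e by linarith
  then have "j \<ge> 0" by linarith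
  then have "x = (y + real (nat j)) / 2 ^ k" using e by (simp add: field_simps)
  then show ?thesis by blast
qed

text \<open>After division by a positive power of two, \<open>lift x\<close> lies in \<open>[-1/2,1/2)\<close> and has the sign it had
  before; the integer part is \<open>-1\<close> on the left half and zero on the right half.\<close>

lemma contracting_frac:
  assumes x: "x \<in> {0..<1}" and m: "m < 0"
  shows "frac (2 powi m * lift x) = (if x < 1/2 then 1 else 0) + lift x / 2 ^ nat (- m)"
proof -
  define k where "k = nat (- m)"
  have k: "k \<ge> 1" using m by (simp add: k_def)
  have p: "2 powi m * lift x = lift x / 2 ^ k" using m by (simp add: k_def power_int_def field_simps)
  have g: "(2::real) \<le> 2 ^ k" using k self_le_power[of "2::real" k] by simp
  have "\<bar>lift x\<bar> \<le> 1" using x by (auto simp: lift_def)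
  define q where "q = lift x / 2 ^ k"
  have "\<bar>q\<bar> = \<bar>lift x\<bar> / 2 ^ k" by (simp add: q_def)
  also have "\<dots> \<le> 1 / 2" using \<open>\<bar>lift x\<bar> \<le> 1\<close> g by (intro frac_le) auto
  finally have a: "\<bar>q\<bar> \<le> 1/2" .
  have "(x < 1/2 \<longrightarrow> q < 0) \<and> (\<not> x < 1/2 \<longrightarrow> 0 \<le> q)"
    using x by (auto simp: q_def lift_def divide_less_0_iff zero_le_divide_iff)
  then have "frac q = (if x < 1/2 then 1 else 0) + q"
    using a by (auto simp: frac_unique_iff abs_le_iff)
  then show ?thesis by (simp only: p k_def q_def)
qed

text \<open>Let \<open>Am\<close> be the set where the exponent is negative and \<open>Ap\<close> its complement. The map \<open>u\<close> is \<open>h\<close> on \<open>Am\<close>,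
  and \<open>v\<close> is the inverse of \<open>h\<close> on \<open>h ` Ap\<close>; on \<open>h ` Am\<close> it is a dyadic injection into \<open>Am\<close>, except
  for a saturated null set where it is the identity. Then the core agrees with \<open>Am\<close> up to a null set,
  because \<open>v \<circ> u\<close> shrinks measure.\<close>

theorem wavelet_induced_diamond:
  assumes h: "wavelet_induced h"
  shows "\<exists>u\<in>WI1. \<exists>v\<in>WI2. ae_eq h (u \<diamondop> v)"
proof -
  define A where "A = {0..<1::real}"
  obtain m :: "real \<Rightarrow> int" where bij: "bij_betw h A A"
    and hm: "\<And>x. x \<in> A \<Longrightarrow> h x = frac (2 powi (m x) * lift x)"
    and level: "\<And>k. {x\<in>A. m x = k} \<in> sets lebesgue"
    by (rule wavelet_inducedD[OF h, folded A_def]) (rule that)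
  note inj = bij_betw_imp_inj_on[OF bij]
  have hA: "h x \<in> A" if "x \<in> A" for x using bij_betw_apply[OF bij that] .
  have hrel: "rat_rel x (h x)" if "x \<in> A" for x unfolding hm[OF that] by (rule rat_rel_frac)
  define Am where "Am = {x\<in>A. m x < 0}"
  define Ap where "Ap = {x\<in>A. 0 \<le> m x}"
  have Am0: "A \<in> sets lebesgue" by (simp add: A_def)
  have AmA: "Am \<subseteq> A" and ApA: "Ap \<subseteq> A" by (auto simp: Am_def Ap_def)
  have A_split: "x \<in> Am \<or> x \<in> Ap" if "x \<in> A" for x using that by (auto simp: Am_def Ap_def)
  have disj: "Am \<inter> Ap = {}" by (auto simp: Am_def Ap_def)
  have levels: "{x\<in>A. m x \<in> S} \<in> sets lebesgue" for S
  proof -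
    have "{x\<in>A. m x \<in> S} = (\<Union>k\<in>S. {x\<in>A. m x = k})" by auto
    then show ?thesis using level by auto
  qed
  have Amm: "Am \<in> sets lebesgue" using levels[of "{..<0}"] by (simp add: Am_def)
  have Apm: "Ap \<in> sets lebesgue" using levels[of "{0..}"] by (simp add: Ap_def)
  have hmeas: "h \<in> borel_measurable (lebesgue_on A)"
  proof (rule borel_measurable_piecewise[where I="UNIV :: int set" and C="\<lambda>k. {x\<in>A. m x = k}" and g="\<lambda>k x. frac (2 powi k * lift x)"])
    have [measurable]: "lift \<in> borel_measurable borel" unfolding lift_def[abs_def] by measurable
    show "(\<lambda>x. frac (2 powi k * lift x)) \<in> borel_measurable lebesgue" for k :: int
      by (rule borel_imp_lebesgue_measurable) measurable
    show "{x\<in>A. m x = k} \<in> sets lebesgue" for k by (rule level)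
    show "h x = frac (2 powi k * lift x)" if "x \<in> {x\<in>A. m x = k}" for k x
      using hm[of x] that by blast
    show "A \<in> sets lebesgue" by (rule Am0)
  qed auto
  have hp: "rat_pieces h A" using hmeas hrel Am0 by (simp add: rat_pieces_def)
  have hAmm: "h ` Am \<in> sets lebesgue" and hApm: "h ` Ap \<in> sets lebesgue"
    by (intro rat_pieces_image_sets[OF hp] Amm Apm AmA ApA)+
  have hAmA: "h ` Am \<subseteq> A" using AmA hA by blast
  \<comment> \<open>If \<open>Am\<close> is null, so is \<open>h ` Am\<close>, and the empty injection suffices.\<close>
  obtain D g where D: "D \<in> sets lebesgue" "D \<subseteq> h ` Am" "h ` Am - D \<in> null_sets lebesgue"
    and g: "inj_on g D" "g ` D \<subseteq> Am" "g \<in> borel_measurable (lebesgue_on D)"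
       "\<And>y. y \<in> D \<Longrightarrow> \<exists>k l::nat. g y = (y + real l) / 2 ^ k"
  proof (cases "emeasure lebesgue Am > 0")
    case True
    show ?thesis by (rule dyadic_partial_injection[OF hAmm hAmA[unfolded A_def] Amm AmA[unfolded A_def] True]) (rule that)
  next
    case False
    then have "Am \<in> null_sets lebesgue" using Amm by (simp add: null_sets_def)
    then have "rat_saturation Am \<in> null_sets lebesgue" by (rule null_rat_saturation)
    moreover have "h ` Am \<subseteq> rat_saturation Am"
      using AmA hrel hA unfolding rat_saturation_def A_def[symmetric] by blast
    ultimately have "h ` Am \<in> null_sets lebesgue" using null_sets_completion_subset by blast
    then show ?thesis by (intro that[of "{}" "\<lambda>x. x"]) (auto simp: borel_measurable_lebesgue_on_iff)
  qed
  \<comment> \<open>The exceptional set. By saturation \<open>h\<close>, \<open>g\<close> and their inverses preserve both \<open>N\<close> and its complement,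
    so that the pieces of \<open>v\<close> cannot interfere with each other.\<close>
  define N where "N = rat_saturation (h ` Am - D)"
  have Nnull: "N \<in> null_sets lebesgue" unfolding N_def by (rule null_rat_saturation[OF D(3)])
  have NA: "N \<subseteq> A" unfolding N_def rat_saturation_def A_def by blast
  have DN: "h ` Am - D \<subseteq> N" unfolding N_def using hAmA by (intro rat_saturation_superset) (auto simp: A_def)
  have Nclosed: "x \<in> N \<longleftrightarrow> y \<in> N" if "rat_rel x y" "x \<in> A" "y \<in> A" for x y
    unfolding N_def using rat_saturation_closed[folded A_def] that rat_rel_sym by blast
  have hN: "h x \<in> N \<longleftrightarrow> x \<in> N" if "x \<in> A" for x using Nclosed[OF hrel[OF that] that hA[OF that]] by simp
  define ih where "ih = inv_into A h"
  have ih: "ih (h x) = x" if "x \<in> A" for x unfolding ih_def using inv_into_f_f[OF inj that] .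
  \<comment> \<open>Outside the exceptional set, the range of \<open>h\<close> splits according to the two branches of \<open>v\<close>.\<close>
  have split: "(\<exists>x\<in>Ap - N. y = h x) \<or> (y \<in> D \<and> (\<exists>x\<in>Am - N. y = h x))" if y: "y \<in> A" "y \<notin> N" for y
  proof -
    obtain x where x: "x \<in> A" "y = h x" using y(1) bij_betw_imp_surj_on[OF bij] by blast
    have xN: "x \<notin> N" using hN[OF x(1)] x(2) y(2) by simp
    show ?thesis using A_split[OF x(1)] DN x xN y by blast
  qed
  have hAp_D: "h ` Ap \<inter> D = {}"
  proof (rule ccontr)
    assume "h ` Ap \<inter> D \<noteq> {}"
    then obtain x x' where x: "x \<in> Ap" "x' \<in> Am" "h x = h x'" using D(2) by blast
    then have "x = x'" using inj_onD[OF inj] AmA ApA by blast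
    then show False using x disj by blast
  qed
  define v where "v y = (if y \<in> N then y else if y \<in> h ` Ap then ih y else g y)" for y
  have v_N: "v y = y" if "y \<in> N" for y using that by (simp add: v_def)
  have v_h: "v (h x) = x" if "x \<in> Ap" "x \<notin> N" for x
  proof -
    have "x \<in> A" using that ApA by blast
    then show ?thesis using that hN ih by (simp add: v_def)
  qed
  have v_D: "v y = g y" if "y \<in> D" "y \<notin> N" for y using that hAp_D by (auto simp: v_def)
  have g_rel: "rat_rel y (g y)" if "y \<in> D" for y
  proof -
    have "\<exists>k l::nat. g y = (y + real l) / 2 ^ k" by (rule g(4)[OF that])
    then obtain k l :: nat where "g y = (y + real l) / 2 ^ k" by blast
    then show ?thesis by (intro rat_relI[of "1 / 2 ^ k" "real l / 2 ^ k"]) (auto simp: field_simps)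
  qed
  have gN: "g y \<in> Am - N" if "y \<in> D" "y \<notin> N" for y
    using Nclosed[OF g_rel[OF that(1)]] that g(2) AmA D(2) hAmA by blast
  have vA: "v y \<in> A \<and> (y \<notin> N \<longrightarrow> v y \<notin> N)" if y: "y \<in> A" for y
  proof (cases "y \<in> N")
    case True then show ?thesis using v_N[OF True] y by simp
  next
    case False
    show ?thesis using split[OF y False]
    proof (elim disjE conjE bexE)
      fix x assume "x \<in> Ap - N" "y = h x"
      then show ?thesis using v_h[of x] ApA by auto
    next
      assume "y \<in> D"
      then show ?thesis using v_D[of y] gN[of y] False AmA by auto
    qed
  qed
  have v_inj: "inj_on v A"
  proof (rule inj_onI)
    fix y z assume yz: "y \<in> A" "z \<in> A" "v y = v z"
    show "y = z"
    proof (cases "y \<in> N \<or> z \<in> N")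
      case True
      then have "y \<in> N" "z \<in> N" using vA[OF yz(1)] vA[OF yz(2)] v_N yz(3) by metis+
      then show ?thesis using v_N yz(3) by simp
    next
      case False
      then have yN: "y \<notin> N" "z \<notin> N" by auto
      show ?thesis using split[OF yz(1) yN(1)] split[OF yz(2) yN(2)]
      proof (elim disjE conjE bexE)
        fix x x' assume "x \<in> Ap - N" "y = h x" "x' \<in> Ap - N" "z = h x'"
        then show ?thesis using v_h yz(3) by simp
      next
        fix x assume "x \<in> Ap - N" "y = h x" "z \<in> D"
        then have "v y \<in> Ap" "v z \<in> Am" using v_h v_D[of z] gN[of z] yN by auto
        then show ?thesis using disj yz(3) by auto
      next
        fix x assume "y \<in> D" "x \<in> Ap - N" "z = h x"
        then have "v z \<in> Ap" "v y \<in> Am" using v_h v_D[of y] gN[of y] yN by auto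
        then show ?thesis using disj yz(3) by auto
      next
        assume "y \<in> D" "z \<in> D"
        then show ?thesis using v_D yN yz(3) g(1) by (metis inj_onD)
      qed
    qed
  qed
  have v_form: "\<exists>k l::nat. v y = (y + real l) / 2 ^ k" if y: "y \<in> A" for y
  proof (cases "y \<in> N")
    case True
    then have "v y = (y + real 0) / 2 ^ 0" using v_N by simp
    then show ?thesis by blast
  next
    case False
    show ?thesis using split[OF y False]
    proof (elim disjE conjE bexE)
      fix x assume x: "x \<in> Ap - N" "y = h x"
      then have "x \<in> A" "0 \<le> m x" by (auto simp: Ap_def)
      then have "\<exists>k l::nat. x = (y + real l) / 2 ^ k" using inverse_of_expanding_frac[folded A_def] hm x(2) by blast
      then show ?thesis using v_h x by simp
    next
      assume "y \<in> D"
      then show ?thesis using g(4) v_D False by simp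
    qed
  qed
  have Nm: "N \<in> sets lebesgue" using Nnull by auto
  have v_meas: "v \<in> borel_measurable (lebesgue_on A)"
    unfolding borel_measurable_lebesgue_on_iff[OF Am0]
  proof
    fix t
    have eq: "{y\<in>A. t < v y} = (N \<inter> {t<..}) \<union> (h ` (Ap \<inter> {t<..}) - N) \<union> ({y\<in>D. t < g y} - N)"
    proof (intro set_eqI)
      fix y
      show "y \<in> {y\<in>A. t < v y} \<longleftrightarrow> y \<in> (N \<inter> {t<..}) \<union> (h ` (Ap \<inter> {t<..}) - N) \<union> ({y\<in>D. t < g y} - N)"
      proof (cases "y \<in> N")
        case True
        then show ?thesis using v_N[OF True] NA by auto
      next
        case False
        show ?thesis
        proof (cases "y \<in> h ` Ap")
          case True
          then obtain x where x: "x \<in> Ap" "y = h x" by blast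
          have xA: "x \<in> A" using x ApA by blast
          then have vy: "v y = x" "y \<in> A" using v_h[OF x(1)] x(2) hN[OF xA] False hA[OF xA] by auto
          have "y \<in> h ` (Ap \<inter> {t<..}) \<longleftrightarrow> t < x"
            using x ApA inj_onD[OF inj] xA by auto
          moreover have "y \<notin> D" using True hAp_D by blast
          ultimately show ?thesis using vy False by auto
        next
          case nAp: False
          show ?thesis
          proof (cases "y \<in> D")
            case True
            then have "v y = g y" "y \<in> A" using v_D False D(2) hAmA by auto
            then show ?thesis using True False nAp by auto
          next
            case nD: False
            have "y \<notin> A" using split[of y] False nAp nD by blast
            then show ?thesis using False nAp nD by auto
          qed
        qed
      qed
    qed
    have "h ` (Ap \<inter> {t<..}) \<in> sets lebesgue" using Apm ApA by (intro rat_pieces_image_sets[OF hp]) auto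
    moreover have "{y\<in>D. t < g y} \<in> sets lebesgue" using g(3) unfolding borel_measurable_lebesgue_on_iff[OF D(1)] by blast
    moreover have "N \<inter> {t<..} \<in> sets lebesgue" using Nm by auto
    ultimately show "{y\<in>A. t < v y} \<in> sets lebesgue" unfolding eq using Nm by auto
  qed
  have v: "v \<in> WI2" unfolding WI2_def A_def[symmetric] using vA v_meas v_inj v_form by blast
  \<comment> \<open>Outside \<open>Am\<close> any admissible exponent will do, since the core stays inside \<open>Am\<close>.\<close>
  define k where "k x = (if x \<in> Am then nat (- m x) else 1)" for x
  define u where "u x = (if x < 1/2 then 1 else 0) + lift x / 2 ^ k x" for x
  have u: "u \<in> WI1"
  proof (rule WI1I_level[of k, folded A_def])
    show "k x \<ge> 1" if "x \<in> A" for x using that by (auto simp: k_def Am_def)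
    fix j
    have eq: "{x\<in>A. k x = j} = {x\<in>A. m x \<in> {i. i < 0 \<and> nat (- i) = j}} \<union> (if j = 1 then Ap else {})"
      by (auto simp: k_def Am_def Ap_def)
    have "(if j = 1 then Ap else {}) \<in> sets lebesgue" using Apm by simp
    then show "{x\<in>A. k x = j} \<in> sets lebesgue" unfolding eq by (rule sets.Un[OF levels])
  qed (simp add: u_def)
  have u_Am: "u x = h x" if "x \<in> Am" for x
  proof -
    have x: "x \<in> A" "m x < 0" using that by (auto simp: Am_def)
    show ?thesis using contracting_frac[folded A_def, OF x] hm[OF x(1)] that by (simp add: u_def k_def)
  qed
  note uA = WI1_D(1)[OF u, folded A_def] and vfun = WI2_D(1)[OF v, folded A_def]
  note up = WI1_rat_pieces[OF u, folded A_def] and vp = WI2_rat_pieces[OF v, folded A_def]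
  let ?f = "v \<circ> u" and ?K = "scb_core A A u v"
  have step: "?f x \<in> Am - N" if "x \<in> Am - N" for x
  proof -
    have xA: "x \<in> A" using that AmA by blast
    have "h x \<in> D" "h x \<notin> N" using that DN hN[OF xA] by auto
    then show ?thesis using that gN v_D u_Am by auto
  qed
  have fA: "?f x \<in> A" if "x \<in> A" for x using that uA vfun by (auto simp: Pi_iff)
  \<comment> \<open>The range of \<open>v\<close> contains \<open>N\<close> and, outside of \<open>N\<close>, all of \<open>Ap\<close>. So the core starts inside \<open>Am - N\<close>, and
    by \<open>step\<close> it stays there.\<close>
  have outside: "x \<in> Am - N" if x: "x \<in> A" "x \<notin> v ` A" for x
  proof -
    have "x \<notin> N" using x v_N[of x] by (metis imageI)
    moreover have "x \<notin> Ap"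
    proof
      assume "x \<in> Ap"
      then have "x = v (h x)" using v_h \<open>x \<notin> N\<close> by simp
      then show False using x hA[OF x(1)] by (metis imageI)
    qed
    ultimately show ?thesis using A_split[OF x(1)] by blast
  qed
  have core: "?K \<subseteq> Am - N"
  proof -
    have "(?f ^^ n) a \<in> Am - N" if "a \<in> A - v ` A" for n a
      using that by (induction n) (use outside step in auto)
    then show ?thesis unfolding scb_core_def by blast
  qed
  \<comment> \<open>The points of \<open>Am - N\<close> with an infinite backward orbit in \<open>Am - N\<close>.\<close>
  define Z where "Z = (\<Inter>n. (?f ^^ n) ` (Am - N))"
  have Zsub: "(?f ^^ n) ` (Am - N) \<subseteq> Am - N" for n
  proof -
    have "(?f ^^ n) x \<in> Am - N" if "x \<in> Am - N" for x using that by (induction n) (use step in auto)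
    then show ?thesis by blast
  qed
  have images: "(?f ^^ n) ` (Am - N) \<in> sets lebesgue \<and> emeasure lebesgue ((?f ^^ n) ` (Am - N)) \<le> ennreal ((1/2) ^ n)" for n
  proof (induction n)
    case 0
    have "emeasure lebesgue (Am - N) \<le> emeasure lebesgue A" using Amm AmA Am0 by (intro emeasure_mono) auto
    moreover have "emeasure lebesgue A = 1" by (simp add: A_def)
    ultimately show ?case using Amm Nm by auto
  next
    case (Suc n)
    let ?X = "(?f ^^ n) ` (Am - N)"
    have eq: "(?f ^^ Suc n) ` (Am - N) = v ` u ` ?X" by (simp add: image_comp comp_assoc)
    have XA: "?X \<subseteq> A" using Zsub[of n] AmA by blast
    have uXA: "u ` ?X \<subseteq> A" by (intro image_subsetI funcset_mem[OF uA]) (use XA in blast)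
    have uX: "u ` ?X \<in> sets lebesgue" by (rule rat_pieces_image_sets[OF up conjunct1[OF Suc] XA])
    have "emeasure lebesgue (v ` u ` ?X) \<le> ennreal 1 * emeasure lebesgue (u ` ?X)"
      using uXA by (intro rat_pieces_image_le[OF vp uX uXA] WI2_slope[OF v, folded A_def]) blast
    also have "\<dots> \<le> ennreal (1/2) * emeasure lebesgue ?X"
      unfolding ennreal_1 mult_1
      using Suc XA by (intro rat_pieces_image_le[OF up _ XA] WI1_slope[OF u, folded A_def]) blast+
    also have "\<dots> \<le> ennreal (1/2) * ennreal ((1/2) ^ n)" by (rule mult_left_mono[OF conjunct2[OF Suc]]) simp
    also have "\<dots> = ennreal ((1/2) ^ Suc n)" by (subst ennreal_mult[symmetric]) simp_all
    finally show ?case unfolding eq using rat_pieces_image_sets[OF vp uX uXA] by blast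
  qed
  have Znull: "Z \<in> null_sets lebesgue"
  proof -
    have Zm: "Z \<in> sets lebesgue" unfolding Z_def by (intro sets.countable_INT'' conjunct1[OF images]) auto
    have "emeasure lebesgue Z \<le> ennreal ((1/2) ^ n)" for n
    proof -
      have "emeasure lebesgue Z \<le> emeasure lebesgue ((?f ^^ n) ` (Am - N))"
        by (rule emeasure_mono[OF _ conjunct1[OF images]]) (auto simp: Z_def)
      then show ?thesis using conjunct2[OF images] by (rule order_trans)
    qed
    moreover have "(\<lambda>n. ennreal ((1/2) ^ n)) \<longlonglongrightarrow> ennreal 0"
      by (intro tendsto_ennrealI LIMSEQ_power_zero) simp
    ultimately have "emeasure lebesgue Z \<le> ennreal 0" by (intro LIMSEQ_le_const[where X="\<lambda>n. ennreal ((1/2) ^ n)"]) auto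
    then show ?thesis using Zm by (simp add: null_sets_def)
  qed
  \<comment> \<open>A point of \<open>Am - N\<close> outside the core is in the range of \<open>v\<close>, and its \<open>v\<close>-preimage can only lie in \<open>D\<close>:
    this gives a preimage under \<open>v \<circ> u\<close> of the same kind, and so on.\<close>
  have rest: "x \<in> Z" if x: "x \<in> Am - N" "x \<notin> ?K" for x
  proof -
    have "x \<in> (?f ^^ n) ` (Am - N)" for n
      using x
    proof (induction n arbitrary: x)
      case 0 then show ?case by simp
    next
      case (Suc n)
      have xA: "x \<in> A" using Suc AmA by blast
      have "x \<in> v ` A" using Suc(3) scb_core_base[of A v A u] xA by blast
      then obtain y where y: "y \<in> A" "x = v y" by blast
      have yN: "y \<notin> N" using y v_N Suc(2) by auto
      have "y \<notin> h ` (Ap - N)" using y v_h Suc(2) disj by auto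
      then obtain z where z: "y \<in> D" "z \<in> Am - N" "y = h z" using split[OF y(1) yN] by blast
      then have xz: "x = ?f z" using y u_Am by simp
      have "z \<notin> ?K"
      proof
        assume "z \<in> ?K"
        then have "v (u z) \<in> ?K" by (rule scb_core_step)
          then have "x \<in> ?K" using xz by simp
        then show False using Suc(3) by simp
      qed
      then obtain w where w: "w \<in> Am - N" "z = (?f ^^ n) w" using Suc.IH[OF z(2)] by blast
      then have "x = (?f ^^ Suc n) w" using xz by simp
      then show ?case using w(1) by blast
    qed
    then show ?thesis by (simp add: Z_def)
  qed
  have eq: "h x = scb_map A A u v x" if x: "x \<in> A" "x \<notin> N" "x \<notin> Z" for x
  proof (cases "x \<in> Ap")
    case True
    then have "x \<notin> ?K" using core disj by blast
    then have "scb_map A A u v x = inv_into A v x" by (rule scb_map_outside_core[OF x(1)])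
    also have "\<dots> = h x" by (rule inv_into_f_eq[OF v_inj hA[OF x(1)] v_h[OF True x(2)]])
    finally show ?thesis by simp
  next
    case False
    then have "x \<in> Am - N" using A_split x by blast
    then have "x \<in> ?K" using rest x(3) by blast
    then have "scb_map A A u v x = u x" by (rule scb_map_core)
    then show ?thesis using u_Am \<open>x \<in> Am - N\<close> by simp
  qed
  have "ae_eq h (u \<diamondop> v)"
    unfolding ae_eq_def A_def[symmetric]
  proof -
    have "AE x in lebesgue. x \<notin> N" "AE x in lebesgue. x \<notin> Z" using Nnull Znull by (auto intro: AE_not_in)
    then have "AE x in lebesgue. x \<in> A \<longrightarrow> h x = scb_map A A u v x"
      by eventually_elim (use eq in blast)
    then show "AE x in lebesgue_on A. h x = scb_map A A u v x"
      using Am0 by (subst AE_restrict_space_iff) auto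
  qed
  then show ?thesis using u v by blast
qed

theorem theorem3p3:
  shows "(\<forall>h. wavelet_induced h \<longrightarrow> (\<exists>u\<in>WI1. \<exists>v\<in>WI2. ae_eq h (u \<diamondop> v))) \<and>
    (\<forall>u\<in>WI1. \<forall>v\<in>WI2. wavelet_induced (u \<diamondop> v)) \<and>
    (\<exists>h. wavelet_induced h \<and>
      (\<exists>u\<in>WI1. \<exists>v\<in>WI2. \<exists>u'\<in>WI1. \<exists>v'\<in>WI2.
        ae_eq h (u \<diamondop> v) \<and> ae_eq h (u' \<diamondop> v') \<and> \<not> (ae_eq u u' \<and> ae_eq v v')))"
  by (intro conjI allI ballI impI wavelet_induced_diamond diamond_wavelet_induced diamond_not_unique)

end
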